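(* Let $R$ be a ring, $\delta$ a derivation on $R$, $M$ an $R$-bimodule and $d$ a $\delta$-derivation on $M$. (1) The extension of $\delta$ on any symmetric ring of quotients of $R$ with respect to a hereditary and faithful symmetric torsion theory agrees with the extension of $\delta$ on $Q^{\sigma}_{\mathrm{max}}(R)$. In particular, the extensions of $\delta$ on $Q^{\sigma}_{\mathrm{tot}}(R)$ and $Q^{\sigma}_{\mathrm{max}}(R)$ agree. (2) The extension of $d$ on any module of quotients of $M$ with respect to a differential, hereditary and faithful symmetric torsion theory agrees with the extension of $d$ on the module of quotients of $M$ with respect to the symmetric Lambek torsion theory. In particular, the extensions of $d$ on the modules of quotients of $M$ with respect to the symmetric Lambek torsion theory and the maximal perfect symmetric torsion theory agree. (3) If $R$ is (left and right) Ore and $Q_{\mathrm{cl}}(R)$ is its classical ring of quotients, then the extension of $\delta$ on $Q_{\mathrm{cl}}(R)$ agrees with the extensions of $\delta$ on $Q^{\sigma}_{\mathrm{max}}(R)$ and $Q^{\sigma}_{\mathrm{tot}}(R)$. (4) The extensions of $\delta$ on $Q^{\sigma}_{\mathrm{max}}(R)$ and $Q^{\sigma}_{\mathrm{Gol}}(R)$ agree. Moreover, the extension of $\delta$ on any symmetric ring of quotients of $R$ with respect to a hereditary and faithful symmetric torsion theory agrees with the extension of $\delta$ on $Q^{\sigma}_{\mathrm{Gol}}(R)$.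
   Context: Rings are associative with identity and modules are unital. Derivations. A derivation on a ring $R$ is an additive map $\delta:R\to R$ with $\delta(rs)=\delta(r)s+r\delta(s)$. For an $R$-bimodule $M$, a $\delta$-derivation on $M$ is an additive map $d:M\to M$ with $d(xr)=d(x)r+x\delta(r)$ and $d(rx)=\delta(r)x+rd(x)$ for all $x\in M$, $r\in R$. Symmetric filters. An $R$-bimodule $M$ is a right $R\otimes_{\mathbb{Z}}R^{op}$-module via $x(r\otimes s)=sxr$. If $\mathfrak{F}_l$ is a Gabriel filter of left ideals and $\mathfrak{F}_r$ a Gabriel filter of right ideals of $R$, with hereditary torsion theories $\tau_l,\tau_r$, the symmetric filter ${}_l\mathfrak{F}_r$ induced by them is the set of right ideals of $R\otimes_{\mathbb{Z}}R^{op}$ containing one of the form $J\otimes R^{op}+R\otimes I$ (the sum of the images in $R\otimes_{\mathbb{Z}}R^{op}$) with $I\in\mathfrak{F}_l$, $J\in\mathfrak{F}_r$. It is a Gabriel filter; its (hereditary) torsion theory ${}_l\tau_r$ has torsion submodule ${}_l\mathcal{T}_r(M)=\mathcal{T}_l(M)\cap\mathcal{T}_r(M)$ and is called the symmetric torsion theory induced by $\tau_l$ and $\tau_r$. It is faithful if ${}_l\mathcal{T}_r(R)=0$. ${}_l\mathfrak{F}_r$ (or ${}_l\tau_r$) is differential if for every $I\in{}_l\mathfrak{F}_r$ there is $J\in{}_l\mathfrak{F}_r$ such that $\overline{\delta}(J)\subseteq I$ for all derivations $\overline{\delta}$ of the ring $R\otimes_{\mathbb{Z}}R^{op}$ (every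 derivation $\delta$ on $R$ determines such a derivation by $\overline{\delta}(r\otimes s)=\delta(r)\otimes s+r\otimes\delta(s)$). Symmetric modules of quotients. ${}_lM_r=\varinjlim_{K\in{}_l\mathfrak{F}_r}\mathrm{Hom}(K,M/{}_l\mathcal{T}_r(M))$ (homomorphisms of right $R\otimes_{\mathbb{Z}}R^{op}$-modules) is the (symmetric) module of quotients of $M$. The map $q_M:M\to{}_lM_r$ sends $m$ to the class of $t\mapsto(m+{}_l\mathcal{T}_r(M))t$. For $M=R$, ${}_lR_r$ (also written ${}_{\mathfrak{F}_l}R_{\mathfrak{F}_r}$) is a ring, the symmetric ring of quotients, and $q_R$ is a ring homomorphism. Extensions and agreement. A $\delta$-derivation $d$ on $M$ extends to ${}_lM_r$ if there is a $\delta$-derivation $d'$ on the bimodule ${}_lM_r$ with $d'q_M=q_Md$ (such a $d'$ is unique if it exists). For symmetric filters ${}_l\mathfrak{F}_r^1\subseteq{}_l\mathfrak{F}_r^2$ with torsion submodules ${}_l\mathcal{T}_r^i(M)$, quotients ${}_lM_r^i$ and maps $q_i:M\to{}_lM_r^i$, let $q_{12}:{}_lM_r^1\to{}_lM_r^2$ send the class of $f:K\to M/{}_l\mathcal{T}_r^1(M)$ to the class of its composite with the projection $M/{}_l\mathcal{T}_r^1(M)\to M/{}_l\mathcal{T}_r^2(M)$; then $q_{12}q_1=q_2$. The extensions of $d$ on ${}_lM_r^1$ and ${}_lM_r^2$ agree if $d$ extends to $\delta$-derivations $d_i$ on ${}_lM_r^i$ with $d_1q_1=q_1d$, $d_2q_2=q_2d$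 and $d_2q_{12}=q_{12}d_1$. For rings of quotients take $M=R$, $d=\delta$. Particular theories. - Symmetric Lambek torsion theory: induced by the filters of dense left ideals and dense right ideals; its symmetric ring of quotients is the maximal symmetric ring of quotients $Q^{\sigma}_{\mathrm{max}}(R)$. - Perfect symmetric: a ring homomorphism $f:R\to S$ makes $S$ a perfect symmetric ring of quotients if $\mathfrak{F}_l=\{I\text{ left ideal}: Sf(I)=S\}$ and $\mathfrak{F}_r=\{J\text{ right ideal}: f(J)S=S\}$ are Gabriel filters and there is a ring isomorphism $g:S\cong{}_{\mathfrak{F}_l}R_{\mathfrak{F}_r}$ with $g\circ f=q_R$; the filter and torsion theory induced by these $\mathfrak{F}_l,\mathfrak{F}_r$ are then called perfect. Every ring has a largest perfect symmetric ring of quotients, the total symmetric ring of quotients $Q^{\sigma}_{\mathrm{tot}}(R)$, and $R\subseteq Q^{\sigma}_{\mathrm{tot}}(R)\subseteq Q^{\sigma}_{\mathrm{max}}(R)$; its torsion theory is the maximal perfect symmetric torsion theory. - Classical: if $R$ is left and right Ore with set of regular elements $T$, the classical torsion theory for $R$-bimodules is the one in which $M$ is torsion iff for every $m\in M$ there are nonzero $t,s\in T$ with $sm=mt=0$; it is induced by the left and right classical torsion theories, and its symmetric ring of quotients is $Q_{\mathrm{cl}}(R)$, the common left and right classical ring of quotients. - Symmetric Goldie torsion theory: induced by the left and right torsion theories whose torsion-free classes are the nonsingular left modules and nonsingular right modules; its symmetric ring of quotients is $Q^{\sigma}_{\mathrm{Gol}}(R)$.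
   Formalization: Faithful (T_l∩T_r zero on R) does not force the filter to be comparable with the Lambek or Goldie one, so "agree" can be undefined; in (1), (2), (4) agreement is stated for filters nested in either order, with inclusion proved when both one-sided torsion parts of R vanish. *)

theory Defs
  imports "HOL-Library.Poly_Mapping" "HOL-Algebra.QuotRing" "HOL-Algebra.Generated_Groups"
begin

section \<open>One-sided modules, bimodules and derivations\<close>

text \<open>As for the library's record of modules, the fields of a bimodule coming from
  \<^type>\<open>ring\<close> only serve to provide the additive group; \<open>mult\<close> and \<open>one\<close> are ignored.
  A left (right) module is an element of the same record type of which only the left
  (right) action is used.\<close>

record ('a, 'm) bimodule = "'m ring" +
  lsmult :: "'a \<Rightarrow> 'm \<Rightarrow> 'm"
  rsmult :: "'m \<Rightarrow> 'a \<Rightarrow> 'm"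

locale left_module = R?: ring R + M?: abelian_group M
  for R :: "('a, 'c) ring_scheme" (structure)
    and M :: "('a, 'm, 'e) bimodule_scheme" (structure) +
  assumes lsmult_closed:
      "\<lbrakk>a \<in> carrier R; x \<in> carrier M\<rbrakk> \<Longrightarrow> lsmult M a x \<in> carrier M"
    and lsmult_l_distr:
      "\<lbrakk>a \<in> carrier R; b \<in> carrier R; x \<in> carrier M\<rbrakk> \<Longrightarrow>
        lsmult M (a \<oplus>\<^bsub>R\<^esub> b) x = lsmult M a x \<oplus>\<^bsub>M\<^esub> lsmult M b x"
    and lsmult_r_distr:
      "\<lbrakk>a \<in> carrier R; x \<in> carrier M; y \<in> carrier M\<rbrakk> \<Longrightarrow>
        lsmult M a (x \<oplus>\<^bsub>M\<^esub> y) = lsmult M a x \<oplus>\<^bsub>M\<^esub> lsmult M a y"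
    and lsmult_assoc:
      "\<lbrakk>a \<in> carrier R; b \<in> carrier R; x \<in> carrier M\<rbrakk> \<Longrightarrow>
        lsmult M (a \<otimes>\<^bsub>R\<^esub> b) x = lsmult M a (lsmult M b x)"
    and lsmult_one: "x \<in> carrier M \<Longrightarrow> lsmult M \<one>\<^bsub>R\<^esub> x = x"

locale right_module = R?: ring R + M?: abelian_group M
  for R :: "('a, 'c) ring_scheme" (structure)
    and M :: "('a, 'm, 'e) bimodule_scheme" (structure) +
  assumes rsmult_closed:
      "\<lbrakk>a \<in> carrier R; x \<in> carrier M\<rbrakk> \<Longrightarrow> rsmult M x a \<in> carrier M"
    and rsmult_r_distr:
      "\<lbrakk>a \<in> carrier R; b \<in> carrier R; x \<in> carrier M\<rbrakk> \<Longrightarrow>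
        rsmult M x (a \<oplus>\<^bsub>R\<^esub> b) = rsmult M x a \<oplus>\<^bsub>M\<^esub> rsmult M x b"
    and rsmult_l_distr:
      "\<lbrakk>a \<in> carrier R; x \<in> carrier M; y \<in> carrier M\<rbrakk> \<Longrightarrow>
        rsmult M (x \<oplus>\<^bsub>M\<^esub> y) a = rsmult M x a \<oplus>\<^bsub>M\<^esub> rsmult M y a"
    and rsmult_assoc:
      "\<lbrakk>a \<in> carrier R; b \<in> carrier R; x \<in> carrier M\<rbrakk> \<Longrightarrow>
        rsmult M x (a \<otimes>\<^bsub>R\<^esub> b) = rsmult M (rsmult M x a) b"
    and rsmult_one: "x \<in> carrier M \<Longrightarrow> rsmult M x \<one>\<^bsub>R\<^esub> = x"

locale bimodule = left_module R M + right_module R M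
  for R :: "('a, 'c) ring_scheme" (structure)
    and M :: "('a, 'm, 'e) bimodule_scheme" (structure) +
  assumes lsmult_rsmult:
      "\<lbrakk>a \<in> carrier R; b \<in> carrier R; x \<in> carrier M\<rbrakk> \<Longrightarrow>
        rsmult M (lsmult M a x) b = lsmult M a (rsmult M x b)"

definition regular_bimodule :: "('a, 'c) ring_scheme \<Rightarrow> ('a, 'a) bimodule" where
  "regular_bimodule R =
     \<lparr>carrier = carrier R, monoid.mult = monoid.mult R, monoid.one = monoid.one R,
      ring.zero = ring.zero R, ring.add = ring.add R,
      lsmult = monoid.mult R, rsmult = monoid.mult R\<rparr>"

text \<open>The quotient of \<open>M\<close> by a subbimodule \<open>N\<close>; the operations on cosets are written in the
  style of \<^const>\<open>rcoset_mult\<close>.\<close>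

definition quotient_bimodule ::
    "('a, 'm, 'e) bimodule_scheme \<Rightarrow> 'm set \<Rightarrow> ('a, 'm set) bimodule" where
  "quotient_bimodule M N =
     \<lparr>carrier = a_rcosets\<^bsub>M\<^esub> N, monoid.mult = undefined, monoid.one = undefined,
      ring.zero = N, ring.add = set_add M,
      lsmult = (\<lambda>a X. \<Union>x\<in>X. N +>\<^bsub>M\<^esub> lsmult M a x),
      rsmult = (\<lambda>X a. \<Union>x\<in>X. N +>\<^bsub>M\<^esub> rsmult M x a)\<rparr>"

definition derivation :: "('a, 'c) ring_scheme \<Rightarrow> ('a \<Rightarrow> 'a) \<Rightarrow> bool" where
  "derivation R \<delta> \<longleftrightarrow>
     \<delta> \<in> carrier R \<rightarrow> carrier R \<and>
     (\<forall>r\<in>carrier R. \<forall>s\<in>carrier R. \<delta> (r \<oplus>\<^bsub>R\<^esub> s) = \<delta> r \<oplus>\<^bsub>R\<^esub> \<delta> s) \<and>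
     (\<forall>r\<in>carrier R. \<forall>s\<in>carrier R. \<delta> (r \<otimes>\<^bsub>R\<^esub> s) = \<delta> r \<otimes>\<^bsub>R\<^esub> s \<oplus>\<^bsub>R\<^esub> r \<otimes>\<^bsub>R\<^esub> \<delta> s)"

definition module_derivation ::
    "('a, 'c) ring_scheme \<Rightarrow> ('a, 'm, 'e) bimodule_scheme \<Rightarrow> ('a \<Rightarrow> 'a) \<Rightarrow> ('m \<Rightarrow> 'm) \<Rightarrow> bool" where
  "module_derivation R M \<delta> d \<longleftrightarrow>
     d \<in> carrier M \<rightarrow> carrier M \<and>
     (\<forall>x\<in>carrier M. \<forall>y\<in>carrier M. d (x \<oplus>\<^bsub>M\<^esub> y) = d x \<oplus>\<^bsub>M\<^esub> d y) \<and>
     (\<forall>x\<in>carrier M. \<forall>r\<in>carrier R. d (rsmult M x r) = rsmult M (d x) r \<oplus>\<^bsub>M\<^esub> rsmult M x (\<delta> r)) \<and>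
     (\<forall>x\<in>carrier M. \<forall>r\<in>carrier R. d (lsmult M r x) = lsmult M (\<delta> r) x \<oplus>\<^bsub>M\<^esub> lsmult M r (d x))"

section \<open>The enveloping ring\<close>

text \<open>\<open>R \<otimes> R\<^sup>o\<^sup>p\<close> is constructed as the quotient of the integral monoid ring of the multiplicative
  monoid \<open>R \<times> R\<^sup>o\<^sup>p\<close> by the ideal generated by the bilinearity relations. The set of relations is
  stable under multiplication by basis elements, so this ideal is also the additive subgroup
  generated by the relations, and the additive group of the quotient is the tensor product
  over the integers.\<close>

definition pair_monoid_ring :: "('a, 'c) ring_scheme \<Rightarrow> ('a \<times> 'a \<Rightarrow>\<^sub>0 int) ring" where
  "pair_monoid_ring R =
     \<lparr>carrier = {u. Poly_Mapping.keys u \<subseteq> carrier R \<times> carrier R},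
      monoid.mult = (\<lambda>u v. \<Sum>p\<in>Poly_Mapping.keys u. \<Sum>q\<in>Poly_Mapping.keys v.
                Poly_Mapping.single (fst p \<otimes>\<^bsub>R\<^esub> fst q, snd q \<otimes>\<^bsub>R\<^esub> snd p)
                  (Poly_Mapping.lookup u p * Poly_Mapping.lookup v q)),
      monoid.one = Poly_Mapping.single (\<one>\<^bsub>R\<^esub>, \<one>\<^bsub>R\<^esub>) 1, ring.zero = 0, ring.add = (+)\<rparr>"

definition bilinear_relations :: "('a, 'c) ring_scheme \<Rightarrow> ('a \<times> 'a \<Rightarrow>\<^sub>0 int) set" where
  "bilinear_relations R =
     {Poly_Mapping.single (r \<oplus>\<^bsub>R\<^esub> r', s) 1 - Poly_Mapping.single (r, s) 1 - Poly_Mapping.single (r', s) 1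
       | r r' s. r \<in> carrier R \<and> r' \<in> carrier R \<and> s \<in> carrier R} \<union>
     {Poly_Mapping.single (r, s \<oplus>\<^bsub>R\<^esub> s') 1 - Poly_Mapping.single (r, s) 1 - Poly_Mapping.single (r, s') 1
       | r s s'. r \<in> carrier R \<and> s \<in> carrier R \<and> s' \<in> carrier R}"

definition bilinear_ideal :: "('a, 'c) ring_scheme \<Rightarrow> ('a \<times> 'a \<Rightarrow>\<^sub>0 int) set" where
  "bilinear_ideal R = Idl\<^bsub>pair_monoid_ring R\<^esub> (bilinear_relations R)"

type_synonym 'a tensor = "('a \<times> 'a \<Rightarrow>\<^sub>0 int) set"

definition env_ring :: "('a, 'c) ring_scheme \<Rightarrow> 'a tensor ring" where
  "env_ring R = pair_monoid_ring R Quot bilinear_ideal R"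

definition pure_tensor :: "('a, 'c) ring_scheme \<Rightarrow> 'a \<Rightarrow> 'a \<Rightarrow> 'a tensor" where
  "pure_tensor R r s = bilinear_ideal R +>\<^bsub>pair_monoid_ring R\<^esub> Poly_Mapping.single (r, s) 1"

text \<open>The right action of \<open>R \<otimes> R\<^sup>o\<^sup>p\<close> on a bimodule, \<open>x (r \<otimes> s) = s x r\<close>; the value
  does not depend on the representative \<open>u\<close> of the coset \<open>t\<close>.\<close>

definition env_act ::
    "('a, 'm, 'e) bimodule_scheme \<Rightarrow> 'm \<Rightarrow> 'a tensor \<Rightarrow> 'm" where
  "env_act M x t =
     the_elem ((\<lambda>u. \<Oplus>\<^bsub>M\<^esub>p\<in>Poly_Mapping.keys u.
       [Poly_Mapping.lookup u p] \<cdot>\<^bsub>M\<^esub> lsmult M (snd p) (rsmult M x (fst p))) ` t)"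

section \<open>Gabriel filters and symmetric filters\<close>

definition left_ideal :: "('a, 'c) ring_scheme \<Rightarrow> 'a set \<Rightarrow> bool" where
  "left_ideal R I \<longleftrightarrow> additive_subgroup I R \<and> (\<forall>a\<in>I. \<forall>r\<in>carrier R. r \<otimes>\<^bsub>R\<^esub> a \<in> I)"

definition right_ideal :: "('a, 'c) ring_scheme \<Rightarrow> 'a set \<Rightarrow> bool" where
  "right_ideal R I \<longleftrightarrow> additive_subgroup I R \<and> (\<forall>a\<in>I. \<forall>r\<in>carrier R. a \<otimes>\<^bsub>R\<^esub> r \<in> I)"

definition left_colon :: "('a, 'c) ring_scheme \<Rightarrow> 'a set \<Rightarrow> 'a \<Rightarrow> 'a set" where
  "left_colon R I a = {x \<in> carrier R. x \<otimes>\<^bsub>R\<^esub> a \<in> I}"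

definition right_colon :: "('a, 'c) ring_scheme \<Rightarrow> 'a set \<Rightarrow> 'a \<Rightarrow> 'a set" where
  "right_colon R I a = {x \<in> carrier R. a \<otimes>\<^bsub>R\<^esub> x \<in> I}"

definition left_gabriel_filter :: "('a, 'c) ring_scheme \<Rightarrow> 'a set set \<Rightarrow> bool" where
  "left_gabriel_filter R F \<longleftrightarrow>
     F \<noteq> {} \<and> (\<forall>I\<in>F. left_ideal R I) \<and>
     (\<forall>I\<in>F. \<forall>J. left_ideal R J \<and> I \<subseteq> J \<longrightarrow> J \<in> F) \<and>
     (\<forall>I\<in>F. \<forall>J\<in>F. I \<inter> J \<in> F) \<and>
     (\<forall>I\<in>F. \<forall>a\<in>carrier R. left_colon R I a \<in> F) \<and>
     (\<forall>I. \<forall>J\<in>F. left_ideal R I \<and> (\<forall>a\<in>J. left_colon R I a \<in> F) \<longrightarrow> I \<in> F)"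

definition right_gabriel_filter :: "('a, 'c) ring_scheme \<Rightarrow> 'a set set \<Rightarrow> bool" where
  "right_gabriel_filter R F \<longleftrightarrow>
     F \<noteq> {} \<and> (\<forall>I\<in>F. right_ideal R I) \<and>
     (\<forall>I\<in>F. \<forall>J. right_ideal R J \<and> I \<subseteq> J \<longrightarrow> J \<in> F) \<and>
     (\<forall>I\<in>F. \<forall>J\<in>F. I \<inter> J \<in> F) \<and>
     (\<forall>I\<in>F. \<forall>a\<in>carrier R. right_colon R I a \<in> F) \<and>
     (\<forall>I. \<forall>J\<in>F. right_ideal R I \<and> (\<forall>a\<in>J. right_colon R I a \<in> F) \<longrightarrow> I \<in> F)"

definition left_torsion ::
    "('a, 'm, 'e) bimodule_scheme \<Rightarrow> 'a set set \<Rightarrow> 'm set" where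
  "left_torsion M F = {x \<in> carrier M. \<exists>I\<in>F. \<forall>a\<in>I. lsmult M a x = \<zero>\<^bsub>M\<^esub>}"

definition right_torsion ::
    "('a, 'm, 'e) bimodule_scheme \<Rightarrow> 'a set set \<Rightarrow> 'm set" where
  "right_torsion M F = {x \<in> carrier M. \<exists>J\<in>F. \<forall>a\<in>J. rsmult M x a = \<zero>\<^bsub>M\<^esub>}"

text \<open>A symmetric theory is given by a pair consisting of a Gabriel filter of left ideals and
  a Gabriel filter of right ideals.\<close>

type_synonym 'a filter_pair = "'a set set \<times> 'a set set"

definition gabriel_pair :: "('a, 'c) ring_scheme \<Rightarrow> 'a filter_pair \<Rightarrow> bool" where
  "gabriel_pair R F \<longleftrightarrow> left_gabriel_filter R (fst F) \<and> right_gabriel_filter R (snd F)"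

definition symmetric_filter :: "('a, 'c) ring_scheme \<Rightarrow> 'a filter_pair \<Rightarrow> 'a tensor set set" where
  "symmetric_filter R F =
     {K. right_ideal (env_ring R) K \<and>
         (\<exists>I\<in>fst F. \<exists>J\<in>snd F.
           generate (add_monoid (env_ring R)) {pure_tensor R j s | j s. j \<in> J \<and> s \<in> carrier R}
             <+>\<^bsub>env_ring R\<^esub>
           generate (add_monoid (env_ring R)) {pure_tensor R r i | r i. r \<in> carrier R \<and> i \<in> I} \<subseteq> K)}"

definition symmetric_torsion ::
    "('a, 'm, 'e) bimodule_scheme \<Rightarrow> 'a filter_pair \<Rightarrow> 'm set" where
  "symmetric_torsion M F = left_torsion M (fst F) \<inter> right_torsion M (snd F)"

definition faithful :: "('a, 'c) ring_scheme \<Rightarrow> 'a filter_pair \<Rightarrow> bool" where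
  "faithful R F \<longleftrightarrow> symmetric_torsion (regular_bimodule R) F = {\<zero>\<^bsub>R\<^esub>}"

text \<open>This is stronger than \<^term>\<open>faithful R F\<close>, which only concerns the intersection of the two
  torsion submodules. For instance, if \<open>fst F\<close> consists of the dense left ideals and \<open>snd F\<close> of
  all right ideals, then \<open>F\<close> is faithful, but in general not contained in the symmetric Lambek
  filter; its ring of quotients is the maximal left ring of quotients.\<close>

definition faithful_on_both_sides :: "('a, 'c) ring_scheme \<Rightarrow> 'a filter_pair \<Rightarrow> bool" where
  "faithful_on_both_sides R F \<longleftrightarrow>
     left_torsion (regular_bimodule R) (fst F) = {\<zero>\<^bsub>R\<^esub>} \<and>
     right_torsion (regular_bimodule R) (snd F) = {\<zero>\<^bsub>R\<^esub>}"

definition differential :: "('a, 'c) ring_scheme \<Rightarrow> 'a filter_pair \<Rightarrow> bool" where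
  "differential R F \<longleftrightarrow>
     (\<forall>I\<in>symmetric_filter R F. \<exists>J\<in>symmetric_filter R F.
        \<forall>D. derivation (env_ring R) D \<longrightarrow> D ` J \<subseteq> I)"

section \<open>Symmetric modules and rings of quotients\<close>

definition torsionfree_quotient ::
    "('a, 'm, 'e) bimodule_scheme \<Rightarrow> 'a filter_pair \<Rightarrow> ('a, 'm set) bimodule" where
  "torsionfree_quotient M F = quotient_bimodule M (symmetric_torsion M F)"

definition env_hom ::
    "('a, 'c) ring_scheme \<Rightarrow> 'a tensor set \<Rightarrow> ('a, 'm, 'e) bimodule_scheme \<Rightarrow> ('a tensor \<Rightarrow> 'm) set" where
  "env_hom R K N =
     {f \<in> K \<rightarrow> carrier N.
        (\<forall>k\<in>K. \<forall>l\<in>K. f (k \<oplus>\<^bsub>env_ring R\<^esub> l) = f k \<oplus>\<^bsub>N\<^esub> f l) \<and>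
        (\<forall>k\<in>K. \<forall>t\<in>carrier (env_ring R). f (k \<otimes>\<^bsub>env_ring R\<^esub> t) = env_act N (f k) t)}"

text \<open>The direct limit is the set of equivalence classes of pairs \<open>(K, f)\<close>. Two pairs are
  equivalent if the homomorphisms agree on a smaller member of the filter; the values of \<open>f\<close>
  outside of \<open>K\<close> are therefore irrelevant.\<close>

type_synonym ('a, 'm) germ = "('a tensor set \<times> ('a tensor \<Rightarrow> 'm set)) set"

definition partial_homs ::
    "('a, 'c) ring_scheme \<Rightarrow> ('a, 'm, 'e) bimodule_scheme \<Rightarrow> 'a filter_pair \<Rightarrow>
     ('a tensor set \<times> ('a tensor \<Rightarrow> 'm set)) set" where
  "partial_homs R M F =
     (SIGMA K : symmetric_filter R F. env_hom R K (torsionfree_quotient M F))"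

definition germ_rel ::
    "('a, 'c) ring_scheme \<Rightarrow> ('a, 'm, 'e) bimodule_scheme \<Rightarrow> 'a filter_pair \<Rightarrow>
     (('a tensor set \<times> ('a tensor \<Rightarrow> 'm set)) \<times> ('a tensor set \<times> ('a tensor \<Rightarrow> 'm set))) set" where
  "germ_rel R M F =
     {((K, f), (L, g)). (K, f) \<in> partial_homs R M F \<and> (L, g) \<in> partial_homs R M F \<and>
        (\<exists>H\<in>symmetric_filter R F. H \<subseteq> K \<inter> L \<and> (\<forall>k\<in>H. f k = g k))}"

definition germ_class ::
    "('a, 'c) ring_scheme \<Rightarrow> ('a, 'm, 'e) bimodule_scheme \<Rightarrow> 'a filter_pair \<Rightarrow>
     'a tensor set \<Rightarrow> ('a tensor \<Rightarrow> 'm set) \<Rightarrow> ('a, 'm) germ" where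
  "germ_class R M F K f = germ_rel R M F `` {(K, f)}"

text \<open>The action of \<open>R \<otimes> R\<^sup>o\<^sup>p\<close> on the direct limit, \<open>(f t) k = f (t k)\<close>.\<close>

definition germ_act ::
    "('a, 'c) ring_scheme \<Rightarrow> ('a, 'm, 'e) bimodule_scheme \<Rightarrow> 'a filter_pair \<Rightarrow>
     ('a, 'm) germ \<Rightarrow> 'a tensor \<Rightarrow> ('a, 'm) germ" where
  "germ_act R M F X t =
     (\<Union>(K, f)\<in>X. germ_class R M F (right_colon (env_ring R) K t) (\<lambda>k. f (t \<otimes>\<^bsub>env_ring R\<^esub> k)))"

definition module_of_quotients ::
    "('a, 'c) ring_scheme \<Rightarrow> ('a, 'm, 'e) bimodule_scheme \<Rightarrow> 'a filter_pair \<Rightarrow>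
     ('a, ('a, 'm) germ) bimodule" where
  "module_of_quotients R M F =
     \<lparr>carrier = partial_homs R M F // germ_rel R M F, monoid.mult = undefined, monoid.one = undefined,
      ring.zero = germ_class R M F (carrier (env_ring R)) (\<lambda>_. \<zero>\<^bsub>torsionfree_quotient M F\<^esub>),
      ring.add = (\<lambda>X Y. \<Union>(K, f)\<in>X. \<Union>(L, g)\<in>Y.
               germ_class R M F (K \<inter> L) (\<lambda>k. f k \<oplus>\<^bsub>torsionfree_quotient M F\<^esub> g k)),
      lsmult = (\<lambda>s X. germ_act R M F X (pure_tensor R \<one>\<^bsub>R\<^esub> s)),
      rsmult = (\<lambda>X r. germ_act R M F X (pure_tensor R r \<one>\<^bsub>R\<^esub>))\<rparr>"

definition quotient_map ::
    "('a, 'c) ring_scheme \<Rightarrow> ('a, 'm, 'e) bimodule_scheme \<Rightarrow> 'a filter_pair \<Rightarrow>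
     'm \<Rightarrow> ('a, 'm) germ" where
  "quotient_map R M F m =
     germ_class R M F (carrier (env_ring R))
       (\<lambda>t. env_act (torsionfree_quotient M F) (symmetric_torsion M F +>\<^bsub>M\<^esub> m) t)"

definition comparison_map ::
    "('a, 'c) ring_scheme \<Rightarrow> ('a, 'm, 'e) bimodule_scheme \<Rightarrow> 'a filter_pair \<Rightarrow> 'a filter_pair \<Rightarrow>
     ('a, 'm) germ \<Rightarrow> ('a, 'm) germ" where
  "comparison_map R M F G X =
     (\<Union>(K, f)\<in>X. germ_class R M G K (\<lambda>k. \<Union>x\<in>f k. symmetric_torsion M G +>\<^bsub>M\<^esub> x))"

text \<open>The product \<open>p q\<close> in the symmetric ring of quotients. There are a left ideal \<open>I\<close> and a
  right ideal \<open>J\<close> in the given filters with \<open>I p\<close> and \<open>q J\<close> contained in the image of \<open>R\<close>, so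
  that associativity prescribes \<open>(p q) j\<close> for \<open>j\<close> in \<open>J\<close> and \<open>i (p q)\<close> for \<open>i\<close> in \<open>I\<close> through
  the bimodule structure. This determines \<open>p q\<close>, since an element annihilated by \<open>I\<close> on the
  left and by \<open>J\<close> on the right is torsion.\<close>

definition ring_of_quotients ::
    "('a, 'c) ring_scheme \<Rightarrow> 'a filter_pair \<Rightarrow> ('a, 'a) germ ring" where
  "ring_of_quotients R F =
     (let Q = module_of_quotients R (regular_bimodule R) F;
          \<iota> = quotient_map R (regular_bimodule R) F
      in \<lparr>carrier = carrier Q,
          monoid.mult = (\<lambda>p q. THE x. x \<in> carrier Q \<and>
            (\<forall>j\<in>carrier R. \<forall>r\<in>carrier R. rsmult Q q j = \<iota> r \<longrightarrow> rsmult Q x j = rsmult Q p r) \<and>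
            (\<forall>i\<in>carrier R. \<forall>r\<in>carrier R. lsmult Q i p = \<iota> r \<longrightarrow> lsmult Q i x = lsmult Q r q)),
          monoid.one = \<iota> \<one>\<^bsub>R\<^esub>, ring.zero = ring.zero Q, ring.add = ring.add Q\<rparr>)"

section \<open>Extensions of derivations and their agreement\<close>

definition is_extension ::
    "('a, 'c) ring_scheme \<Rightarrow> ('a, 'm, 'e) bimodule_scheme \<Rightarrow> ('a \<Rightarrow> 'a) \<Rightarrow> ('m \<Rightarrow> 'm) \<Rightarrow>
     'a filter_pair \<Rightarrow> (('a, 'm) germ \<Rightarrow> ('a, 'm) germ) \<Rightarrow> bool" where
  "is_extension R M \<delta> d F d' \<longleftrightarrow>
     module_derivation R (module_of_quotients R M F) \<delta> d' \<and>
     (\<forall>m\<in>carrier M. d' (quotient_map R M F m) = quotient_map R M F (d m))"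

definition extends ::
    "('a, 'c) ring_scheme \<Rightarrow> ('a, 'm, 'e) bimodule_scheme \<Rightarrow> ('a \<Rightarrow> 'a) \<Rightarrow> ('m \<Rightarrow> 'm) \<Rightarrow>
     'a filter_pair \<Rightarrow> bool" where
  "extends R M \<delta> d F \<longleftrightarrow> (\<exists>d'. is_extension R M \<delta> d F d')"

definition extensions_agree ::
    "('a, 'c) ring_scheme \<Rightarrow> ('a, 'm, 'e) bimodule_scheme \<Rightarrow> ('a \<Rightarrow> 'a) \<Rightarrow> ('m \<Rightarrow> 'm) \<Rightarrow>
     'a filter_pair \<Rightarrow> 'a filter_pair \<Rightarrow> bool" where
  "extensions_agree R M \<delta> d F G \<longleftrightarrow>
     symmetric_filter R F \<subseteq> symmetric_filter R G \<and>
     (\<exists>d\<^sub>1 d\<^sub>2. is_extension R M \<delta> d F d\<^sub>1 \<and> is_extension R M \<delta> d G d\<^sub>2 \<and>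
        (\<forall>x\<in>carrier (module_of_quotients R M F).
           d\<^sub>2 (comparison_map R M F G x) = comparison_map R M F G (d\<^sub>1 x)))"

section \<open>Particular theories\<close>

definition dense_left_ideal :: "('a, 'c) ring_scheme \<Rightarrow> 'a set \<Rightarrow> bool" where
  "dense_left_ideal R I \<longleftrightarrow> left_ideal R I \<and>
     (\<forall>x\<in>carrier R. \<forall>y\<in>carrier R. x \<noteq> \<zero>\<^bsub>R\<^esub> \<longrightarrow>
        (\<exists>r\<in>carrier R. r \<otimes>\<^bsub>R\<^esub> y \<in> I \<and> r \<otimes>\<^bsub>R\<^esub> x \<noteq> \<zero>\<^bsub>R\<^esub>))"

definition dense_right_ideal :: "('a, 'c) ring_scheme \<Rightarrow> 'a set \<Rightarrow> bool" where
  "dense_right_ideal R J \<longleftrightarrow> right_ideal R J \<and>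
     (\<forall>x\<in>carrier R. \<forall>y\<in>carrier R. x \<noteq> \<zero>\<^bsub>R\<^esub> \<longrightarrow>
        (\<exists>r\<in>carrier R. y \<otimes>\<^bsub>R\<^esub> r \<in> J \<and> x \<otimes>\<^bsub>R\<^esub> r \<noteq> \<zero>\<^bsub>R\<^esub>))"

definition lambek_pair :: "('a, 'c) ring_scheme \<Rightarrow> 'a filter_pair" where
  "lambek_pair R = ({I. dense_left_ideal R I}, {J. dense_right_ideal R J})"

text \<open>The products \<open>S f(I)\<close> and \<open>f(J) S\<close> are the sets of finite sums of products.\<close>

definition perfect_pair ::
    "('a, 'c) ring_scheme \<Rightarrow> ('s, 'b) ring_scheme \<Rightarrow> ('a \<Rightarrow> 's) \<Rightarrow> 'a filter_pair" where
  "perfect_pair R S f =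
     ({I. left_ideal R I \<and>
          generate (add_monoid S) {s \<otimes>\<^bsub>S\<^esub> f i | s i. s \<in> carrier S \<and> i \<in> I} = carrier S},
      {J. right_ideal R J \<and>
          generate (add_monoid S) {f j \<otimes>\<^bsub>S\<^esub> s | j s. j \<in> J \<and> s \<in> carrier S} = carrier S})"

definition perfect_symmetric_ring_of_quotients ::
    "('a, 'c) ring_scheme \<Rightarrow> ('s, 'b) ring_scheme \<Rightarrow> ('a \<Rightarrow> 's) \<Rightarrow> bool" where
  "perfect_symmetric_ring_of_quotients R S f \<longleftrightarrow>
     ring S \<and> f \<in> ring_hom R S \<and> gabriel_pair R (perfect_pair R S f) \<and>
     (\<exists>g \<in> ring_iso S (ring_of_quotients R (perfect_pair R S f)).
        \<forall>r\<in>carrier R. g (f r) = quotient_map R (regular_bimodule R) (perfect_pair R S f) r)"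

text \<open>The total symmetric ring of quotients: the largest perfect symmetric ring of quotients
  containing \<open>R\<close>. (Without injectivity the zero ring would always be perfect, with the filters
  of all one-sided ideals.) It is enough to let the competitors \<open>S'\<close> range over the rings on
  the type of \<^const>\<open>ring_of_quotients\<close>, because by definition every perfect symmetric ring
  of quotients is isomorphic over \<open>R\<close> to a ring on that type.\<close>

definition total_symmetric_ring_of_quotients ::
    "('a, 'c) ring_scheme \<Rightarrow> ('s, 'b) ring_scheme \<Rightarrow> ('a \<Rightarrow> 's) \<Rightarrow> bool" where
  "total_symmetric_ring_of_quotients R S f \<longleftrightarrow>
     perfect_symmetric_ring_of_quotients R S f \<and> inj_on f (carrier R) \<and>
     (\<forall>(S' :: ('a, 'a) germ ring) f'.
        perfect_symmetric_ring_of_quotients R S' f' \<and> inj_on f' (carrier R) \<longrightarrow>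
        (\<exists>h \<in> ring_hom S' S. \<forall>r\<in>carrier R. h (f' r) = f r))"

definition regular_elements :: "('a, 'c) ring_scheme \<Rightarrow> 'a set" where
  "regular_elements R =
     {t \<in> carrier R. \<forall>x\<in>carrier R.
        (t \<otimes>\<^bsub>R\<^esub> x = \<zero>\<^bsub>R\<^esub> \<longrightarrow> x = \<zero>\<^bsub>R\<^esub>) \<and> (x \<otimes>\<^bsub>R\<^esub> t = \<zero>\<^bsub>R\<^esub> \<longrightarrow> x = \<zero>\<^bsub>R\<^esub>)}"

definition left_ore :: "('a, 'c) ring_scheme \<Rightarrow> bool" where
  "left_ore R \<longleftrightarrow> (\<forall>a\<in>carrier R. \<forall>t\<in>regular_elements R.
     \<exists>b\<in>carrier R. \<exists>s\<in>regular_elements R. s \<otimes>\<^bsub>R\<^esub> a = b \<otimes>\<^bsub>R\<^esub> t)"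

definition right_ore :: "('a, 'c) ring_scheme \<Rightarrow> bool" where
  "right_ore R \<longleftrightarrow> (\<forall>a\<in>carrier R. \<forall>t\<in>regular_elements R.
     \<exists>b\<in>carrier R. \<exists>s\<in>regular_elements R. a \<otimes>\<^bsub>R\<^esub> s = t \<otimes>\<^bsub>R\<^esub> b)"

text \<open>The filters of the one-sided classical torsion theories: \<open>I\<close> is in the filter iff every
  element of \<open>R / I\<close> is annihilated by a regular element.\<close>

definition classical_pair :: "('a, 'c) ring_scheme \<Rightarrow> 'a filter_pair" where
  "classical_pair R =
     ({I. left_ideal R I \<and> (\<forall>r\<in>carrier R. \<exists>s\<in>regular_elements R. s \<otimes>\<^bsub>R\<^esub> r \<in> I)},
      {J. right_ideal R J \<and> (\<forall>r\<in>carrier R. \<exists>t\<in>regular_elements R. r \<otimes>\<^bsub>R\<^esub> t \<in> J)})"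

definition essential_left_ideal :: "('a, 'c) ring_scheme \<Rightarrow> 'a set \<Rightarrow> bool" where
  "essential_left_ideal R I \<longleftrightarrow> left_ideal R I \<and>
     (\<forall>L. left_ideal R L \<and> L \<noteq> {\<zero>\<^bsub>R\<^esub>} \<longrightarrow> I \<inter> L \<noteq> {\<zero>\<^bsub>R\<^esub>})"

definition essential_right_ideal :: "('a, 'c) ring_scheme \<Rightarrow> 'a set \<Rightarrow> bool" where
  "essential_right_ideal R J \<longleftrightarrow> right_ideal R J \<and>
     (\<forall>L. right_ideal R L \<and> L \<noteq> {\<zero>\<^bsub>R\<^esub>} \<longrightarrow> J \<inter> L \<noteq> {\<zero>\<^bsub>R\<^esub>})"

definition nonsingular_left_module ::
    "('a, 'c) ring_scheme \<Rightarrow> ('a, 'm, 'e) bimodule_scheme \<Rightarrow> bool" where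
  "nonsingular_left_module R N \<longleftrightarrow>
     (\<forall>x\<in>carrier N. essential_left_ideal R {a \<in> carrier R. lsmult N a x = \<zero>\<^bsub>N\<^esub>} \<longrightarrow> x = \<zero>\<^bsub>N\<^esub>)"

definition nonsingular_right_module ::
    "('a, 'c) ring_scheme \<Rightarrow> ('a, 'm, 'e) bimodule_scheme \<Rightarrow> bool" where
  "nonsingular_right_module R N \<longleftrightarrow>
     (\<forall>x\<in>carrier N. essential_right_ideal R {a \<in> carrier R. rsmult N x a = \<zero>\<^bsub>N\<^esub>} \<longrightarrow> x = \<zero>\<^bsub>N\<^esub>)"

text \<open>The torsion-free modules of the Goldie theories are the nonsingular ones. Being
  torsion-free and being nonsingular are both tested on cyclic submodules, and every cyclic
  module is isomorphic to a module of cosets of a one-sided ideal, so it is enough to let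
  \<open>N\<close> range over modules on the type \<^typ>\<open>'a set\<close>.\<close>

definition goldie_pair :: "('a, 'c) ring_scheme \<Rightarrow> 'a filter_pair \<Rightarrow> bool" where
  "goldie_pair R G \<longleftrightarrow> gabriel_pair R G \<and>
     (\<forall>N :: ('a, 'a set) bimodule. left_module R N \<longrightarrow>
        (left_torsion N (fst G) = {\<zero>\<^bsub>N\<^esub>} \<longleftrightarrow> nonsingular_left_module R N)) \<and>
     (\<forall>N :: ('a, 'a set) bimodule. right_module R N \<longrightarrow>
        (right_torsion N (snd G) = {\<zero>\<^bsub>N\<^esub>} \<longleftrightarrow> nonsingular_right_module R N))"

end

theory Submission
  imports Defs
begin

text \<open>For a Gabriel filter of left ideals and a fixed derivation \<open>\<delta>\<close>, the set of all \<open>a\<close> in a member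
  \<open>I\<close> with \<open>\<delta> a\<close> in \<open>I\<close> is again a member: for \<open>a\<close> in \<open>I\<close>, its colon ideal by \<open>a\<close> contains the colon
  ideal of \<open>I\<close> by \<open>\<delta> a\<close> (Lomp and van den Berg). Hence for every member \<open>K\<close> of a symmetric filter, the
  elements of \<open>K\<close> that the induced derivation \<open>D\<close> of \<open>R \<otimes> R\<^sup>o\<^sup>p\<close> maps into \<open>K\<close> form a member, on which
  \<open>k \<mapsto> d (f k) - f (D k)\<close> extends \<open>d\<close> to the germ of \<open>f\<close>. This formula is compatible with
  every inclusion of symmetric filters, so extensions always exist and agree along inclusions.

  It remains to compare filters. The members of a faithful one-sided filter are dense, and dense ideals
  are essential, so they belong to the Goldie filter. For the inclusion of the classical filter in the
  total perfect one, elements of the symmetric ring of quotients are described by pairs of one-sided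
  homomorphisms \<open>f\<close> and \<open>g\<close> with \<open>f i \<cdot> j = i \<cdot> g j\<close>. This yields the product, and inverses of the
  regular elements in the classical case, so the classical ring of quotients is perfect and maps to
  the total one.\<close>

section \<open>Presentation of the enveloping ring\<close>

text \<open>Faithfulness bounds only the intersection of the two torsion submodules, so by itself it
  does not place a symmetric filter inside the Lambek one. The comparison with dense ideals works
  one side at a time and rests on torsion-freeness on each side
  (\<open>faithful_on_both_sides\<close>). Tensors have no normal form, and this shapes much of the
  work. Additive maps out of R \<otimes> R^op are obtained from biadditive maps and compared on pure
  tensors. The obstacle is sharpest when f on I and g on J are to be glued into one homomorphism on
  a right ideal containing all 1 \<otimes> i and j \<otimes> 1: a tensor splits into such parts in
  many ways, and no biadditive map is at hand. The value is therefore characterized by its left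
  multiples by a member of the left filter, which is enough because R has no left torsion. The ring
  structure enters because the total ring of quotients is given by a universal property among
  perfect rings: before the classical filter can be compared with the total one, the classical ring
  of quotients has to be exhibited as a competitor.\<close>

definition pair_mult :: "('a, 'c) ring_scheme \<Rightarrow> 'a \<times> 'a \<Rightarrow> 'a \<times> 'a \<Rightarrow> 'a \<times> 'a" where
  "pair_mult R p q = (fst p \<otimes>\<^bsub>R\<^esub> fst q, snd q \<otimes>\<^bsub>R\<^esub> snd p)"

text \<open>The product of the monoid ring rewritten through \<open>frag_extend\<close>. The double
  sum over keys in the record is awkward for induction, whereas a bilinear extension lets identities
  be reduced to generators \<open>frag_of p\<close> by \<open>frag_induction\<close>.\<close>

definition frag_mult ::
    "('a, 'c) ring_scheme \<Rightarrow> ('a \<times> 'a \<Rightarrow>\<^sub>0 int) \<Rightarrow> ('a \<times> 'a \<Rightarrow>\<^sub>0 int) \<Rightarrow> ('a \<times> 'a \<Rightarrow>\<^sub>0 int)" where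
  "frag_mult R u v = frag_extend (\<lambda>p. frag_extend (\<lambda>q. frag_of (pair_mult R p q)) v) u"

lemma frag_cmul_single: "frag_cmul c (Poly_Mapping.single p d) = Poly_Mapping.single p (c * d)"
  by (rule poly_mapping_eqI) (simp add: lookup_single when_def)

lemma pair_monoid_ring_mult: "monoid.mult (pair_monoid_ring R) = frag_mult R"
  by (intro ext) (simp add: pair_monoid_ring_def frag_mult_def frag_extend_def frag_cmul_sum
      frag_cmul_single pair_mult_def)

lemma pair_monoid_ring_simps [simp]:
  "carrier (pair_monoid_ring R) = {u. Poly_Mapping.keys u \<subseteq> carrier R \<times> carrier R}"
  "ring.zero (pair_monoid_ring R) = 0"
  "ring.add (pair_monoid_ring R) = (+)"
  "monoid.one (pair_monoid_ring R) = frag_of (\<one>\<^bsub>R\<^esub>, \<one>\<^bsub>R\<^esub>)"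
  by (simp_all add: pair_monoid_ring_def)

lemma frag_mult_of [simp]: "frag_mult R (frag_of p) (frag_of q) = frag_of (pair_mult R p q)"
  by (simp add: frag_mult_def)

lemma frag_mult_0 [simp]: "frag_mult R 0 v = 0" "frag_mult R u 0 = 0"
  by (simp_all add: frag_mult_def frag_extend_eq_0)

lemma frag_mult_diff_left: "frag_mult R (a - b) v = frag_mult R a v - frag_mult R b v"
  by (simp add: frag_mult_def frag_extend_diff)

lemma frag_mult_add_left: "frag_mult R (a + b) v = frag_mult R a v + frag_mult R b v"
  by (simp add: frag_mult_def frag_extend_add)

lemma frag_mult_add_right: "frag_mult R u (a + b) = frag_mult R u a + frag_mult R u b"
  by (simp add: frag_mult_def frag_extend_add)
     (simp add: frag_extend_def frag_cmul_distrib2 sum.distrib)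

lemma frag_mult_diff_right: "frag_mult R u (a - b) = frag_mult R u a - frag_mult R u b"
  using frag_mult_add_right[of R u "a - b" b] by simp

lemma keys_diff_subset:
  fixes a b :: "'a \<Rightarrow>\<^sub>0 int"
  shows "Poly_Mapping.keys a \<subseteq> S \<Longrightarrow> Poly_Mapping.keys b \<subseteq> S \<Longrightarrow> Poly_Mapping.keys (a - b) \<subseteq> S"
  using keys_diff[of a b] by blast

lemma keys_add_subset:
  fixes a b :: "'a \<Rightarrow>\<^sub>0 int"
  shows "Poly_Mapping.keys a \<subseteq> S \<Longrightarrow> Poly_Mapping.keys b \<subseteq> S \<Longrightarrow> Poly_Mapping.keys (a + b) \<subseteq> S"
  using keys_add[of a b] by blast

context ring
begin

abbreviation "RR \<equiv> carrier R \<times> carrier R"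
abbreviation "E \<equiv> env_ring R"

lemma pair_mult_closed: "p \<in> RR \<Longrightarrow> q \<in> RR \<Longrightarrow> pair_mult R p q \<in> RR"
  by (auto simp: pair_mult_def)

lemma pair_mult_assoc:
  "p \<in> RR \<Longrightarrow> q \<in> RR \<Longrightarrow> s \<in> RR \<Longrightarrow>
     pair_mult R (pair_mult R p q) s = pair_mult R p (pair_mult R q s)"
  by (auto simp: pair_mult_def m_assoc)

lemma frag_mult_closed:
  assumes "Poly_Mapping.keys u \<subseteq> RR" "Poly_Mapping.keys v \<subseteq> RR"
  shows "Poly_Mapping.keys (frag_mult R u v) \<subseteq> RR"
  using assms(1)
proof (induction u rule: frag_induction)
  case (one p)
  with assms(2) show ?case
    by (induction v rule: frag_induction)
      (simp_all add: frag_mult_diff_right keys_diff_subset keys_frag_of pair_mult_closed)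
qed (simp_all add: frag_mult_diff_left keys_diff_subset)

text \<open>Both sides are additive in each of the three arguments, so three nested inductions
  reduce the claim to \<open>pair_mult_assoc\<close> on generators.\<close>

lemma frag_mult_assoc:
  assumes u: "Poly_Mapping.keys u \<subseteq> RR" and v: "Poly_Mapping.keys v \<subseteq> RR"
    and w: "Poly_Mapping.keys w \<subseteq> RR"
  shows "frag_mult R (frag_mult R u v) w = frag_mult R u (frag_mult R v w)"
  using u
proof (induction u rule: frag_induction)
  case (one p)
  show ?case using v
  proof (induction v rule: frag_induction)
    case (one q)
    show ?case using w
    proof (induction w rule: frag_induction)
      case (one s)
      then show ?case
        using \<open>p \<in> RR\<close> \<open>q \<in> RR\<close> by (simp add: pair_mult_assoc)
    qed (simp_all add: frag_mult_diff_right)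
  qed (simp_all add: frag_mult_diff_left frag_mult_diff_right)
qed (simp_all add: frag_mult_diff_left)

lemma frag_mult_one:
  assumes u: "Poly_Mapping.keys u \<subseteq> RR"
  shows "frag_mult R (frag_of (\<one>, \<one>)) u = u" "frag_mult R u (frag_of (\<one>, \<one>)) = u"
  using u
  by (induction u rule: frag_induction)
    (auto simp add: frag_mult_diff_right frag_mult_diff_left pair_mult_def)

lemma pair_monoid_ring_is_ring: "ring (pair_monoid_ring R)"
proof (rule ringI)
  show "abelian_group (pair_monoid_ring R)"
  proof (rule abelian_groupI)
    fix x assume "x \<in> carrier (pair_monoid_ring R)"
    then show "\<exists>y\<in>carrier (pair_monoid_ring R).
        y \<oplus>\<^bsub>pair_monoid_ring R\<^esub> x = \<zero>\<^bsub>pair_monoid_ring R\<^esub>"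
      by (intro bexI[of _ "- x"]) simp_all
  qed (simp_all add: keys_add_subset add_ac)
  show "Group.monoid (pair_monoid_ring R)"
    by (rule monoidI)
      (simp_all add: pair_monoid_ring_mult frag_mult_assoc frag_mult_one frag_mult_closed)
qed (simp_all add: pair_monoid_ring_mult frag_mult_add_left frag_mult_add_right)

lemma pair_monoid_ring_minus:
  assumes "Poly_Mapping.keys u \<subseteq> RR"
  shows "\<ominus>\<^bsub>pair_monoid_ring R\<^esub> u = - u"
proof -
  interpret P: ring "pair_monoid_ring R" by (rule pair_monoid_ring_is_ring)
  show ?thesis
    using assms P.minus_equality[of "- u" u] by (auto simp: keys_minus)
qed

lemma bilinear_relations_subset: "u \<in> bilinear_relations R \<Longrightarrow> Poly_Mapping.keys u \<subseteq> RR"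
  unfolding bilinear_relations_def
  by (elim UnE CollectE exE conjE; hypsubst; intro keys_diff_subset) (simp_all add: keys_frag_of)

text \<open>The additive subgroup generated by the bilinearity relations, given inductively for the
  sake of its induction rule. It turns out to be the whole ideal (\<open>bilinear_ideal_eq\<close>),
  so no products have to be considered when a map is shown to vanish on the ideal.\<close>

inductive_set relation_span :: "('a \<times> 'a \<Rightarrow>\<^sub>0 int) set" where
  zero: "0 \<in> relation_span"
| rel: "u \<in> bilinear_relations R \<Longrightarrow> u \<in> relation_span"
| diff: "u \<in> relation_span \<Longrightarrow> v \<in> relation_span \<Longrightarrow> u - v \<in> relation_span"

lemma relation_span_subset: "u \<in> relation_span \<Longrightarrow> Poly_Mapping.keys u \<subseteq> RR"
  by (induction rule: relation_span.induct)
    (simp_all add: bilinear_relations_subset keys_diff_subset)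

text \<open>By distributivity a multiplier can be moved into the arguments of a relation, which
  gives another relation of the same family. This is the reason why the generated subgroup is
  already an ideal.\<close>

lemma relation_mult:
  assumes "u \<in> bilinear_relations R" "p \<in> RR"
  shows "frag_mult R u (frag_of p) \<in> bilinear_relations R"
    and "frag_mult R (frag_of p) u \<in> bilinear_relations R"
proof -
  obtain a b where p: "p = (a, b)" "a \<in> carrier R" "b \<in> carrier R"
    using assms(2) by auto
  show "frag_mult R u (frag_of p) \<in> bilinear_relations R"
    using assms(1) unfolding bilinear_relations_def
  proof (elim UnE CollectE exE conjE, goal_cases)
    case (1 r r' s)
    then show ?case
      using p by (intro UnI1 CollectI exI[of _ "r \<otimes> a"] exI[of _ "r' \<otimes> a"] exI[of _ "b \<otimes> s"])
        (simp add: frag_mult_diff_left pair_mult_def l_distr)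
  next
    case (2 r s s')
    then show ?case
      using p by (intro UnI2 CollectI exI[of _ "r \<otimes> a"] exI[of _ "b \<otimes> s"] exI[of _ "b \<otimes> s'"])
        (simp add: frag_mult_diff_left pair_mult_def r_distr)
  qed
  show "frag_mult R (frag_of p) u \<in> bilinear_relations R"
    using assms(1) unfolding bilinear_relations_def
  proof (elim UnE CollectE exE conjE, goal_cases)
    case (1 r r' s)
    then show ?case
      using p by (intro UnI1 CollectI exI[of _ "a \<otimes> r"] exI[of _ "a \<otimes> r'"] exI[of _ "s \<otimes> b"])
        (simp add: frag_mult_diff_right pair_mult_def r_distr)
  next
    case (2 r s s')
    then show ?case
      using p by (intro UnI2 CollectI exI[of _ "a \<otimes> r"] exI[of _ "s \<otimes> b"] exI[of _ "s' \<otimes> b"])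
        (simp add: frag_mult_diff_right pair_mult_def l_distr)
  qed
qed

lemma relation_span_mult:
  assumes "u \<in> relation_span" "Poly_Mapping.keys v \<subseteq> RR"
  shows "frag_mult R u v \<in> relation_span" "frag_mult R v u \<in> relation_span"
proof -
  have "frag_mult R u (frag_of p) \<in> relation_span \<and> frag_mult R (frag_of p) u \<in> relation_span"
    if "p \<in> RR" for p
    using assms(1) that
    by (induction rule: relation_span.induct)
      (auto simp: frag_mult_diff_left frag_mult_diff_right intro: relation_span.intros relation_mult)
  with assms(2) show "frag_mult R u v \<in> relation_span" "frag_mult R v u \<in> relation_span"
    by (induction v rule: frag_induction)
      (auto simp: frag_mult_diff_left frag_mult_diff_right intro: relation_span.intros)
qed

lemma relation_span_ideal: "ideal relation_span (pair_monoid_ring R)"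
proof -
  interpret P: ring "pair_monoid_ring R" by (rule pair_monoid_ring_is_ring)
  have neg: "- u \<in> relation_span" if "u \<in> relation_span" for u
    using relation_span.diff[OF relation_span.zero that] by simp
  have sum: "u + v \<in> relation_span" if "u \<in> relation_span" "v \<in> relation_span" for u v
    using relation_span.diff[OF that(1) neg[OF that(2)]] by simp
  show ?thesis
  proof (intro idealI)
    show "subgroup relation_span (add_monoid (pair_monoid_ring R))"
    proof (rule P.add.subgroupI)
      show "relation_span \<subseteq> carrier (pair_monoid_ring R)"
        using relation_span_subset by auto
      show "relation_span \<noteq> {}" using relation_span.zero by auto
      show "\<ominus>\<^bsub>pair_monoid_ring R\<^esub> u \<in> relation_span" if "u \<in> relation_span" for u
        using neg[OF that] pair_monoid_ring_minus[OF relation_span_subset[OF that]] by simp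
    qed (simp add: sum)
  qed (auto simp: pair_monoid_ring_mult relation_span_mult P.ring_axioms)
qed

text \<open>One inclusion is minimality of the generated ideal, since the span is an ideal; the
  other holds because an ideal is closed under differences.\<close>

lemma bilinear_ideal_eq: "bilinear_ideal R = relation_span"
proof
  interpret P: ring "pair_monoid_ring R" by (rule pair_monoid_ring_is_ring)
  show "bilinear_ideal R \<subseteq> relation_span"
    unfolding bilinear_ideal_def
    by (rule P.genideal_minimal[OF relation_span_ideal]) (auto intro: relation_span.rel)
  interpret B: ideal "bilinear_ideal R" "pair_monoid_ring R"
    unfolding bilinear_ideal_def
    by (rule P.genideal_ideal) (use bilinear_relations_subset in auto)
  have rel: "bilinear_relations R \<subseteq> bilinear_ideal R"
    unfolding bilinear_ideal_def
    by (rule P.genideal_self) (use bilinear_relations_subset in auto)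
  show "relation_span \<subseteq> bilinear_ideal R"
  proof
    fix u assume "u \<in> relation_span"
    then show "u \<in> bilinear_ideal R"
    proof (induction rule: relation_span.induct)
      case zero
      then show ?case using B.zero_closed by simp
    next
      case (diff u v)
      have "Poly_Mapping.keys v \<subseteq> RR" using diff B.a_subset by auto
      then show ?case
        using B.a_closed[OF diff(3) B.a_inv_closed[OF diff(4)]]
        by (simp add: pair_monoid_ring_minus)
    qed (use rel in auto)
  qed
qed

lemma bilinear_ideal_ideal: "ideal (bilinear_ideal R) (pair_monoid_ring R)"
  by (simp add: bilinear_ideal_eq relation_span_ideal)

text \<open>The tool for well-definedness on tensors: whatever is preserved by differences and holds
  for the two families of relations holds on the whole ideal.\<close>

lemma bilinear_ideal_induct [consumes 1, case_names zero left right diff]: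
  assumes "u \<in> bilinear_ideal R"
    and "P 0"
    and "\<And>r r' s. r \<in> carrier R \<Longrightarrow> r' \<in> carrier R \<Longrightarrow> s \<in> carrier R \<Longrightarrow>
           P (frag_of (r \<oplus> r', s) - frag_of (r, s) - frag_of (r', s))"
    and "\<And>r s s'. r \<in> carrier R \<Longrightarrow> s \<in> carrier R \<Longrightarrow> s' \<in> carrier R \<Longrightarrow>
           P (frag_of (r, s \<oplus> s') - frag_of (r, s) - frag_of (r, s'))"
    and "\<And>u v. Poly_Mapping.keys u \<subseteq> RR \<Longrightarrow> Poly_Mapping.keys v \<subseteq> RR \<Longrightarrow> P u \<Longrightarrow> P v \<Longrightarrow> P (u - v)"
  shows "P u"
  using assms(1) unfolding bilinear_ideal_eq
  by (induction rule: relation_span.induct)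
    (auto simp: bilinear_relations_def intro: assms dest: relation_span_subset)

end

text \<open>The homomorphism from the free abelian group on pairs that extends \<open>h\<close>. It
  is spelled as in the definition of \<open>env_act\<close>, so that the latter becomes an instance
  by unfolding.\<close>

definition frag_sum :: "('g, 'x) ring_scheme \<Rightarrow> ('b \<Rightarrow> 'g) \<Rightarrow> ('b \<Rightarrow>\<^sub>0 int) \<Rightarrow> 'g" where
  "frag_sum G h u = (\<Oplus>\<^bsub>G\<^esub>p\<in>Poly_Mapping.keys u. [Poly_Mapping.lookup u p] \<cdot>\<^bsub>G\<^esub> h p)"

context abelian_group
begin

lemma frag_sum_0 [simp]: "frag_sum G h 0 = \<zero>"
  by (simp add: frag_sum_def)

lemma frag_sum_of [simp]: "h p \<in> carrier G \<Longrightarrow> frag_sum G h (frag_of p) = h p"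
  by (simp add: frag_sum_def add.int_pow_1)

lemma frag_sum_closed:
  assumes "h \<in> A \<rightarrow> carrier G" "Poly_Mapping.keys u \<subseteq> A"
  shows "frag_sum G h u \<in> carrier G"
  unfolding frag_sum_def using assms by (intro finsum_closed) auto

text \<open>A sum over \<open>u + v\<close> may run over fewer keys than those of \<open>u\<close>
  and \<open>v\<close> because of cancellation. Extending all sums to a common finite index set
  makes them comparable.\<close>

lemma frag_sum_superset:
  assumes "finite B" "Poly_Mapping.keys u \<subseteq> B" "h \<in> B \<rightarrow> carrier G"
  shows "frag_sum G h u = (\<Oplus>p\<in>B. [Poly_Mapping.lookup u p] \<cdot> h p)"
  unfolding frag_sum_def
  by (rule add.finprod_mono_neutral_cong_left)
    (use assms in \<open>auto simp: in_keys_iff add_pow_def[of _ 0]\<close>)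

lemma frag_sum_add:
  assumes "h \<in> A \<rightarrow> carrier G" "Poly_Mapping.keys u \<subseteq> A" "Poly_Mapping.keys v \<subseteq> A"
  shows "frag_sum G h (u + v) = frag_sum G h u \<oplus> frag_sum G h v"
proof -
  let ?B = "Poly_Mapping.keys u \<union> Poly_Mapping.keys v"
  have h: "h \<in> ?B \<rightarrow> carrier G" using assms by auto
  have hp: "h p \<in> carrier G" if "p \<in> ?B" for p using h that by (rule Pi_mem)
  have "frag_sum G h (u + v) = (\<Oplus>p\<in>?B. [Poly_Mapping.lookup (u + v) p] \<cdot> h p)"
    using h keys_add[of u v] by (intro frag_sum_superset) auto
  also have "\<dots> = (\<Oplus>p\<in>?B. [Poly_Mapping.lookup u p] \<cdot> h p \<oplus> [Poly_Mapping.lookup v p] \<cdot> h p)"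
    using hp by (intro add.finprod_cong') (simp_all only: lookup_add add.int_pow_mult, simp_all)
  also have "\<dots> = (\<Oplus>p\<in>?B. [Poly_Mapping.lookup u p] \<cdot> h p) \<oplus> (\<Oplus>p\<in>?B. [Poly_Mapping.lookup v p] \<cdot> h p)"
    using h by (intro finsum_addf) auto
  also have "\<dots> = frag_sum G h u \<oplus> frag_sum G h v"
    using h by (simp add: frag_sum_superset[of ?B])
  finally show ?thesis .
qed

lemma frag_sum_diff:
  assumes "h \<in> A \<rightarrow> carrier G" "Poly_Mapping.keys u \<subseteq> A" "Poly_Mapping.keys v \<subseteq> A"
  shows "frag_sum G h (u - v) = frag_sum G h u \<ominus> frag_sum G h v"
proof -
  have k: "Poly_Mapping.keys (u - v) \<subseteq> A" using assms by (simp add: keys_diff_subset)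
  have "frag_sum G h u = frag_sum G h (u - v) \<oplus> frag_sum G h v"
    using frag_sum_add[OF assms(1) k assms(3)] by simp
  then show ?thesis
    using frag_sum_closed[OF assms(1)] assms k
    by (metis add.inv_solve_right a_minus_def)
qed

end

section \<open>Universal property of the tensor product\<close>

definition biadditive :: "('a, 'c) ring_scheme \<Rightarrow> ('g, 'x) ring_scheme \<Rightarrow> ('a \<times> 'a \<Rightarrow> 'g) \<Rightarrow> bool" where
  "biadditive R G h \<longleftrightarrow>
     h \<in> carrier R \<times> carrier R \<rightarrow> carrier G \<and>
     (\<forall>r\<in>carrier R. \<forall>r'\<in>carrier R. \<forall>s\<in>carrier R. h (r \<oplus>\<^bsub>R\<^esub> r', s) = h (r, s) \<oplus>\<^bsub>G\<^esub> h (r', s)) \<and>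
     (\<forall>r\<in>carrier R. \<forall>s\<in>carrier R. \<forall>s'\<in>carrier R. h (r, s \<oplus>\<^bsub>R\<^esub> s') = h (r, s) \<oplus>\<^bsub>G\<^esub> h (r, s'))"

definition tensor_class :: "('a, 'c) ring_scheme \<Rightarrow> ('a \<times> 'a \<Rightarrow>\<^sub>0 int) \<Rightarrow> 'a tensor" where
  "tensor_class R u = bilinear_ideal R +>\<^bsub>pair_monoid_ring R\<^esub> u"

text \<open>For biadditive \<open>h\<close> the value of \<open>frag_sum\<close> is constant on a
  coset, so the image of the coset is a singleton and \<open>the_elem\<close> reads off its
  element.\<close>

definition tensor_lift :: "('g, 'x) ring_scheme \<Rightarrow> ('a \<times> 'a \<Rightarrow> 'g) \<Rightarrow> 'a tensor \<Rightarrow> 'g" where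
  "tensor_lift G h t = the_elem (frag_sum G h ` t)"

lemma env_act_eq: "env_act M x = tensor_lift M (\<lambda>p. lsmult M (snd p) (rsmult M x (fst p)))"
  by (intro ext) (simp add: env_act_def tensor_lift_def frag_sum_def)

lemma pure_tensor_eq: "pure_tensor R r s = tensor_class R (frag_of (r, s))"
  by (simp add: pure_tensor_def tensor_class_def)

context ring
begin

lemma env_ring_is_ring: "ring E"
  unfolding env_ring_def by (rule ideal.quotient_is_ring[OF bilinear_ideal_ideal])

lemma tensor_class_ring_hom: "tensor_class R \<in> ring_hom (pair_monoid_ring R) E"
  unfolding env_ring_def tensor_class_def
  by (rule ideal.rcos_ring_hom[OF bilinear_ideal_ideal])

lemma carrier_env_ring: "carrier E = tensor_class R ` {u. Poly_Mapping.keys u \<subseteq> RR}"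
  by (auto simp: env_ring_def FactRing_def A_RCOSETS_def' tensor_class_def)

lemma tensor_class_closed: "Poly_Mapping.keys u \<subseteq> RR \<Longrightarrow> tensor_class R u \<in> carrier E"
  by (auto simp: carrier_env_ring)

lemma tensor_class_add:
  "Poly_Mapping.keys u \<subseteq> RR \<Longrightarrow> Poly_Mapping.keys v \<subseteq> RR \<Longrightarrow>
     tensor_class R (u + v) = tensor_class R u \<oplus>\<^bsub>E\<^esub> tensor_class R v"
  using ring_hom_add[OF tensor_class_ring_hom, of u v] by simp

lemma tensor_class_mult:
  "Poly_Mapping.keys u \<subseteq> RR \<Longrightarrow> Poly_Mapping.keys v \<subseteq> RR \<Longrightarrow>
     tensor_class R (frag_mult R u v) = tensor_class R u \<otimes>\<^bsub>E\<^esub> tensor_class R v"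
  using ring_hom_mult[OF tensor_class_ring_hom, of u v] by (simp add: pair_monoid_ring_mult)

lemma tensor_class_0: "tensor_class R 0 = \<zero>\<^bsub>E\<^esub>"
  using ring_hom_zero[OF tensor_class_ring_hom pair_monoid_ring_is_ring env_ring_is_ring] by simp

lemma tensor_class_one: "\<one>\<^bsub>E\<^esub> = pure_tensor R \<one> \<one>"
  using ring_hom_one[OF tensor_class_ring_hom] by (simp add: pure_tensor_eq)

lemma tensor_class_diff:
  assumes "Poly_Mapping.keys u \<subseteq> RR" "Poly_Mapping.keys v \<subseteq> RR"
  shows "tensor_class R (u - v) = tensor_class R u \<ominus>\<^bsub>E\<^esub> tensor_class R v"
proof -
  interpret E: ring E by (rule env_ring_is_ring)
  have k: "Poly_Mapping.keys (u - v) \<subseteq> RR" using assms by (simp add: keys_diff_subset)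
  have "tensor_class R u = tensor_class R (u - v) \<oplus>\<^bsub>E\<^esub> tensor_class R v"
    using tensor_class_add[OF k assms(2)] by simp
  then show ?thesis
    using tensor_class_closed assms k by (metis E.add.inv_solve_right a_minus_def)
qed

lemma mem_tensor_class:
  assumes "Poly_Mapping.keys u \<subseteq> RR"
  shows "v \<in> tensor_class R u \<longleftrightarrow> v - u \<in> bilinear_ideal R"
  unfolding tensor_class_def a_r_coset_def' by (auto intro!: bexI[of _ "v - u"])

lemma tensor_class_eq_0:
  assumes "Poly_Mapping.keys u \<subseteq> RR" "tensor_class R u = \<zero>\<^bsub>E\<^esub>"
  shows "u \<in> bilinear_ideal R"
  using mem_tensor_class[of 0 u] mem_tensor_class[of u u] assms bilinear_ideal_eq relation_span.zero
  by (simp add: tensor_class_0)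

lemma pure_tensor_closed [simp]:
  "r \<in> carrier R \<Longrightarrow> s \<in> carrier R \<Longrightarrow> pure_tensor R r s \<in> carrier E"
  by (simp add: pure_tensor_eq tensor_class_closed keys_frag_of)

lemma pure_tensor_mult:
  "r \<in> carrier R \<Longrightarrow> s \<in> carrier R \<Longrightarrow> r' \<in> carrier R \<Longrightarrow> s' \<in> carrier R \<Longrightarrow>
   pure_tensor R r s \<otimes>\<^bsub>E\<^esub> pure_tensor R r' s' = pure_tensor R (r \<otimes> r') (s' \<otimes> s)"
  by (simp add: pure_tensor_eq keys_frag_of pair_mult_def flip: tensor_class_mult)

lemma tensor_class_relation:
  assumes "u \<in> bilinear_ideal R"
  shows "tensor_class R u = \<zero>\<^bsub>E\<^esub>"
proof -
  interpret B: ideal "bilinear_ideal R" "pair_monoid_ring R" by (rule bilinear_ideal_ideal)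
  have "tensor_class R u = bilinear_ideal R"
    unfolding tensor_class_def
    using assms B.a_coset_join2 B.a_subset B.additive_subgroup_axioms additive_subgroup.a_subgroup by blast
  moreover have "tensor_class R 0 = bilinear_ideal R"
    unfolding tensor_class_def using B.a_coset_add_zero[OF B.a_subset] by simp
  ultimately show ?thesis by (simp add: tensor_class_0)
qed

lemma pure_tensor_add_left:
  assumes "r \<in> carrier R" "r' \<in> carrier R" "s \<in> carrier R"
  shows "pure_tensor R (r \<oplus> r') s = pure_tensor R r s \<oplus>\<^bsub>E\<^esub> pure_tensor R r' s"
proof -
  let ?u = "frag_of (r \<oplus> r', s)" and ?v = "frag_of (r, s) + frag_of (r', s)"
  have k: "Poly_Mapping.keys ?u \<subseteq> RR" "Poly_Mapping.keys ?v \<subseteq> RR"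
    using assms by (simp_all add: keys_frag_of keys_add_subset)
  have "?u - ?v \<in> bilinear_ideal R"
    using assms unfolding bilinear_ideal_eq diff_diff_add[symmetric]
    by (intro relation_span.rel) (unfold bilinear_relations_def, blast)
  then have "tensor_class R (?u - ?v) = \<zero>\<^bsub>E\<^esub>" by (rule tensor_class_relation)
  moreover have "tensor_class R ?u = tensor_class R (?u - ?v) \<oplus>\<^bsub>E\<^esub> tensor_class R ?v"
    using k by (simp add: keys_diff_subset flip: tensor_class_add)
  ultimately have "tensor_class R ?u = tensor_class R ?v"
    using k by (simp add: tensor_class_closed ring.ring_simprules[OF env_ring_is_ring])
  then show ?thesis
    using assms by (simp add: pure_tensor_eq keys_frag_of tensor_class_add)
qed

lemma pure_tensor_add_right:
  assumes "r \<in> carrier R" "s \<in> carrier R" "s' \<in> carrier R"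
  shows "pure_tensor R r (s \<oplus> s') = pure_tensor R r s \<oplus>\<^bsub>E\<^esub> pure_tensor R r s'"
proof -
  let ?u = "frag_of (r, s \<oplus> s')" and ?v = "frag_of (r, s) + frag_of (r, s')"
  have k: "Poly_Mapping.keys ?u \<subseteq> RR" "Poly_Mapping.keys ?v \<subseteq> RR"
    using assms by (simp_all add: keys_frag_of keys_add_subset)
  have "?u - ?v \<in> bilinear_ideal R"
    using assms unfolding bilinear_ideal_eq diff_diff_add[symmetric]
    by (intro relation_span.rel) (unfold bilinear_relations_def, blast)
  then have "tensor_class R (?u - ?v) = \<zero>\<^bsub>E\<^esub>" by (rule tensor_class_relation)
  moreover have "tensor_class R ?u = tensor_class R (?u - ?v) \<oplus>\<^bsub>E\<^esub> tensor_class R ?v"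
    using k by (simp add: keys_diff_subset flip: tensor_class_add)
  ultimately have "tensor_class R ?u = tensor_class R ?v"
    using k by (simp add: tensor_class_closed ring.ring_simprules[OF env_ring_is_ring])
  then show ?thesis
    using assms by (simp add: pure_tensor_eq keys_frag_of tensor_class_add)
qed

text \<open>Every class is represented by an integer combination of pairs, so the pure tensors
  generate additively. The step with differences covers sums and negatives at once.\<close>

lemma env_ring_induct [consumes 1, case_names zero pure diff]:
  assumes "t \<in> carrier E"
    and zero: "P \<zero>\<^bsub>E\<^esub>"
    and pure: "\<And>r s. r \<in> carrier R \<Longrightarrow> s \<in> carrier R \<Longrightarrow> P (pure_tensor R r s)"
    and diff: "\<And>a b. a \<in> carrier E \<Longrightarrow> b \<in> carrier E \<Longrightarrow>
           P a \<Longrightarrow> P b \<Longrightarrow> P (a \<ominus>\<^bsub>E\<^esub> b)"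
  shows "P t"
proof -
  obtain u where u: "Poly_Mapping.keys u \<subseteq> RR" "t = tensor_class R u"
    using assms(1) by (auto simp: carrier_env_ring)
  have "Poly_Mapping.keys u \<subseteq> RR \<and> P (tensor_class R u)"
    using u(1)
  proof (induction u rule: frag_induction)
    case zero
    then show ?case using assms(2) by (simp add: tensor_class_0)
  next
    case (one p)
    then show ?case using pure by (cases p) (auto simp: keys_frag_of pure_tensor_eq)
  next
    case (diff a b)
    then show ?case using assms(4) by (simp add: keys_diff_subset tensor_class_diff tensor_class_closed)
  qed
  with u(2) show ?thesis by simp
qed

text \<open>Biadditivity of \<open>h\<close> says that the two families of relations are sent to
  zero; additivity of \<open>frag_sum\<close> does the rest.\<close>

lemma frag_sum_bilinear_ideal:
  assumes "abelian_group G" "biadditive R G h" "u \<in> bilinear_ideal R"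
  shows "frag_sum G h u = \<zero>\<^bsub>G\<^esub>"
proof -
  interpret G: abelian_group G by fact
  have h: "h \<in> RR \<rightarrow> carrier G" using assms(2) by (simp add: biadditive_def)
  then have hc: "h (r, s) \<in> carrier G" if "r \<in> carrier R" "s \<in> carrier R" for r s using that by auto
  have c: "frag_sum G h (frag_of (r, s)) = h (r, s)" if "r \<in> carrier R" "s \<in> carrier R" for r s
    using hc[OF that] by simp
  show ?thesis using assms(3)
  proof (induction rule: bilinear_ideal_induct)
    case (left r r' s)
    have "h (r \<oplus> r', s) = h (r, s) \<oplus>\<^bsub>G\<^esub> h (r', s)"
      using assms(2) left by (simp add: biadditive_def)
    then show ?case
      using left hc by (simp add: G.frag_sum_diff[OF h] keys_diff_subset keys_frag_of c a_minus_def
          G.minus_add G.a_ac G.r_neg G.r_neg1 G.r_neg2)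
  next
    case (right r s s')
    have "h (r, s \<oplus> s') = h (r, s) \<oplus>\<^bsub>G\<^esub> h (r, s')"
      using assms(2) right by (simp add: biadditive_def)
    then show ?case
      using right hc by (simp add: G.frag_sum_diff[OF h] keys_diff_subset keys_frag_of c a_minus_def
          G.minus_add G.a_ac G.r_neg G.r_neg1 G.r_neg2)
  next
    case (diff u v)
    then show ?case by (simp add: G.frag_sum_diff[OF h] a_minus_def G.r_neg)
  qed simp
qed

text \<open>Two representatives differ by an element of the ideal, on which \<open>frag_sum\<close>
  vanishes. Hence any representative may be used to compute the lift.\<close>

lemma tensor_lift_class:
  assumes "abelian_group G" "biadditive R G h" "Poly_Mapping.keys u \<subseteq> RR"
  shows "tensor_lift G h (tensor_class R u) = frag_sum G h u"
proof -
  interpret G: abelian_group G by fact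
  have h: "h \<in> RR \<rightarrow> carrier G" using assms(2) by (simp add: biadditive_def)
  have "frag_sum G h v = frag_sum G h u" if "v \<in> tensor_class R u" for v
  proof -
    have b: "v - u \<in> bilinear_ideal R" using that assms(3) by (simp add: mem_tensor_class)
    then have "Poly_Mapping.keys (v - u) \<subseteq> RR"
      by (auto simp: bilinear_ideal_eq dest: relation_span_subset)
    then have "frag_sum G h (v - u + u) = frag_sum G h (v - u) \<oplus>\<^bsub>G\<^esub> frag_sum G h u"
      using assms(3) by (rule G.frag_sum_add[OF h])
    then show ?thesis
      using b frag_sum_bilinear_ideal[OF assms(1,2)] G.frag_sum_closed[OF h assms(3)] by simp
  qed
  moreover have "u \<in> tensor_class R u"
    using assms(3) by (simp add: mem_tensor_class bilinear_ideal_eq relation_span.zero)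
  ultimately have "frag_sum G h ` tensor_class R u = {frag_sum G h u}" by blast
  then show ?thesis by (simp add: tensor_lift_def)
qed

lemma tensor_lift_pure:
  assumes "abelian_group G" "biadditive R G h" "r \<in> carrier R" "s \<in> carrier R"
  shows "tensor_lift G h (pure_tensor R r s) = h (r, s)"
proof -
  interpret G: abelian_group G by fact
  have "h (r, s) \<in> carrier G" using assms by (auto simp: biadditive_def)
  then show ?thesis
    using tensor_lift_class[OF assms(1,2), of "frag_of (r, s)"] assms(3,4)
    by (simp add: pure_tensor_eq keys_frag_of)
qed

lemma tensor_lift_closed:
  assumes "abelian_group G" "biadditive R G h" "t \<in> carrier E"
  shows "tensor_lift G h t \<in> carrier G"
  using assms abelian_group.frag_sum_closed[OF assms(1), of h RR]
  by (auto simp: carrier_env_ring tensor_lift_class biadditive_def)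

lemma tensor_lift_add:
  assumes "abelian_group G" "biadditive R G h" "t \<in> carrier E" "t' \<in> carrier E"
  shows "tensor_lift G h (t \<oplus>\<^bsub>E\<^esub> t') = tensor_lift G h t \<oplus>\<^bsub>G\<^esub> tensor_lift G h t'"
proof -
  obtain u v where uv: "Poly_Mapping.keys u \<subseteq> RR" "t = tensor_class R u"
    "Poly_Mapping.keys v \<subseteq> RR" "t' = tensor_class R v"
    using assms by (auto simp: carrier_env_ring)
  then have "t \<oplus>\<^bsub>E\<^esub> t' = tensor_class R (u + v)" by (simp add: tensor_class_add)
  then show ?thesis
    using uv assms abelian_group.frag_sum_add[OF assms(1), of h RR u v]
    by (simp add: tensor_lift_class keys_add_subset biadditive_def)
qed

end

section \<open>Additive subgroups and additive maps\<close>

lemma (in abelian_group) additive_subgroup_iff: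
  "additive_subgroup H G \<longleftrightarrow> H \<subseteq> carrier G \<and> \<zero> \<in> H \<and> (\<forall>x\<in>H. \<forall>y\<in>H. x \<ominus> y \<in> H)"
proof
  assume "additive_subgroup H G"
  then interpret H: additive_subgroup H G .
  show "H \<subseteq> carrier G \<and> \<zero> \<in> H \<and> (\<forall>x\<in>H. \<forall>y\<in>H. x \<ominus> y \<in> H)"
    using H.a_subset by (auto simp: a_minus_def)
next
  assume H: "H \<subseteq> carrier G \<and> \<zero> \<in> H \<and> (\<forall>x\<in>H. \<forall>y\<in>H. x \<ominus> y \<in> H)"
  have neg: "\<ominus> x \<in> H" if "x \<in> H" for x
    using H that by (metis a_minus_def add.inv_closed add.l_one subsetD)
  have "x \<oplus> y \<in> H" if "x \<in> H" "y \<in> H" for x y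
    using H that neg[OF that(2)] by (metis a_minus_def add.inv_inv subsetD)
  with H neg show "additive_subgroup H G"
    by (intro additive_subgroupI add.subgroupI) auto
qed

lemma additive_map_zero:
  assumes "abelian_group G" "abelian_group H" "f \<in> carrier G \<rightarrow> carrier H"
    and add: "\<And>x y. x \<in> carrier G \<Longrightarrow> y \<in> carrier G \<Longrightarrow> f (x \<oplus>\<^bsub>G\<^esub> y) = f x \<oplus>\<^bsub>H\<^esub> f y"
  shows "f \<zero>\<^bsub>G\<^esub> = \<zero>\<^bsub>H\<^esub>"
proof -
  interpret G: abelian_group G by fact
  interpret H: abelian_group H by fact
  have "f \<zero>\<^bsub>G\<^esub> \<oplus>\<^bsub>H\<^esub> f \<zero>\<^bsub>G\<^esub> = f \<zero>\<^bsub>G\<^esub>" using add[of "\<zero>\<^bsub>G\<^esub>" "\<zero>\<^bsub>G\<^esub>"] by simp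
  moreover have "f \<zero>\<^bsub>G\<^esub> \<in> carrier H" using assms(3) by auto
  ultimately show ?thesis by (metis H.add.r_cancel_one)
qed

lemma additive_map_diff:
  assumes "abelian_group G" "abelian_group H" "f \<in> carrier G \<rightarrow> carrier H"
    and add: "\<And>x y. x \<in> carrier G \<Longrightarrow> y \<in> carrier G \<Longrightarrow> f (x \<oplus>\<^bsub>G\<^esub> y) = f x \<oplus>\<^bsub>H\<^esub> f y"
    and "x \<in> carrier G" "y \<in> carrier G"
  shows "f (x \<ominus>\<^bsub>G\<^esub> y) = f x \<ominus>\<^bsub>H\<^esub> f y"
proof -
  interpret G: abelian_group G by fact
  interpret H: abelian_group H by fact
  have "f x = f (x \<ominus>\<^bsub>G\<^esub> y) \<oplus>\<^bsub>H\<^esub> f y"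
    using add[of "x \<ominus>\<^bsub>G\<^esub> y" y] assms(5,6) by (simp add: a_minus_def G.a_assoc G.l_neg)
  moreover have "f x \<in> carrier H" "f y \<in> carrier H" "f (x \<ominus>\<^bsub>G\<^esub> y) \<in> carrier H"
    using assms(3,5,6) by auto
  ultimately show ?thesis by (metis H.add.inv_solve_right a_minus_def)
qed

lemma additive_map_minus:
  assumes "abelian_group G" "abelian_group H" "f \<in> carrier G \<rightarrow> carrier H"
    and add: "\<And>x y. x \<in> carrier G \<Longrightarrow> y \<in> carrier G \<Longrightarrow> f (x \<oplus>\<^bsub>G\<^esub> y) = f x \<oplus>\<^bsub>H\<^esub> f y"
    and "x \<in> carrier G"
  shows "f (\<ominus>\<^bsub>G\<^esub> x) = \<ominus>\<^bsub>H\<^esub> f x"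
proof -
  interpret G: abelian_group G by fact
  interpret H: abelian_group H by fact
  have "f (\<zero>\<^bsub>G\<^esub> \<ominus>\<^bsub>G\<^esub> x) = f \<zero>\<^bsub>G\<^esub> \<ominus>\<^bsub>H\<^esub> f x"
    using assms by (intro additive_map_diff) auto
  then show ?thesis
    using assms additive_map_zero[OF assms(1-3) add] by (simp add: a_minus_def Pi_iff)
qed

section \<open>Opposite rings and modules\<close>

text \<open>The device for left-right symmetry: a statement about right ideals is the corresponding
  statement about left ideals of the opposite ring. Only the product is updated, so the
  simplification rules below eliminate every trace of \<open>opposite\<close> after
  instantiation.\<close>

definition opposite :: "('a, 'c) ring_scheme \<Rightarrow> ('a, 'c) ring_scheme" where
  "opposite R = R\<lparr>monoid.mult := (\<lambda>x y. y \<otimes>\<^bsub>R\<^esub> x)\<rparr>"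

lemma opposite_simps [simp]:
  "carrier (opposite R) = carrier R" "\<zero>\<^bsub>opposite R\<^esub> = \<zero>\<^bsub>R\<^esub>" "\<one>\<^bsub>opposite R\<^esub> = \<one>\<^bsub>R\<^esub>"
  "x \<oplus>\<^bsub>opposite R\<^esub> y = x \<oplus>\<^bsub>R\<^esub> y" "x \<otimes>\<^bsub>opposite R\<^esub> y = y \<otimes>\<^bsub>R\<^esub> x"
  "a_inv (opposite R) = a_inv R" "x \<ominus>\<^bsub>opposite R\<^esub> y = x \<ominus>\<^bsub>R\<^esub> y"
  by (auto simp: opposite_def a_inv_def m_inv_def a_minus_def)

lemma (in ring) opposite_ring: "ring (opposite R)"
  by (rule ringI)
    (auto intro!: abelian_groupI monoidI bexI[of _ "\<ominus> _"] simp: ring_simprules)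

lemma additive_subgroup_opposite [simp]: "additive_subgroup I (opposite R) \<longleftrightarrow> additive_subgroup I R"
  by (simp add: additive_subgroup_def opposite_def)

lemma left_ideal_opposite [simp]: "left_ideal (opposite R) I = right_ideal R I"
  by (simp add: left_ideal_def right_ideal_def)

lemma left_colon_opposite [simp]: "left_colon (opposite R) I a = right_colon R I a"
  by (simp add: left_colon_def right_colon_def)

lemma left_gabriel_filter_opposite [simp]:
  "left_gabriel_filter (opposite R) F = right_gabriel_filter R F"
  by (simp add: left_gabriel_filter_def right_gabriel_filter_def)

lemma dense_left_ideal_opposite [simp]: "dense_left_ideal (opposite R) I = dense_right_ideal R I"
  by (simp add: dense_left_ideal_def dense_right_ideal_def)

lemma essential_left_ideal_opposite [simp]:
  "essential_left_ideal (opposite R) I = essential_right_ideal R I"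
  by (simp add: essential_left_ideal_def essential_right_ideal_def)

lemma regular_elements_opposite [simp]: "regular_elements (opposite R) = regular_elements R"
  by (auto simp: regular_elements_def)

lemma (in ring) derivation_opposite [simp]: "derivation (opposite R) \<delta> = derivation R \<delta>"
proof -
  have "\<delta> s \<otimes> r \<oplus> s \<otimes> \<delta> r = s \<otimes> \<delta> r \<oplus> \<delta> s \<otimes> r"
    if "\<delta> \<in> carrier R \<rightarrow> carrier R" "r \<in> carrier R" "s \<in> carrier R" for r s
    using that by (intro a_comm) auto
  then show ?thesis
    unfolding derivation_def by (simp cong: conj_cong) blast
qed

definition opposite_module :: "('a, 'm, 'e) bimodule_scheme \<Rightarrow> ('a, 'm, 'e) bimodule_scheme" where
  "opposite_module M = M\<lparr>lsmult := (\<lambda>a x. rsmult M x a), rsmult := (\<lambda>x a. lsmult M a x)\<rparr>"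

lemma opposite_module_simps [simp]:
  "carrier (opposite_module M) = carrier M" "\<zero>\<^bsub>opposite_module M\<^esub> = \<zero>\<^bsub>M\<^esub>"
  "x \<oplus>\<^bsub>opposite_module M\<^esub> y = x \<oplus>\<^bsub>M\<^esub> y"
  "lsmult (opposite_module M) a x = rsmult M x a" "rsmult (opposite_module M) x a = lsmult M a x"
  by (auto simp: opposite_module_def)

lemma additive_subgroup_opposite_module [simp]:
  "additive_subgroup I (opposite_module M) \<longleftrightarrow> additive_subgroup I M"
  by (simp add: additive_subgroup_def opposite_module_def)

lemma left_torsion_opposite_module [simp]:
  "left_torsion (opposite_module M) F = right_torsion M F"
  by (simp add: left_torsion_def right_torsion_def)

lemma opposite_opposite_module [simp]: "opposite_module (opposite_module M) = M"
  by (simp add: opposite_module_def)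

lemma abelian_group_opposite_module: "abelian_group M \<Longrightarrow> abelian_group (opposite_module M)"
  by (simp add: abelian_group_def abelian_monoid_def abelian_group_axioms_def opposite_module_def)

lemma (in right_module) left_module_opposite: "left_module (opposite R) (opposite_module M)"
  by (intro left_module.intro left_module_axioms.intro)
    (auto simp: R.opposite_ring M.abelian_group_axioms abelian_group_opposite_module
      rsmult_closed rsmult_l_distr rsmult_r_distr rsmult_assoc rsmult_one)

lemma (in left_module) right_module_opposite: "right_module (opposite R) (opposite_module M)"
  by (intro right_module.intro right_module_axioms.intro)
    (auto simp: R.opposite_ring M.abelian_group_axioms abelian_group_opposite_module
      lsmult_closed lsmult_l_distr lsmult_r_distr lsmult_assoc lsmult_one)

context left_module
begin

lemma lsmult_diff:
  "a \<in> carrier R \<Longrightarrow> x \<in> carrier M \<Longrightarrow> y \<in> carrier M \<Longrightarrow>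
     lsmult M a (x \<ominus>\<^bsub>M\<^esub> y) = lsmult M a x \<ominus>\<^bsub>M\<^esub> lsmult M a y"
  by (rule additive_map_diff[OF M.abelian_group_axioms M.abelian_group_axioms])
    (auto simp: lsmult_closed lsmult_r_distr)

lemma lsmult_zero: "a \<in> carrier R \<Longrightarrow> lsmult M a \<zero>\<^bsub>M\<^esub> = \<zero>\<^bsub>M\<^esub>"
  by (rule additive_map_zero[OF M.abelian_group_axioms M.abelian_group_axioms])
    (auto simp: lsmult_closed lsmult_r_distr)

lemma zero_lsmult: "x \<in> carrier M \<Longrightarrow> lsmult M \<zero>\<^bsub>R\<^esub> x = \<zero>\<^bsub>M\<^esub>"
  by (rule additive_map_zero[OF R.abelian_group_axioms M.abelian_group_axioms, of "\<lambda>a. lsmult M a x"])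
    (auto simp: lsmult_closed lsmult_l_distr)

lemma diff_lsmult:
  "x \<in> carrier M \<Longrightarrow> a \<in> carrier R \<Longrightarrow> b \<in> carrier R \<Longrightarrow>
     lsmult M (a \<ominus>\<^bsub>R\<^esub> b) x = lsmult M a x \<ominus>\<^bsub>M\<^esub> lsmult M b x"
  by (rule additive_map_diff[OF R.abelian_group_axioms M.abelian_group_axioms, of "\<lambda>a. lsmult M a x"])
    (auto simp: lsmult_closed lsmult_l_distr)

end

context right_module
begin

lemma rsmult_diff:
  "a \<in> carrier R \<Longrightarrow> x \<in> carrier M \<Longrightarrow> y \<in> carrier M \<Longrightarrow>
     rsmult M (x \<ominus>\<^bsub>M\<^esub> y) a = rsmult M x a \<ominus>\<^bsub>M\<^esub> rsmult M y a"
  by (rule additive_map_diff[OF M.abelian_group_axioms M.abelian_group_axioms, of "\<lambda>x. rsmult M x a"])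
    (auto simp: rsmult_closed rsmult_l_distr)

lemma rsmult_zero: "a \<in> carrier R \<Longrightarrow> rsmult M \<zero>\<^bsub>M\<^esub> a = \<zero>\<^bsub>M\<^esub>"
  by (rule additive_map_zero[OF M.abelian_group_axioms M.abelian_group_axioms, of "\<lambda>x. rsmult M x a"])
    (auto simp: rsmult_closed rsmult_l_distr)

lemma zero_rsmult: "x \<in> carrier M \<Longrightarrow> rsmult M x \<zero>\<^bsub>R\<^esub> = \<zero>\<^bsub>M\<^esub>"
  by (rule additive_map_zero[OF R.abelian_group_axioms M.abelian_group_axioms, of "\<lambda>a. rsmult M x a"])
    (auto simp: rsmult_closed rsmult_r_distr)

lemma diff_rsmult:
  "x \<in> carrier M \<Longrightarrow> a \<in> carrier R \<Longrightarrow> b \<in> carrier R \<Longrightarrow>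
     rsmult M x (a \<ominus>\<^bsub>R\<^esub> b) = rsmult M x a \<ominus>\<^bsub>M\<^esub> rsmult M x b"
  by (rule additive_map_diff[OF R.abelian_group_axioms M.abelian_group_axioms, of "\<lambda>a. rsmult M x a"])
    (auto simp: rsmult_closed rsmult_r_distr)

end

section \<open>The right action of the enveloping ring on a bimodule\<close>

context bimodule
begin

lemma env_act_biadditive:
  "x \<in> carrier M \<Longrightarrow> biadditive R M (\<lambda>p. lsmult M (snd p) (rsmult M x (fst p)))"
  by (auto simp: biadditive_def lsmult_closed rsmult_closed rsmult_r_distr lsmult_l_distr lsmult_r_distr)

lemma env_act_pure:
  "x \<in> carrier M \<Longrightarrow> r \<in> carrier R \<Longrightarrow> s \<in> carrier R \<Longrightarrow>
     env_act M x (pure_tensor R r s) = lsmult M s (rsmult M x r)"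
  by (simp add: env_act_eq R.tensor_lift_pure[OF M.abelian_group_axioms env_act_biadditive])

lemma env_act_closed:
  "x \<in> carrier M \<Longrightarrow> t \<in> carrier E \<Longrightarrow> env_act M x t \<in> carrier M"
  by (simp add: env_act_eq R.tensor_lift_closed[OF M.abelian_group_axioms env_act_biadditive])

lemma env_act_add:
  "x \<in> carrier M \<Longrightarrow> s \<in> carrier E \<Longrightarrow> t \<in> carrier E \<Longrightarrow>
     env_act M x (s \<oplus>\<^bsub>E\<^esub> t) = env_act M x s \<oplus>\<^bsub>M\<^esub> env_act M x t"
  by (simp add: env_act_eq R.tensor_lift_add[OF M.abelian_group_axioms env_act_biadditive])

lemma env_abelian_group: "abelian_group E"
  using R.env_ring_is_ring by (rule ring.is_abelian_group)

lemma env_act_diff: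
  "x \<in> carrier M \<Longrightarrow> s \<in> carrier E \<Longrightarrow> t \<in> carrier E \<Longrightarrow>
     env_act M x (s \<ominus>\<^bsub>E\<^esub> t) = env_act M x s \<ominus>\<^bsub>M\<^esub> env_act M x t"
  by (rule additive_map_diff[OF env_abelian_group M.abelian_group_axioms])
    (auto simp: env_act_closed env_act_add)

lemma env_act_zero: "x \<in> carrier M \<Longrightarrow> env_act M x \<zero>\<^bsub>E\<^esub> = \<zero>\<^bsub>M\<^esub>"
  by (rule additive_map_zero[OF env_abelian_group M.abelian_group_axioms])
    (auto simp: env_act_closed env_act_add)

lemma env_act_add_left:
  assumes "x \<in> carrier M" "y \<in> carrier M" "t \<in> carrier E"
  shows "env_act M (x \<oplus>\<^bsub>M\<^esub> y) t = env_act M x t \<oplus>\<^bsub>M\<^esub> env_act M y t"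
  using assms(3)
proof (induction rule: R.env_ring_induct)
  case zero
  then show ?case using assms(1,2) by (simp add: env_act_zero)
next
  case (pure r s)
  then show ?case using assms(1,2)
    by (simp add: env_act_pure rsmult_closed lsmult_r_distr rsmult_l_distr)
next
  case (diff a b)
  have "env_act M x a \<in> carrier M" "env_act M x b \<in> carrier M"
    "env_act M y a \<in> carrier M" "env_act M y b \<in> carrier M"
    using assms diff by (simp_all add: env_act_closed)
  with diff show ?case using assms(1,2)
    by (simp add: env_act_diff) (simp add: a_minus_def M.minus_add M.a_ac)
qed

lemma env_act_zero_left:
  "t \<in> carrier E \<Longrightarrow> env_act M \<zero>\<^bsub>M\<^esub> t = \<zero>\<^bsub>M\<^esub>"
  by (rule additive_map_zero[OF M.abelian_group_axioms M.abelian_group_axioms, of "\<lambda>x. env_act M x t"])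
    (auto simp: env_act_closed env_act_add_left)

lemma env_act_diff_left:
  "x \<in> carrier M \<Longrightarrow> y \<in> carrier M \<Longrightarrow> t \<in> carrier E \<Longrightarrow>
     env_act M (x \<ominus>\<^bsub>M\<^esub> y) t = env_act M x t \<ominus>\<^bsub>M\<^esub> env_act M y t"
  by (rule additive_map_diff[OF M.abelian_group_axioms M.abelian_group_axioms, of "\<lambda>x. env_act M x t"])
    (auto simp: env_act_closed env_act_add_left)

text \<open>On pure tensors the reversed product in the second coordinate matches the order in which
  the left multiplications are performed, and the left and right actions commute. Additivity in both
  tensors extends this to all of the enveloping ring.\<close>

lemma env_act_mult:
  assumes x: "x \<in> carrier M" and s: "s \<in> carrier E" and t: "t \<in> carrier E"
  shows "env_act M x (s \<otimes>\<^bsub>E\<^esub> t) = env_act M (env_act M x s) t"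
  using s
proof (induction rule: R.env_ring_induct)
  interpret E: ring E by (rule R.env_ring_is_ring)
  {
    case zero
    then show ?case using x t by (simp add: env_act_zero env_act_zero_left)
  next
    case (diff a b)
    then show ?case using x t
      by (simp add: E.minus_eq E.l_distr E.l_minus)
        (simp add: env_act_diff env_act_diff_left env_act_closed flip: E.minus_eq)
  next
    case (pure a b)
    show ?case using t
    proof (induction rule: R.env_ring_induct)
      case zero
      then show ?case using x pure by (simp add: env_act_zero env_act_closed)
    next
      case (diff a' b')
      then show ?case using x pure
        by (simp add: E.minus_eq E.r_distr E.r_minus)
          (simp add: env_act_diff env_act_closed flip: E.minus_eq)
    next
      case (pure a' b')
      then show ?case using x \<open>a \<in> carrier R\<close> \<open>b \<in> carrier R\<close>
        by (simp add: R.pure_tensor_mult env_act_pure rsmult_closed lsmult_closed lsmult_assoc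
            rsmult_assoc lsmult_rsmult)
    qed
  }
qed

end

section \<open>One-sided ideals and colon ideals\<close>

lemma (in ring) left_ideal_iff:
  "left_ideal R I \<longleftrightarrow> I \<subseteq> carrier R \<and> \<zero> \<in> I \<and> (\<forall>x\<in>I. \<forall>y\<in>I. x \<ominus> y \<in> I) \<and>
     (\<forall>a\<in>I. \<forall>r\<in>carrier R. r \<otimes> a \<in> I)"
  by (auto simp: left_ideal_def additive_subgroup_iff)

lemma (in ring) right_ideal_iff:
  "right_ideal R I \<longleftrightarrow> I \<subseteq> carrier R \<and> \<zero> \<in> I \<and> (\<forall>x\<in>I. \<forall>y\<in>I. x \<ominus> y \<in> I) \<and>
     (\<forall>a\<in>I. \<forall>r\<in>carrier R. a \<otimes> r \<in> I)"
  by (auto simp: right_ideal_def additive_subgroup_iff)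

lemma (in ring) right_ideal_add: "right_ideal R K \<Longrightarrow> a \<in> K \<Longrightarrow> b \<in> K \<Longrightarrow> a \<oplus> b \<in> K"
  by (simp add: right_ideal_def additive_subgroup.a_closed)

lemma (in ring) right_ideal_carrier: "right_ideal R (carrier R)"
  by (auto simp: right_ideal_iff)

lemma (in ring) right_ideal_inter: "right_ideal R K \<Longrightarrow> right_ideal R L \<Longrightarrow> right_ideal R (K \<inter> L)"
  by (auto simp: right_ideal_iff)

lemma (in ring) right_ideal_colon:
  assumes "right_ideal R K" "t \<in> carrier R"
  shows "right_ideal R (right_colon R K t)"
  using assms unfolding right_ideal_iff right_colon_def
  by (auto simp: minus_eq r_distr r_minus m_assoc[symmetric])

lemma (in ring) left_ideal_colon:
  assumes "left_ideal R K" "t \<in> carrier R"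
  shows "left_ideal R (left_colon R K t)"
  using assms unfolding left_ideal_iff left_colon_def
  by (auto simp: minus_eq l_distr l_minus m_assoc)

section \<open>Quotient modules\<close>

lemma quotient_bimodule_simps [simp]:
  "carrier (quotient_bimodule M N) = a_rcosets\<^bsub>M\<^esub> N"
  "\<zero>\<^bsub>quotient_bimodule M N\<^esub> = N"
  "ring.add (quotient_bimodule M N) = set_add M"
  by (simp_all add: quotient_bimodule_def)

text \<open>An equality of records, by which right-hand facts about cosets are read off from the
  left-hand ones.\<close>

lemma quotient_opposite_module:
  "quotient_bimodule (opposite_module M) N = opposite_module (quotient_bimodule M N)"
  by (simp add: quotient_bimodule_def opposite_module_def A_RCOSETS_def RCOSETS_def r_coset_def
      a_r_coset_def set_add_def set_mult_def fun_eq_iff)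

context abelian_group
begin

lemma rcosets_eq_image: "a_rcosets N = (\<lambda>x. N +> x) ` carrier G"
  by (auto simp: A_RCOSETS_def')

lemma rcoset_add:
  assumes "additive_subgroup N G" "x \<in> carrier G" "y \<in> carrier G"
  shows "(N +> x) <+> (N +> y) = N +> (x \<oplus> y)"
  by (rule abelian_subgroup.a_rcos_sum)
    (use assms abelian_subgroupI3 abelian_group_axioms in auto)

lemma mem_rcoset:
  assumes "additive_subgroup N G" "x \<in> carrier G"
  shows "y \<in> N +> x \<longleftrightarrow> y \<in> carrier G \<and> y \<ominus> x \<in> N"
proof -
  interpret N: additive_subgroup N G by fact
  show ?thesis
  proof
    assume "y \<in> N +> x"
    then obtain n where "n \<in> N" "y = n \<oplus> x" by (auto simp: a_r_coset_def')
    then show "y \<in> carrier G \<and> y \<ominus> x \<in> N"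
      using assms(2) N.a_Hcarr by (auto simp: a_minus_def a_assoc r_neg)
  next
    assume y: "y \<in> carrier G \<and> y \<ominus> x \<in> N"
    then have "y = (y \<ominus> x) \<oplus> x" using assms(2) by (simp add: a_minus_def a_assoc l_neg)
    with y show "y \<in> N +> x" unfolding a_r_coset_def' by blast
  qed
qed

lemma rcoset_eq_iff:
  assumes "additive_subgroup N G" "x \<in> carrier G" "y \<in> carrier G"
  shows "N +> x = N +> y \<longleftrightarrow> x \<ominus> y \<in> N"
proof -
  interpret N: abelian_subgroup N G
    using assms abelian_subgroupI3 abelian_group_axioms by auto
  show ?thesis
    using mem_rcoset[OF assms(1,3), of x] N.a_rcos_self[OF assms(2)] assms
      a_repr_independence[OF _ assms(3), of x N] N.a_subgroup by metis
qed

lemma rcoset_eq_subgroup_iff: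
  assumes "additive_subgroup N G" "x \<in> carrier G"
  shows "N +> x = N \<longleftrightarrow> x \<in> N"
  using rcoset_eq_iff[OF assms zero_closed] assms a_coset_add_zero[of N]
    additive_subgroup.a_subset[OF assms(1)]
  by (simp add: a_minus_def a_inv_def)

end

lemma quotient_abelian_group:
  fixes M :: "('r, 'a, 'e) bimodule_scheme"
  assumes "additive_subgroup N M" "abelian_group M"
  shows "abelian_group (quotient_bimodule M N)"
proof -
  interpret M: abelian_group M by fact
  show ?thesis
  proof (rule abelian_groupI)
    fix X assume X: "X \<in> carrier (quotient_bimodule M N)"
    then obtain x where x: "x \<in> carrier M" "X = N +>\<^bsub>M\<^esub> x" by (auto simp: M.rcosets_eq_image)
    then have "(N +>\<^bsub>M\<^esub> (\<ominus>\<^bsub>M\<^esub> x)) <+>\<^bsub>M\<^esub> X = N"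
      using assms(1) M.rcoset_add[of N] by (simp add: M.l_neg additive_subgroup.a_subset)
    then show "\<exists>Y\<in>carrier (quotient_bimodule M N).
        Y \<oplus>\<^bsub>quotient_bimodule M N\<^esub> X = \<zero>\<^bsub>quotient_bimodule M N\<^esub>"
      using x(1) by (auto simp: M.rcosets_eq_image)
  next
    have "N = N +>\<^bsub>M\<^esub> \<zero>\<^bsub>M\<^esub>" using additive_subgroup.a_subset[OF assms(1)] by simp
    then show "\<zero>\<^bsub>quotient_bimodule M N\<^esub> \<in> carrier (quotient_bimodule M N)"
      by (auto simp: M.rcosets_eq_image)
    then show "\<zero>\<^bsub>quotient_bimodule M N\<^esub> \<oplus>\<^bsub>quotient_bimodule M N\<^esub> X = X"
      if "X \<in> carrier (quotient_bimodule M N)" for X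
      using that M.rcoset_add[OF assms(1), of "\<zero>\<^bsub>M\<^esub>"] \<open>N = _\<close>
      by (auto simp: M.rcosets_eq_image)
  qed (auto simp: M.rcosets_eq_image M.rcoset_add assms M.a_ac)
qed

text \<open>The action on a coset is a union over all its representatives. Since \<open>N\<close> is
  stable under \<open>a\<close>, they all contribute the same coset, and the union
  collapses.\<close>

lemma (in left_module) quotient_lsmult:
  assumes N: "additive_subgroup N M"
    and closed: "\<And>a x. a \<in> carrier R \<Longrightarrow> x \<in> N \<Longrightarrow> lsmult M a x \<in> N"
    and a: "a \<in> carrier R" and x: "x \<in> carrier M"
  shows "lsmult (quotient_bimodule M N) a (N +>\<^bsub>M\<^esub> x) = N +>\<^bsub>M\<^esub> lsmult M a x"
proof -
  have "N +>\<^bsub>M\<^esub> lsmult M a y = N +>\<^bsub>M\<^esub> lsmult M a x" if "y \<in> N +>\<^bsub>M\<^esub> x" for y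
  proof -
    have "y \<in> carrier M" "y \<ominus>\<^bsub>M\<^esub> x \<in> N" using that M.mem_rcoset[OF N x] by auto
    then show ?thesis
      using closed[OF a, of "y \<ominus>\<^bsub>M\<^esub> x"] a x
      by (simp add: M.rcoset_eq_iff[OF N] lsmult_closed lsmult_diff)
  qed
  moreover have "x \<in> N +>\<^bsub>M\<^esub> x"
    using M.mem_rcoset[OF N x] x N by (simp add: M.r_neg a_minus_def additive_subgroup.zero_closed)
  ultimately have "(\<lambda>y. N +>\<^bsub>M\<^esub> lsmult M a y) ` (N +>\<^bsub>M\<^esub> x) = {N +>\<^bsub>M\<^esub> lsmult M a x}"
    by blast
  then show ?thesis by (simp add: quotient_bimodule_def)
qed

lemma (in left_module) quotient_left_module:
  assumes N: "additive_subgroup N M"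
    and closed: "\<And>a x. a \<in> carrier R \<Longrightarrow> x \<in> N \<Longrightarrow> lsmult M a x \<in> N"
  shows "left_module R (quotient_bimodule M N)"
proof (intro left_module.intro left_module_axioms.intro quotient_abelian_group)
  note [simp] = quotient_lsmult[OF N closed] M.rcoset_add[OF N] M.rcosets_eq_image
  show "lsmult (quotient_bimodule M N) a x \<in> carrier (quotient_bimodule M N)"
    if "a \<in> carrier R" "x \<in> carrier (quotient_bimodule M N)" for a x
    using that by (auto simp: lsmult_closed)
qed (use N in \<open>auto simp: R.ring_axioms M.abelian_group_axioms quotient_lsmult[OF N closed]
        M.rcoset_add[OF N] M.rcosets_eq_image lsmult_closed lsmult_l_distr lsmult_r_distr
        lsmult_assoc lsmult_one\<close>)

lemma (in right_module) quotient_rsmult: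
  assumes N: "additive_subgroup N M"
    and closed: "\<And>a x. a \<in> carrier R \<Longrightarrow> x \<in> N \<Longrightarrow> rsmult M x a \<in> N"
    and a: "a \<in> carrier R" and x: "x \<in> carrier M"
  shows "rsmult (quotient_bimodule M N) (N +>\<^bsub>M\<^esub> x) a = N +>\<^bsub>M\<^esub> rsmult M x a"
  using left_module.quotient_lsmult[OF left_module_opposite, of N a x] assms
  by (simp add: quotient_opposite_module)
    (simp add: a_r_coset_def r_coset_def)

lemma (in right_module) quotient_right_module:
  assumes N: "additive_subgroup N M"
    and closed: "\<And>a x. a \<in> carrier R \<Longrightarrow> x \<in> N \<Longrightarrow> rsmult M x a \<in> N"
  shows "right_module R (quotient_bimodule M N)"
proof (intro right_module.intro right_module_axioms.intro quotient_abelian_group)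
  show "rsmult (quotient_bimodule M N) x a \<in> carrier (quotient_bimodule M N)"
    if "a \<in> carrier R" "x \<in> carrier (quotient_bimodule M N)" for a x
    using that by (auto simp: rsmult_closed quotient_rsmult[OF N closed] M.rcosets_eq_image)
qed (use N in \<open>auto simp: R.ring_axioms M.abelian_group_axioms quotient_rsmult[OF N closed]
        M.rcoset_add[OF N] M.rcosets_eq_image rsmult_closed rsmult_l_distr rsmult_r_distr
        rsmult_assoc rsmult_one\<close>)

lemma (in bimodule) quotient_bimodule_bimodule:
  assumes N: "additive_subgroup N M"
    and l: "\<And>a x. a \<in> carrier R \<Longrightarrow> x \<in> N \<Longrightarrow> lsmult M a x \<in> N"
    and r: "\<And>a x. a \<in> carrier R \<Longrightarrow> x \<in> N \<Longrightarrow> rsmult M x a \<in> N"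
  shows "bimodule R (quotient_bimodule M N)"
  by (intro bimodule.intro bimodule_axioms.intro quotient_left_module[OF N l]
      quotient_right_module[OF N r])
    (auto simp: M.rcosets_eq_image quotient_lsmult[OF N l] quotient_rsmult[OF N r]
      lsmult_closed rsmult_closed lsmult_rsmult)

section \<open>Derivations of the enveloping ring\<close>

text \<open>Pure tensors generate additively. Leibniz rules and compatibility with
  \<open>env_act\<close> are thereby checked on pure tensors, without choosing
  representatives.\<close>

lemma (in ring) env_additive_eqI:
  assumes G: "abelian_group G"
    and f: "f \<in> carrier E \<rightarrow> carrier G"
    and f_add: "\<And>s t. s \<in> carrier E \<Longrightarrow> t \<in> carrier E \<Longrightarrow>
          f (s \<oplus>\<^bsub>E\<^esub> t) = f s \<oplus>\<^bsub>G\<^esub> f t"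
    and g: "g \<in> carrier E \<rightarrow> carrier G"
    and g_add: "\<And>s t. s \<in> carrier E \<Longrightarrow> t \<in> carrier E \<Longrightarrow>
          g (s \<oplus>\<^bsub>E\<^esub> t) = g s \<oplus>\<^bsub>G\<^esub> g t"
    and pure: "\<And>r s. r \<in> carrier R \<Longrightarrow> s \<in> carrier R \<Longrightarrow> f (pure_tensor R r s) = g (pure_tensor R r s)"
    and t: "t \<in> carrier E"
  shows "f t = g t"
  using t
proof (induction rule: env_ring_induct)
  have E: "abelian_group E" using env_ring_is_ring by (rule ring.is_abelian_group)
  {
    case zero
    show ?case using additive_map_zero[OF E G f f_add] additive_map_zero[OF E G g g_add] by simp
  next
    case (diff a b)
    then show ?case
      using additive_map_diff[OF E G f f_add] additive_map_diff[OF E G g g_add] by simp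
  next
    case (pure r s)
    then show ?case by (rule assms(6))
  }
qed

definition env_derivation :: "('a, 'c) ring_scheme \<Rightarrow> ('a \<Rightarrow> 'a) \<Rightarrow> 'a tensor \<Rightarrow> 'a tensor" where
  "env_derivation R \<delta> = tensor_lift (env_ring R)
     (\<lambda>p. pure_tensor R (\<delta> (fst p)) (snd p) \<oplus>\<^bsub>env_ring R\<^esub> pure_tensor R (fst p) (\<delta> (snd p)))"

context ring
begin

lemma derivationD:
  assumes "derivation R \<delta>"
  shows "r \<in> carrier R \<Longrightarrow> \<delta> r \<in> carrier R"
    and "r \<in> carrier R \<Longrightarrow> s \<in> carrier R \<Longrightarrow> \<delta> (r \<oplus> s) = \<delta> r \<oplus> \<delta> s"
    and "r \<in> carrier R \<Longrightarrow> s \<in> carrier R \<Longrightarrow> \<delta> (r \<otimes> s) = \<delta> r \<otimes> s \<oplus> r \<otimes> \<delta> s"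
  using assms by (auto simp: derivation_def)

lemma derivation_diff:
  "derivation R \<delta> \<Longrightarrow> r \<in> carrier R \<Longrightarrow> s \<in> carrier R \<Longrightarrow> \<delta> (r \<ominus> s) = \<delta> r \<ominus> \<delta> s"
  by (rule additive_map_diff[OF abelian_group_axioms abelian_group_axioms]) (auto simp: derivationD)

lemma derivation_zero: "derivation R \<delta> \<Longrightarrow> \<delta> \<zero> = \<zero>"
  by (rule additive_map_zero[OF abelian_group_axioms abelian_group_axioms]) (auto simp: derivationD)

text \<open>From 1 = 1 \<cdot> 1 one gets \<delta> 1 = \<delta> 1 + \<delta> 1. As a consequence the
  induced derivation sends j \<otimes> 1 to \<delta> j \<otimes> 1 and 1 \<otimes> i to 1 \<otimes>
  \<delta> i.\<close>

lemma derivation_one: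
  assumes "derivation R \<delta>"
  shows "\<delta> \<one> = \<zero>"
proof -
  have "\<delta> \<one> = \<delta> \<one> \<oplus> \<delta> \<one>" using derivationD(3)[OF assms, of \<one> \<one>] derivationD(1)[OF assms, of \<one>] by simp
  then show ?thesis using derivationD(1)[OF assms, of \<one>] by (metis add.r_cancel_one one_closed)
qed

lemma pure_tensor_zero:
  assumes "r \<in> carrier R"
  shows "pure_tensor R r \<zero> = \<zero>\<^bsub>E\<^esub>" "pure_tensor R \<zero> r = \<zero>\<^bsub>E\<^esub>"
proof -
  have E: "abelian_group E" using env_ring_is_ring by (rule ring.is_abelian_group)
  show "pure_tensor R r \<zero> = \<zero>\<^bsub>E\<^esub>"
    by (rule additive_map_zero[OF abelian_group_axioms E]) (use assms in \<open>auto simp: pure_tensor_add_right\<close>)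
  show "pure_tensor R \<zero> r = \<zero>\<^bsub>E\<^esub>"
    by (rule additive_map_zero[OF abelian_group_axioms E, of "\<lambda>s. pure_tensor R s r"])
      (use assms in \<open>auto simp: pure_tensor_add_left\<close>)
qed

context
  fixes \<delta> assumes der: "derivation R \<delta>"
begin

interpretation E: ring E by (rule env_ring_is_ring)

lemma env_derivation_biadditive:
  "biadditive R E
     (\<lambda>p. pure_tensor R (\<delta> (fst p)) (snd p) \<oplus>\<^bsub>E\<^esub> pure_tensor R (fst p) (\<delta> (snd p)))"
  using derivationD[OF der]
  by (auto simp: biadditive_def pure_tensor_add_left pure_tensor_add_right E.a_ac)

lemma env_derivation_pure:
  "r \<in> carrier R \<Longrightarrow> s \<in> carrier R \<Longrightarrow> env_derivation R \<delta> (pure_tensor R r s) =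
     pure_tensor R (\<delta> r) s \<oplus>\<^bsub>E\<^esub> pure_tensor R r (\<delta> s)"
  by (simp add: env_derivation_def tensor_lift_pure[OF E.abelian_group_axioms env_derivation_biadditive])

lemma env_derivation_closed:
  "t \<in> carrier E \<Longrightarrow> env_derivation R \<delta> t \<in> carrier E"
  by (simp add: env_derivation_def tensor_lift_closed[OF E.abelian_group_axioms env_derivation_biadditive])

lemma env_derivation_add:
  "s \<in> carrier E \<Longrightarrow> t \<in> carrier E \<Longrightarrow>
     env_derivation R \<delta> (s \<oplus>\<^bsub>E\<^esub> t) =
       env_derivation R \<delta> s \<oplus>\<^bsub>E\<^esub> env_derivation R \<delta> t"
  by (simp add: env_derivation_def tensor_lift_add[OF E.abelian_group_axioms env_derivation_biadditive])

text \<open>The second coordinates are multiplied in the opposite ring, but \<delta> is a derivation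
  there too because addition is commutative. Both sides are additive in \<open>s\<close> and in
  \<open>t\<close>, so pure tensors suffice.\<close>

lemma env_derivation_mult:
  assumes s: "s \<in> carrier E" and t: "t \<in> carrier E"
  shows "env_derivation R \<delta> (s \<otimes>\<^bsub>E\<^esub> t) =
     env_derivation R \<delta> s \<otimes>\<^bsub>E\<^esub> t \<oplus>\<^bsub>E\<^esub> s \<otimes>\<^bsub>E\<^esub> env_derivation R \<delta> t"
proof (rule env_additive_eqI[OF E.abelian_group_axioms _ _ _ _ _ s])
  fix a b assume ab: "a \<in> carrier R" "b \<in> carrier R"
  show "env_derivation R \<delta> (pure_tensor R a b \<otimes>\<^bsub>E\<^esub> t) =
     env_derivation R \<delta> (pure_tensor R a b) \<otimes>\<^bsub>E\<^esub> t \<oplus>\<^bsub>E\<^esub>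
       pure_tensor R a b \<otimes>\<^bsub>E\<^esub> env_derivation R \<delta> t"
  proof (rule env_additive_eqI[OF E.abelian_group_axioms _ _ _ _ _ t])
    fix a' b' assume ab': "a' \<in> carrier R" "b' \<in> carrier R"
    show "env_derivation R \<delta> (pure_tensor R a b \<otimes>\<^bsub>E\<^esub> pure_tensor R a' b') =
     env_derivation R \<delta> (pure_tensor R a b) \<otimes>\<^bsub>E\<^esub> pure_tensor R a' b' \<oplus>\<^bsub>E\<^esub>
       pure_tensor R a b \<otimes>\<^bsub>E\<^esub> env_derivation R \<delta> (pure_tensor R a' b')"
      using ab ab' derivationD[OF der]
      by (simp add: pure_tensor_mult env_derivation_pure E.l_distr E.r_distr pure_tensor_add_left
          pure_tensor_add_right E.a_ac)
  qed (use ab in \<open>auto simp: env_derivation_closed env_derivation_add E.r_distr E.l_distr E.a_ac\<close>)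
qed (use t in \<open>auto simp: env_derivation_closed env_derivation_add E.r_distr E.l_distr E.a_ac\<close>)

lemma env_derivation_derivation: "derivation E (env_derivation R \<delta>)"
  by (simp add: derivation_def env_derivation_closed env_derivation_add env_derivation_mult)

end

end

declare (in left_module) lsmult_closed [simp]
declare (in right_module) rsmult_closed [simp]

lemma module_derivationD:
  assumes "module_derivation R M \<delta> d"
  shows "x \<in> carrier M \<Longrightarrow> d x \<in> carrier M"
    and "x \<in> carrier M \<Longrightarrow> y \<in> carrier M \<Longrightarrow> d (x \<oplus>\<^bsub>M\<^esub> y) = d x \<oplus>\<^bsub>M\<^esub> d y"
    and "x \<in> carrier M \<Longrightarrow> r \<in> carrier R \<Longrightarrow>
      d (rsmult M x r) = rsmult M (d x) r \<oplus>\<^bsub>M\<^esub> rsmult M x (\<delta> r)"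
    and "x \<in> carrier M \<Longrightarrow> r \<in> carrier R \<Longrightarrow>
      d (lsmult M r x) = lsmult M (\<delta> r) x \<oplus>\<^bsub>M\<^esub> lsmult M r (d x)"
  using assms by (auto simp: module_derivation_def)

context bimodule
begin

text \<open>Packs the left and the right Leibniz rule into a single one. At the pure tensor r
  \<otimes> s both sides are the sum of (\<delta> s) x r, s (d x) r and s x (\<delta> r).\<close>

lemma module_derivation_env_act:
  assumes \<delta>: "derivation R \<delta>" and d: "module_derivation R M \<delta> d"
    and x: "x \<in> carrier M" and t: "t \<in> carrier E"
  shows "d (env_act M x t) = env_act M (d x) t \<oplus>\<^bsub>M\<^esub> env_act M x (env_derivation R \<delta> t)"
proof (rule R.env_additive_eqI[OF M.abelian_group_axioms _ _ _ _ _ t])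
  note [simp] = module_derivationD[OF d] R.derivationD[OF \<delta>]
  fix r s assume rs: "r \<in> carrier R" "s \<in> carrier R"
  show "d (env_act M x (pure_tensor R r s)) = env_act M (d x) (pure_tensor R r s) \<oplus>\<^bsub>M\<^esub>
      env_act M x (env_derivation R \<delta> (pure_tensor R r s))"
    using rs x by (simp add: env_act_pure R.env_derivation_pure[OF \<delta>] env_act_add lsmult_r_distr M.a_ac)
qed (use x in \<open>auto simp: env_act_closed env_act_add module_derivationD[OF d] M.a_ac
        R.env_derivation_closed[OF \<delta>] R.env_derivation_add[OF \<delta>]\<close>)

end

section \<open>Symmetric filters\<close>

lemma left_gabriel_filterD:
  assumes "left_gabriel_filter R F"
  shows "I \<in> F \<Longrightarrow> left_ideal R I"
    and "I \<in> F \<Longrightarrow> left_ideal R J \<Longrightarrow> I \<subseteq> J \<Longrightarrow> J \<in> F"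
    and "I \<in> F \<Longrightarrow> J \<in> F \<Longrightarrow> I \<inter> J \<in> F"
    and "I \<in> F \<Longrightarrow> a \<in> carrier R \<Longrightarrow> left_colon R I a \<in> F"
    and "J \<in> F \<Longrightarrow> left_ideal R I \<Longrightarrow> (\<And>a. a \<in> J \<Longrightarrow> left_colon R I a \<in> F) \<Longrightarrow> I \<in> F"
proof -
  note * = assms[unfolded left_gabriel_filter_def]
  show "I \<in> F \<Longrightarrow> left_ideal R I"
    using * by (elim conjE) (rule bspec)
  show "I \<in> F \<Longrightarrow> left_ideal R J \<Longrightarrow> I \<subseteq> J \<Longrightarrow> J \<in> F"
    using * by (elim conjE) metis
  show "I \<in> F \<Longrightarrow> J \<in> F \<Longrightarrow> I \<inter> J \<in> F"
    using * by (elim conjE) metis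
  show "I \<in> F \<Longrightarrow> a \<in> carrier R \<Longrightarrow> left_colon R I a \<in> F"
    using * by (elim conjE) metis
  show "J \<in> F \<Longrightarrow> left_ideal R I \<Longrightarrow> (\<And>a. a \<in> J \<Longrightarrow> left_colon R I a \<in> F) \<Longrightarrow> I \<in> F"
    using * by (elim conjE) metis
qed

lemma right_gabriel_filterD:
  assumes "right_gabriel_filter R F"
  shows "I \<in> F \<Longrightarrow> right_ideal R I"
    and "I \<in> F \<Longrightarrow> right_ideal R J \<Longrightarrow> I \<subseteq> J \<Longrightarrow> J \<in> F"
    and "I \<in> F \<Longrightarrow> J \<in> F \<Longrightarrow> I \<inter> J \<in> F"
    and "I \<in> F \<Longrightarrow> a \<in> carrier R \<Longrightarrow> right_colon R I a \<in> F"
    and "J \<in> F \<Longrightarrow> right_ideal R I \<Longrightarrow> (\<And>a. a \<in> J \<Longrightarrow> right_colon R I a \<in> F) \<Longrightarrow> I \<in> F"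
proof -
  note * = assms[unfolded right_gabriel_filter_def]
  show "I \<in> F \<Longrightarrow> right_ideal R I"
    using * by (elim conjE) (rule bspec)
  show "I \<in> F \<Longrightarrow> right_ideal R J \<Longrightarrow> I \<subseteq> J \<Longrightarrow> J \<in> F"
    using * by (elim conjE) metis
  show "I \<in> F \<Longrightarrow> J \<in> F \<Longrightarrow> I \<inter> J \<in> F"
    using * by (elim conjE) metis
  show "I \<in> F \<Longrightarrow> a \<in> carrier R \<Longrightarrow> right_colon R I a \<in> F"
    using * by (elim conjE) metis
  show "J \<in> F \<Longrightarrow> right_ideal R I \<Longrightarrow> (\<And>a. a \<in> J \<Longrightarrow> right_colon R I a \<in> F) \<Longrightarrow> I \<in> F"
    using * by (elim conjE) metis
qed

lemma (in ring) left_gabriel_filter_derivation: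
  assumes F: "left_gabriel_filter R F" and \<delta>: "derivation R \<delta>" and I: "I \<in> F"
  shows "{a \<in> I. \<delta> a \<in> I} \<in> F"
proof -
  note F = left_gabriel_filterD[OF F]
  have l: "left_ideal R I" using I by (rule F(1))
  then have Ic: "I \<subseteq> carrier R" by (simp add: left_ideal_iff)
  have add: "a \<oplus> b \<in> I" if "a \<in> I" "b \<in> I" for a b
    using l that by (simp add: left_ideal_def additive_subgroup.a_closed)
  \<comment> \<open>Closure under left multiplication uses both conditions: \<delta> (r a) =
    \<delta> r a + r \<delta> a, where the first summand lies in \<open>I\<close> because
    \<open>a\<close> does and the second because \<delta> a does.\<close>
  have l': "left_ideal R {a \<in> I. \<delta> a \<in> I}"
    unfolding left_ideal_iff
    using l[unfolded left_ideal_iff] subsetD[OF Ic]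
    by (intro conjI ballI) (auto simp: derivation_diff[OF \<delta>] derivation_zero[OF \<delta>]
        derivationD[OF \<delta>] add)
  show ?thesis
  proof (rule F(5)[OF I l'])
    fix a assume a: "a \<in> I"
    show "left_colon R {a \<in> I. \<delta> a \<in> I} a \<in> F"
    proof (rule F(2)[OF F(4)[OF I]])
      show "\<delta> a \<in> carrier R" using subsetD[OF Ic a] by (rule derivationD(1)[OF \<delta>])
      show "left_ideal R (left_colon R {a \<in> I. \<delta> a \<in> I} a)"
        using l' subsetD[OF Ic a] by (rule left_ideal_colon)
      \<comment> \<open>If x \<delta> a is in \<open>I\<close>, then \<delta> (x a) = \<delta> x a +
        x \<delta> a is in \<open>I\<close> as well, the first summand because \<open>a\<close> is
        in \<open>I\<close>.\<close>
      show "left_colon R I (\<delta> a) \<subseteq> left_colon R {a \<in> I. \<delta> a \<in> I} a"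
        using l[unfolded left_ideal_iff] a subsetD[OF Ic a]
        by (auto simp: left_colon_def derivationD[OF \<delta>] add)
    qed
  qed
qed

lemma (in ring) right_gabriel_filter_derivation:
  assumes "right_gabriel_filter R F" "derivation R \<delta>" "I \<in> F"
  shows "{a \<in> I. \<delta> a \<in> I} \<in> F"
  using ring.left_gabriel_filter_derivation[OF opposite_ring, of F \<delta> I] assms by simp

lemma (in ring) left_gabriel_filter_carrier: "left_gabriel_filter R F \<Longrightarrow> carrier R \<in> F"
proof -
  assume F: "left_gabriel_filter R F"
  have "F \<noteq> {}" using F[unfolded left_gabriel_filter_def] by (rule conjunct1)
  then obtain I where I: "I \<in> F" by blast
  show ?thesis
    using left_gabriel_filterD(1)[OF F I]
    by (intro left_gabriel_filterD(2)[OF F I]) (auto simp: left_ideal_iff)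
qed

lemma (in ring) right_gabriel_filter_carrier: "right_gabriel_filter R F \<Longrightarrow> carrier R \<in> F"
  using ring.left_gabriel_filter_carrier[OF opposite_ring, of F] by simp

locale symmetric_theory = ring R for R :: "('a, 'c) ring_scheme" (structure) +
  fixes F :: "'a filter_pair"
  assumes gabriel: "gabriel_pair R F"
begin

lemma left_gabriel: "left_gabriel_filter R (fst F)" and right_gabriel: "right_gabriel_filter R (snd F)"
  using gabriel by (auto simp: gabriel_pair_def)

sublocale E: ring E by (rule env_ring_is_ring)

lemma fst_subset: "I \<in> fst F \<Longrightarrow> i \<in> I \<Longrightarrow> i \<in> carrier R"
  using left_gabriel_filterD(1)[OF left_gabriel, of I] by (auto simp: left_ideal_iff)

lemma snd_subset: "J \<in> snd F \<Longrightarrow> j \<in> J \<Longrightarrow> j \<in> carrier R"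
  using right_gabriel_filterD(1)[OF right_gabriel, of J] by (auto simp: right_ideal_iff)

text \<open>A right ideal containing j \<otimes> 1 contains j \<otimes> s = (j \<otimes> 1) (1
  \<otimes> s), and likewise r \<otimes> i = (1 \<otimes> i) (r \<otimes> 1). So the sum of the two
  generated subgroups may be replaced by the generators with a 1 in one coordinate.\<close>

lemma symmetric_filter_iff:
  "K \<in> symmetric_filter R F \<longleftrightarrow> right_ideal E K \<and>
     (\<exists>I\<in>fst F. \<exists>J\<in>snd F. (\<forall>j\<in>J. pure_tensor R j \<one> \<in> K) \<and> (\<forall>i\<in>I. pure_tensor R \<one> i \<in> K))"
  (is "?L \<longleftrightarrow> ?R")
proof
  assume ?L
  then obtain I J where IJ: "I \<in> fst F" "J \<in> snd F" and K: "right_ideal E K"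
    and sub: "generate (add_monoid E) {pure_tensor R j s | j s. j \<in> J \<and> s \<in> carrier R}
             <+>\<^bsub>E\<^esub>
           generate (add_monoid E) {pure_tensor R r i | r i. r \<in> carrier R \<and> i \<in> I} \<subseteq> K"
      (is "?A <+>\<^bsub>_\<^esub> ?B \<subseteq> K")
    unfolding symmetric_filter_def by blast
  \<comment> \<open>Zero lies in both subgroups, so each of them is contained in their sum.\<close>
  have zero: "\<zero>\<^bsub>E\<^esub> \<in> ?A" "\<zero>\<^bsub>E\<^esub> \<in> ?B"
    using generate.one[of "add_monoid E"] by simp_all
  have "pure_tensor R j \<one> \<in> K" if "j \<in> J" for j
  proof -
    have "pure_tensor R j \<one> \<in> ?A" using that by (intro generate.incl) auto
    with zero have "pure_tensor R j \<one> \<oplus>\<^bsub>E\<^esub> \<zero>\<^bsub>E\<^esub> \<in> K"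
      using sub unfolding set_add_def' by blast
    then show ?thesis using snd_subset[OF IJ(2) that] by simp
  qed
  moreover have "pure_tensor R \<one> i \<in> K" if "i \<in> I" for i
  proof -
    have "pure_tensor R \<one> i \<in> ?B" using that by (intro generate.incl) auto
    with zero have "\<zero>\<^bsub>E\<^esub> \<oplus>\<^bsub>E\<^esub> pure_tensor R \<one> i \<in> K"
      using sub unfolding set_add_def' by blast
    then show ?thesis using fst_subset[OF IJ(1) that] by simp
  qed
  ultimately show ?R using IJ K by blast
next
  assume ?R
  then obtain I J where IJ: "I \<in> fst F" "J \<in> snd F" and K: "right_ideal E K"
    and J: "\<And>j. j \<in> J \<Longrightarrow> pure_tensor R j \<one> \<in> K" and I: "\<And>i. i \<in> I \<Longrightarrow> pure_tensor R \<one> i \<in> K"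
    by blast
  interpret K: additive_subgroup K E using K by (simp add: right_ideal_def)
  have mult: "k \<otimes>\<^bsub>E\<^esub> t \<in> K" if "k \<in> K" "t \<in> carrier E" for k t
    using K that by (simp add: right_ideal_def)
  have set_add_subset: "A <+>\<^bsub>E\<^esub> B \<subseteq> K" if "A \<subseteq> K" "B \<subseteq> K" for A B
    using that K.a_closed unfolding set_add_def' by blast
  have sub: "generate (add_monoid E) S \<subseteq> K" if "S \<subseteq> K" for S
    using that E.add.generate_subgroup_incl[OF that K.a_subgroup] by simp
  have "{pure_tensor R j s | j s. j \<in> J \<and> s \<in> carrier R} \<subseteq> K"
  proof safe
    fix j s assume "j \<in> J" "s \<in> carrier R"
    then show "pure_tensor R j s \<in> K"
      using mult[OF J, of j "pure_tensor R \<one> s"] snd_subset[OF IJ(2)] by (simp add: pure_tensor_mult)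
  qed
  moreover have "{pure_tensor R r i | r i. r \<in> carrier R \<and> i \<in> I} \<subseteq> K"
  proof safe
    fix r i assume "i \<in> I" "r \<in> carrier R"
    then show "pure_tensor R r i \<in> K"
      using mult[OF I, of i "pure_tensor R r \<one>"] fst_subset[OF IJ(1)] by (simp add: pure_tensor_mult)
  qed
  ultimately show ?L
    using IJ K unfolding symmetric_filter_def
    by (intro CollectI conjI bexI[of _ I] bexI[of _ J] set_add_subset sub) simp_all
qed

lemma symmetric_filterI:
  assumes "right_ideal E K" "I \<in> fst F" "J \<in> snd F"
    and "\<And>j. j \<in> J \<Longrightarrow> pure_tensor R j \<one> \<in> K" "\<And>i. i \<in> I \<Longrightarrow> pure_tensor R \<one> i \<in> K"
  shows "K \<in> symmetric_filter R F"
  unfolding symmetric_filter_iff using assms by blast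

lemma symmetric_filterE:
  assumes "K \<in> symmetric_filter R F"
  obtains I J where "right_ideal E K" "I \<in> fst F" "J \<in> snd F"
    "\<And>j. j \<in> J \<Longrightarrow> pure_tensor R j \<one> \<in> K" "\<And>i. i \<in> I \<Longrightarrow> pure_tensor R \<one> i \<in> K"
  using assms unfolding symmetric_filter_iff by blast

lemma symmetric_filter_right_ideal: "K \<in> symmetric_filter R F \<Longrightarrow> right_ideal E K"
  by (simp add: symmetric_filter_iff)

lemma symmetric_filter_subset: "K \<in> symmetric_filter R F \<Longrightarrow> k \<in> K \<Longrightarrow> k \<in> carrier E"
  using symmetric_filter_right_ideal[of K] by (auto simp: E.right_ideal_iff)

lemma symmetric_filter_carrier: "carrier E \<in> symmetric_filter R F"
  using left_gabriel_filter_carrier[OF left_gabriel] right_gabriel_filter_carrier[OF right_gabriel]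
  by (auto simp: symmetric_filter_iff E.right_ideal_carrier intro!: bexI[of _ "carrier R"])

lemma symmetric_filter_inter:
  assumes "K \<in> symmetric_filter R F" "L \<in> symmetric_filter R F"
  shows "K \<inter> L \<in> symmetric_filter R F"
proof -
  obtain I J where IJ: "right_ideal E K" "I \<in> fst F" "J \<in> snd F"
    "\<And>j. j \<in> J \<Longrightarrow> pure_tensor R j \<one> \<in> K" "\<And>i. i \<in> I \<Longrightarrow> pure_tensor R \<one> i \<in> K"
    using assms(1) by (rule symmetric_filterE) blast
  obtain I' J' where IJ': "right_ideal E L" "I' \<in> fst F" "J' \<in> snd F"
    "\<And>j. j \<in> J' \<Longrightarrow> pure_tensor R j \<one> \<in> L" "\<And>i. i \<in> I' \<Longrightarrow> pure_tensor R \<one> i \<in> L"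
    using assms(2) by (rule symmetric_filterE) blast
  show ?thesis
  proof (rule symmetric_filterI)
    show "right_ideal E (K \<inter> L)" using IJ(1) IJ'(1) by (rule E.right_ideal_inter)
    show "I \<inter> I' \<in> fst F" using IJ(2) IJ'(2) by (rule left_gabriel_filterD(3)[OF left_gabriel])
    show "J \<inter> J' \<in> snd F" using IJ(3) IJ'(3) by (rule right_gabriel_filterD(3)[OF right_gabriel])
  qed (auto simp: IJ IJ')
qed

lemma symmetric_filter_upper:
  "K \<in> symmetric_filter R F \<Longrightarrow> right_ideal E L \<Longrightarrow> K \<subseteq> L \<Longrightarrow> L \<in> symmetric_filter R F"
  unfolding symmetric_filter_iff by blast

text \<open>The pure tensors carry the content: (r \<otimes> s) (j \<otimes> 1) = (r j \<otimes> 1)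
  (1 \<otimes> s) and (r \<otimes> s) (1 \<otimes> i) = (1 \<otimes> i s) (r \<otimes> 1). Hence the
  colon of \<open>J\<close> by \<open>r\<close> and the colon of \<open>I\<close> by
  \<open>s\<close> witness membership. A difference is handled by intersecting two colon
  ideals.\<close>

lemma symmetric_filter_colon:
  assumes K: "K \<in> symmetric_filter R F" and t: "t \<in> carrier E"
  shows "right_colon E K t \<in> symmetric_filter R F"
  using t
proof (induction rule: env_ring_induct)
  have Kr: "right_ideal E K" using K by (simp add: symmetric_filter_iff)
  {
    case zero
    have "right_colon E K \<zero>\<^bsub>E\<^esub> = carrier E"
      using Kr by (auto simp: right_colon_def E.right_ideal_iff)
    then show ?case by (simp add: symmetric_filter_carrier)
  next
    case (diff a b)
    then have "right_colon E K a \<inter> right_colon E K b \<in> symmetric_filter R F"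
      by (simp add: symmetric_filter_inter)
    moreover have "right_colon E K a \<inter> right_colon E K b
        \<subseteq> right_colon E K (a \<ominus>\<^bsub>E\<^esub> b)"
      using Kr diff by (auto simp: right_colon_def E.right_ideal_iff E.minus_eq E.l_distr E.l_minus)
    ultimately show ?case
      using symmetric_filter_upper E.right_ideal_colon[OF Kr] diff by simp
  next
    case (pure r s)
    obtain I J where IJ: "I \<in> fst F" "J \<in> snd F" "\<And>j. j \<in> J \<Longrightarrow> pure_tensor R j \<one> \<in> K"
      "\<And>i. i \<in> I \<Longrightarrow> pure_tensor R \<one> i \<in> K"
      using K by (rule symmetric_filterE) blast
    have mult: "k \<otimes>\<^bsub>E\<^esub> t \<in> K" if "k \<in> K" "t \<in> carrier E" for k t
      using Kr that by (simp add: right_ideal_def)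
    have "pure_tensor R r s \<otimes>\<^bsub>E\<^esub> pure_tensor R j \<one> \<in> K" if "j \<in> right_colon R J r" for j
      using mult[OF IJ(3), of "r \<otimes> j" "pure_tensor R \<one> s"] that pure
      by (simp add: right_colon_def pure_tensor_mult)
    moreover have "pure_tensor R r s \<otimes>\<^bsub>E\<^esub> pure_tensor R \<one> i \<in> K" if "i \<in> left_colon R I s" for i
      using mult[OF IJ(4), of "i \<otimes> s" "pure_tensor R r \<one>"] that pure
      by (simp add: left_colon_def pure_tensor_mult)
    moreover have "right_colon R J r \<in> snd F" "left_colon R I s \<in> fst F"
      using IJ pure left_gabriel_filterD(4)[OF left_gabriel] right_gabriel_filterD(4)[OF right_gabriel]
      by auto
    ultimately show ?case
      using E.right_ideal_colon[OF Kr, of "pure_tensor R r s"] pure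
      by (intro symmetric_filterI[of _ "left_colon R I s" "right_colon R J r"])
        (auto simp: right_colon_def[of E] right_colon_def[of R J] left_colon_def)
  }
qed

text \<open>By the action of the induced derivation on j \<otimes> 1 and 1 \<otimes> i, the claim
  reduces to the one-sided filters: those \<open>a\<close> in \<open>I\<close>, respectively in
  \<open>J\<close>, whose image under \<delta> stays there are the witnesses.\<close>

lemma symmetric_filter_derivation:
  assumes K: "K \<in> symmetric_filter R F" and \<delta>: "derivation R \<delta>"
  shows "{k \<in> K. env_derivation R \<delta> k \<in> K} \<in> symmetric_filter R F"
proof -
  let ?D = "env_derivation R \<delta>"
  have D: "derivation E ?D" using \<delta> by (rule env_derivation_derivation)
  have Kr: "right_ideal E K" using K by (simp add: symmetric_filter_iff)
  have Kc: "k \<in> carrier E" if "k \<in> K" for k using that K symmetric_filter_subset by auto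
  obtain I J where IJ: "I \<in> fst F" "J \<in> snd F" "\<And>j. j \<in> J \<Longrightarrow> pure_tensor R j \<one> \<in> K"
    "\<And>i. i \<in> I \<Longrightarrow> pure_tensor R \<one> i \<in> K"
    using K by (rule symmetric_filterE) blast
  have "{a \<in> I. \<delta> a \<in> I} \<in> fst F" "{a \<in> J. \<delta> a \<in> J} \<in> snd F"
    using IJ \<delta> left_gabriel right_gabriel
    by (simp_all add: left_gabriel_filter_derivation right_gabriel_filter_derivation)
  moreover have "right_ideal E {k \<in> K. ?D k \<in> K}"
    using Kr E.right_ideal_add[OF Kr] Kc
    by (auto simp: E.right_ideal_iff E.derivation_zero[OF D] E.derivation_diff[OF D]
        E.derivationD[OF D])
  moreover have "?D (pure_tensor R j \<one>) \<in> K" if "j \<in> J" "\<delta> j \<in> J" for j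
    using that IJ snd_subset[OF IJ(2)] derivationD(1)[OF \<delta>]
    by (simp add: env_derivation_pure[OF \<delta>] derivation_one[OF \<delta>] pure_tensor_zero)
  moreover have "?D (pure_tensor R \<one> i) \<in> K" if "i \<in> I" "\<delta> i \<in> I" for i
    using that IJ fst_subset[OF IJ(1)] derivationD(1)[OF \<delta>]
    by (simp add: env_derivation_pure[OF \<delta>] derivation_one[OF \<delta>] pure_tensor_zero)
  ultimately show ?thesis
    using IJ(3,4) by (intro symmetric_filterI[of _ "{a \<in> I. \<delta> a \<in> I}" "{a \<in> J. \<delta> a \<in> J}"]) auto
qed

end

lemma (in abelian_group) diff_self: "x \<in> carrier G \<Longrightarrow> x \<ominus> x = \<zero>"
  by (simp add: a_minus_def r_neg)

section \<open>Modules of quotients\<close>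

locale symmetric_module = bimodule R M + symmetric_theory R F
  for R :: "('a, 'c) ring_scheme" (structure)
    and M :: "('a, 'm, 'e) bimodule_scheme" (structure)
    and F :: "'a filter_pair"
begin

lemma annihilator_right_ideal:
  assumes "x \<in> carrier M"
  shows "right_ideal E {t \<in> carrier E. env_act M x t = \<zero>\<^bsub>M\<^esub>}"
  using assms unfolding E.right_ideal_iff
  by (auto simp: env_act_zero env_act_diff env_act_mult env_act_zero_left M.diff_self)

text \<open>Acting with j \<otimes> 1 gives x j and acting with 1 \<otimes> i gives i x. So the
  annihilator belongs to the symmetric filter exactly if a right member and a left member annihilate
  \<open>x\<close> on their sides. From here on torsion is treated as torsion of a right module over
  the enveloping ring.\<close>

lemma annihilator_in_filter_iff:
  assumes x: "x \<in> carrier M"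
  shows "{t \<in> carrier E. env_act M x t = \<zero>\<^bsub>M\<^esub>} \<in> symmetric_filter R F \<longleftrightarrow>
    x \<in> symmetric_torsion M F" (is "?K \<in> _ \<longleftrightarrow> _")
proof
  assume "?K \<in> symmetric_filter R F"
  then obtain I J where IJ: "I \<in> fst F" "J \<in> snd F" "\<And>j. j \<in> J \<Longrightarrow> pure_tensor R j \<one> \<in> ?K"
    "\<And>i. i \<in> I \<Longrightarrow> pure_tensor R \<one> i \<in> ?K"
    by (rule symmetric_filterE) blast
  have "rsmult M x j = \<zero>\<^bsub>M\<^esub>" if "j \<in> J" for j
    using IJ(3)[OF that] snd_subset[OF IJ(2) that] x by (simp add: env_act_pure lsmult_one)
  moreover have "lsmult M i x = \<zero>\<^bsub>M\<^esub>" if "i \<in> I" for i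
    using IJ(4)[OF that] fst_subset[OF IJ(1) that] x by (simp add: env_act_pure rsmult_one)
  ultimately show "x \<in> symmetric_torsion M F"
    using IJ x by (auto simp: symmetric_torsion_def left_torsion_def right_torsion_def)
next
  assume "x \<in> symmetric_torsion M F"
  then obtain I J where IJ: "I \<in> fst F" "J \<in> snd F"
    and I: "\<And>i. i \<in> I \<Longrightarrow> lsmult M i x = \<zero>\<^bsub>M\<^esub>" and J: "\<And>j. j \<in> J \<Longrightarrow> rsmult M x j = \<zero>\<^bsub>M\<^esub>"
    by (auto simp: symmetric_torsion_def left_torsion_def right_torsion_def)
  show "?K \<in> symmetric_filter R F"
    by (rule symmetric_filterI[OF annihilator_right_ideal[OF x] IJ])
      (auto simp: env_act_pure x I J fst_subset[OF IJ(1)] snd_subset[OF IJ(2)] rsmult_one lsmult_zero)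
qed

lemma symmetric_torsionI:
  assumes x: "x \<in> carrier M" and K: "K \<in> symmetric_filter R F"
    and 0: "\<And>k. k \<in> K \<Longrightarrow> env_act M x k = \<zero>\<^bsub>M\<^esub>"
  shows "x \<in> symmetric_torsion M F"
  unfolding annihilator_in_filter_iff[OF x, symmetric]
  by (rule symmetric_filter_upper[OF K annihilator_right_ideal[OF x]])
    (use 0 symmetric_filter_subset[OF K] in auto)

lemma symmetric_torsionE:
  assumes "x \<in> symmetric_torsion M F"
  obtains K where "x \<in> carrier M" "K \<in> symmetric_filter R F"
    "\<And>k. k \<in> K \<Longrightarrow> env_act M x k = \<zero>\<^bsub>M\<^esub>"
proof -
  have "x \<in> carrier M" using assms by (simp add: symmetric_torsion_def left_torsion_def)
  with assms annihilator_in_filter_iff[OF this] show ?thesis by (intro that) auto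
qed

lemma symmetric_torsion_additive_subgroup: "additive_subgroup (symmetric_torsion M F) M"
  unfolding M.additive_subgroup_iff
proof (intro conjI ballI subsetI)
  show "x \<in> carrier M" if "x \<in> symmetric_torsion M F" for x
    using that by (rule symmetric_torsionE)
  show "\<zero>\<^bsub>M\<^esub> \<in> symmetric_torsion M F"
    by (rule symmetric_torsionI[OF _ symmetric_filter_carrier]) (simp_all add: env_act_zero_left)
  fix x y assume x: "x \<in> symmetric_torsion M F" and y: "y \<in> symmetric_torsion M F"
  obtain K where K: "x \<in> carrier M" "K \<in> symmetric_filter R F"
    "\<And>k. k \<in> K \<Longrightarrow> env_act M x k = \<zero>\<^bsub>M\<^esub>" using x by (rule symmetric_torsionE) blast
  obtain L where L: "y \<in> carrier M" "L \<in> symmetric_filter R F"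
    "\<And>k. k \<in> L \<Longrightarrow> env_act M y k = \<zero>\<^bsub>M\<^esub>" using y by (rule symmetric_torsionE) blast
  show "x \<ominus>\<^bsub>M\<^esub> y \<in> symmetric_torsion M F"
    by (rule symmetric_torsionI[OF _ symmetric_filter_inter[OF K(2) L(2)]])
      (auto simp: K L env_act_diff_left symmetric_filter_subset[OF K(2)] M.diff_self)
qed

lemma symmetric_torsion_subset: "x \<in> symmetric_torsion M F \<Longrightarrow> x \<in> carrier M"
  by (simp add: symmetric_torsion_def left_torsion_def)

text \<open>If \<open>K\<close> annihilates \<open>x\<close>, then the colon ideal of
  \<open>K\<close> by \<open>t\<close> annihilates x t.\<close>

lemma symmetric_torsion_env_act:
  assumes x: "x \<in> symmetric_torsion M F" and t: "t \<in> carrier E"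
  shows "env_act M x t \<in> symmetric_torsion M F"
proof -
  obtain K where K: "x \<in> carrier M" "K \<in> symmetric_filter R F"
    "\<And>k. k \<in> K \<Longrightarrow> env_act M x k = \<zero>\<^bsub>M\<^esub>" using x by (rule symmetric_torsionE) blast
  show ?thesis
    by (rule symmetric_torsionI[OF _ symmetric_filter_colon[OF K(2) t]])
      (auto simp: K t env_act_closed right_colon_def simp flip: env_act_mult)
qed

lemma symmetric_torsion_lsmult:
  "a \<in> carrier R \<Longrightarrow> x \<in> symmetric_torsion M F \<Longrightarrow> lsmult M a x \<in> symmetric_torsion M F"
  using symmetric_torsion_env_act[of x "pure_tensor R \<one> a"] symmetric_torsion_subset[of x]
  by (simp add: env_act_pure rsmult_one)

lemma symmetric_torsion_rsmult:
  "a \<in> carrier R \<Longrightarrow> x \<in> symmetric_torsion M F \<Longrightarrow> rsmult M x a \<in> symmetric_torsion M F"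
  using symmetric_torsion_env_act[of x "pure_tensor R a \<one>"] symmetric_torsion_subset[of x]
  by (simp add: env_act_pure lsmult_one)

text \<open>If \<open>k\<close> and its image under the induced derivation both annihilate
  \<open>x\<close>, the Leibniz rule leaves (d x) k = d (x k) = 0. Such \<open>k\<close> form a
  member of the filter.\<close>

lemma symmetric_torsion_derivation:
  assumes \<delta>: "derivation R \<delta>" and d: "module_derivation R M \<delta> d"
    and x: "x \<in> symmetric_torsion M F"
  shows "d x \<in> symmetric_torsion M F"
proof -
  obtain K where K: "x \<in> carrier M" "K \<in> symmetric_filter R F"
    "\<And>k. k \<in> K \<Longrightarrow> env_act M x k = \<zero>\<^bsub>M\<^esub>" using x by (rule symmetric_torsionE) blast
  have d0: "d \<zero>\<^bsub>M\<^esub> = \<zero>\<^bsub>M\<^esub>"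
    by (rule additive_map_zero[OF M.abelian_group_axioms M.abelian_group_axioms])
      (auto simp: module_derivationD[OF d])
  show ?thesis
  proof (rule symmetric_torsionI[OF _ symmetric_filter_derivation[OF K(2) \<delta>]])
    show "d x \<in> carrier M" using K(1) by (rule module_derivationD(1)[OF d])
    fix k assume k: "k \<in> {k \<in> K. env_derivation R \<delta> k \<in> K}"
    then have "k \<in> carrier E" using symmetric_filter_subset[OF K(2)] by auto
    then show "env_act M (d x) k = \<zero>\<^bsub>M\<^esub>"
      using module_derivation_env_act[OF \<delta> d K(1), of k] k K(1,3) d0 module_derivationD(1)[OF d K(1)]
      by (simp add: env_act_closed)
  qed
qed

abbreviation proj :: "'m \<Rightarrow> 'm set" where
  "proj x \<equiv> symmetric_torsion M F +>\<^bsub>M\<^esub> x"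

sublocale N: bimodule R "torsionfree_quotient M F"
  unfolding torsionfree_quotient_def
  by (rule quotient_bimodule_bimodule)
    (auto simp: symmetric_torsion_additive_subgroup symmetric_torsion_lsmult symmetric_torsion_rsmult)

lemma torsionfree_carrier: "carrier (torsionfree_quotient M F) = proj ` carrier M"
  by (simp add: torsionfree_quotient_def M.rcosets_eq_image)

lemma proj_closed [simp]: "x \<in> carrier M \<Longrightarrow> proj x \<in> carrier (torsionfree_quotient M F)"
  by (simp add: torsionfree_carrier)

lemma proj_add: "x \<in> carrier M \<Longrightarrow> y \<in> carrier M \<Longrightarrow>
    proj (x \<oplus>\<^bsub>M\<^esub> y) = proj x \<oplus>\<^bsub>torsionfree_quotient M F\<^esub> proj y"
  by (simp add: torsionfree_quotient_def M.rcoset_add symmetric_torsion_additive_subgroup)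

lemma proj_eq_iff: "x \<in> carrier M \<Longrightarrow> y \<in> carrier M \<Longrightarrow>
    proj x = proj y \<longleftrightarrow> x \<ominus>\<^bsub>M\<^esub> y \<in> symmetric_torsion M F"
  by (simp add: M.rcoset_eq_iff symmetric_torsion_additive_subgroup)

lemma proj_eq_zero_iff: "x \<in> carrier M \<Longrightarrow>
    proj x = \<zero>\<^bsub>torsionfree_quotient M F\<^esub> \<longleftrightarrow> x \<in> symmetric_torsion M F"
  by (simp add: torsionfree_quotient_def M.rcoset_eq_subgroup_iff symmetric_torsion_additive_subgroup)

lemma proj_lsmult: "a \<in> carrier R \<Longrightarrow> x \<in> carrier M \<Longrightarrow>
    lsmult (torsionfree_quotient M F) a (proj x) = proj (lsmult M a x)"
  unfolding torsionfree_quotient_def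
  by (rule quotient_lsmult) (auto simp: symmetric_torsion_additive_subgroup symmetric_torsion_lsmult)

lemma proj_rsmult: "a \<in> carrier R \<Longrightarrow> x \<in> carrier M \<Longrightarrow>
    rsmult (torsionfree_quotient M F) (proj x) a = proj (rsmult M x a)"
  unfolding torsionfree_quotient_def
  by (rule quotient_rsmult) (auto simp: symmetric_torsion_additive_subgroup symmetric_torsion_rsmult)

lemma proj_env_act:
  assumes x: "x \<in> carrier M" and t: "t \<in> carrier E"
  shows "env_act (torsionfree_quotient M F) (proj x) t = proj (env_act M x t)"
  by (rule R.env_additive_eqI[OF N.M.abelian_group_axioms _ _ _ _ _ t])
    (use x in \<open>auto simp: N.env_act_closed N.env_act_add env_act_closed env_act_add proj_add
        N.env_act_pure env_act_pure proj_lsmult proj_rsmult\<close>)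

section \<open>Germs\<close>

lemma partial_homs_iff:
  "(K, f) \<in> partial_homs R M F \<longleftrightarrow> K \<in> symmetric_filter R F \<and>
     (\<forall>k\<in>K. f k \<in> carrier (torsionfree_quotient M F)) \<and>
     (\<forall>k\<in>K. \<forall>l\<in>K. f (k \<oplus>\<^bsub>E\<^esub> l) = f k \<oplus>\<^bsub>torsionfree_quotient M F\<^esub> f l) \<and>
     (\<forall>k\<in>K. \<forall>t\<in>carrier E.
        f (k \<otimes>\<^bsub>E\<^esub> t) = env_act (torsionfree_quotient M F) (f k) t)"
  by (auto simp: partial_homs_def env_hom_def)

lemma partial_homsI:
  assumes "K \<in> symmetric_filter R F"
    and "\<And>k. k \<in> K \<Longrightarrow> f k \<in> carrier (torsionfree_quotient M F)"
    and "\<And>k l. k \<in> K \<Longrightarrow> l \<in> K \<Longrightarrow>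
      f (k \<oplus>\<^bsub>E\<^esub> l) = f k \<oplus>\<^bsub>torsionfree_quotient M F\<^esub> f l"
    and "\<And>k t. k \<in> K \<Longrightarrow> t \<in> carrier E \<Longrightarrow>
      f (k \<otimes>\<^bsub>E\<^esub> t) = env_act (torsionfree_quotient M F) (f k) t"
  shows "(K, f) \<in> partial_homs R M F"
  using assms unfolding partial_homs_iff by blast

lemma partial_homsD:
  assumes "(K, f) \<in> partial_homs R M F"
  shows "K \<in> symmetric_filter R F"
    and "k \<in> K \<Longrightarrow> f k \<in> carrier (torsionfree_quotient M F)"
    and "k \<in> K \<Longrightarrow> l \<in> K \<Longrightarrow>
      f (k \<oplus>\<^bsub>E\<^esub> l) = f k \<oplus>\<^bsub>torsionfree_quotient M F\<^esub> f l"
    and "k \<in> K \<Longrightarrow> t \<in> carrier E \<Longrightarrow>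
      f (k \<otimes>\<^bsub>E\<^esub> t) = env_act (torsionfree_quotient M F) (f k) t"
    and "k \<in> K \<Longrightarrow> k \<in> carrier E"
    and "k \<in> K \<Longrightarrow> l \<in> K \<Longrightarrow> k \<oplus>\<^bsub>E\<^esub> l \<in> K"
    and "k \<in> K \<Longrightarrow> l \<in> K \<Longrightarrow> k \<ominus>\<^bsub>E\<^esub> l \<in> K"
    and "k \<in> K \<Longrightarrow> t \<in> carrier E \<Longrightarrow> k \<otimes>\<^bsub>E\<^esub> t \<in> K"
    and "\<zero>\<^bsub>E\<^esub> \<in> K"
proof -
  note * = assms[unfolded partial_homs_iff]
  have r: "right_ideal E K" using * symmetric_filter_right_ideal by blast
  show "K \<in> symmetric_filter R F"
    and "k \<in> K \<Longrightarrow> f k \<in> carrier (torsionfree_quotient M F)"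
    and "k \<in> K \<Longrightarrow> l \<in> K \<Longrightarrow>
      f (k \<oplus>\<^bsub>E\<^esub> l) = f k \<oplus>\<^bsub>torsionfree_quotient M F\<^esub> f l"
    and "k \<in> K \<Longrightarrow> t \<in> carrier E \<Longrightarrow>
      f (k \<otimes>\<^bsub>E\<^esub> t) = env_act (torsionfree_quotient M F) (f k) t"
    using * by blast+
  show "k \<in> K \<Longrightarrow> k \<in> carrier E"
    and "k \<in> K \<Longrightarrow> l \<in> K \<Longrightarrow> k \<ominus>\<^bsub>E\<^esub> l \<in> K"
    and "k \<in> K \<Longrightarrow> t \<in> carrier E \<Longrightarrow> k \<otimes>\<^bsub>E\<^esub> t \<in> K"
    and "\<zero>\<^bsub>E\<^esub> \<in> K"
    using r unfolding E.right_ideal_iff by blast+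
  show "k \<in> K \<Longrightarrow> l \<in> K \<Longrightarrow> k \<oplus>\<^bsub>E\<^esub> l \<in> K"
    using r by (rule E.right_ideal_add)
qed

lemma partial_homs_diff:
  assumes f: "(K, f) \<in> partial_homs R M F" and "k \<in> K" "l \<in> K"
  shows "f (k \<ominus>\<^bsub>E\<^esub> l) = f k \<ominus>\<^bsub>torsionfree_quotient M F\<^esub> f l"
proof -
  note D = partial_homsD[OF f]
  have "f k = f (k \<ominus>\<^bsub>E\<^esub> l) \<oplus>\<^bsub>torsionfree_quotient M F\<^esub> f l"
    using assms D(3)[of "k \<ominus>\<^bsub>E\<^esub> l" l] D(5)[of k] D(5)[of l] D(7)
    by (simp add: a_minus_def E.a_assoc E.l_neg)
  moreover have "f k \<in> carrier (torsionfree_quotient M F)" "f l \<in> carrier (torsionfree_quotient M F)"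
    "f (k \<ominus>\<^bsub>E\<^esub> l) \<in> carrier (torsionfree_quotient M F)"
    using D(2) D(7)[OF assms(2,3)] assms(2,3) by simp_all
  ultimately show ?thesis by (metis N.M.add.inv_solve_right a_minus_def)
qed

lemma germ_rel_iff:
  "((K, f), (L, g)) \<in> germ_rel R M F \<longleftrightarrow>
     (K, f) \<in> partial_homs R M F \<and> (L, g) \<in> partial_homs R M F \<and>
     (\<exists>H\<in>symmetric_filter R F. H \<subseteq> K \<inter> L \<and> (\<forall>k\<in>H. f k = g k))"
  by (simp add: germ_rel_def)

lemma germ_rel_equiv: "equiv (partial_homs R M F) (germ_rel R M F)"
proof (intro equivI refl_onI symI transI)
  show "germ_rel R M F \<subseteq> partial_homs R M F \<times> partial_homs R M F"
    by (auto simp: germ_rel_def)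
  fix x assume "x \<in> partial_homs R M F"
  then show "(x, x) \<in> germ_rel R M F"
    using partial_homsD(1) by (cases x) (auto simp: germ_rel_iff)
next
  fix x y assume "(x, y) \<in> germ_rel R M F"
  then show "(y, x) \<in> germ_rel R M F"
    by (cases x; cases y) (simp only: germ_rel_iff, metis Int_commute)
next
  fix x y z assume "(x, y) \<in> germ_rel R M F" "(y, z) \<in> germ_rel R M F"
  then obtain K f L g P h where xyz: "x = (K, f)" "y = (L, g)" "z = (P, h)"
    and ph: "(K, f) \<in> partial_homs R M F" "(P, h) \<in> partial_homs R M F"
    and ex: "\<exists>H\<in>symmetric_filter R F. H \<subseteq> K \<inter> L \<and> (\<forall>k\<in>H. f k = g k)"
      "\<exists>H\<in>symmetric_filter R F. H \<subseteq> L \<inter> P \<and> (\<forall>k\<in>H. g k = h k)"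
    by (cases x; cases y; cases z) (auto simp: germ_rel_iff)
  from ex obtain H H' where "H \<in> symmetric_filter R F" "H \<subseteq> K \<inter> L" "\<forall>k\<in>H. f k = g k"
    "H' \<in> symmetric_filter R F" "H' \<subseteq> L \<inter> P" "\<forall>k\<in>H'. g k = h k" by blast
  then show "(x, z) \<in> germ_rel R M F"
    unfolding xyz germ_rel_iff using ph symmetric_filter_inter[of H H']
    by (intro conjI bexI[of _ "H \<inter> H'"]) auto
qed

abbreviation germ :: "'a tensor set \<Rightarrow> ('a tensor \<Rightarrow> 'm set) \<Rightarrow> ('a, 'm) germ" where
  "germ K f \<equiv> germ_class R M F K f"

abbreviation Q where "Q \<equiv> module_of_quotients R M F"

lemma carrier_Q: "carrier Q = partial_homs R M F // germ_rel R M F"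
  by (simp add: module_of_quotients_def)

lemma germ_closed [simp]: "(K, f) \<in> partial_homs R M F \<Longrightarrow> germ K f \<in> carrier Q"
  unfolding carrier_Q germ_class_def by (rule quotientI)

lemma germ_cases:
  assumes "X \<in> carrier Q"
  obtains K f where "(K, f) \<in> partial_homs R M F" "X = germ K f"
  using assms unfolding carrier_Q germ_class_def by (elim quotientE) (metis surj_pair)

lemma germ_eq_iff:
  assumes "(K, f) \<in> partial_homs R M F" "(L, g) \<in> partial_homs R M F"
  shows "germ K f = germ L g \<longleftrightarrow>
    (\<exists>H\<in>symmetric_filter R F. H \<subseteq> K \<inter> L \<and> (\<forall>k\<in>H. f k = g k))"
  unfolding germ_class_def eq_equiv_class_iff[OF germ_rel_equiv assms]
  using assms by (simp add: germ_rel_iff)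

lemma germ_eqI:
  assumes "(K, f) \<in> partial_homs R M F" "(L, g) \<in> partial_homs R M F"
    and "H \<in> symmetric_filter R F" "\<And>k. k \<in> H \<Longrightarrow> k \<in> K" "\<And>k. k \<in> H \<Longrightarrow> k \<in> L"
    and "\<And>k. k \<in> H \<Longrightarrow> f k = g k"
  shows "germ K f = germ L g"
  unfolding germ_eq_iff[OF assms(1,2)] using assms(3-) by (intro bexI[of _ H]) auto

text \<open>Operations on germs are unions over all representatives. Such a union collapses once the
  result is invariant under passing to a representative that agrees on a smaller member; every
  well-definedness proof for germs goes through this rule.\<close>

lemma germ_UN:
  assumes "(K, f) \<in> partial_homs R M F"
    and "\<And>L g H. (L, g) \<in> partial_homs R M F \<Longrightarrow> H \<in> symmetric_filter R F \<Longrightarrow> H \<subseteq> K \<Longrightarrow>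
      H \<subseteq> L \<Longrightarrow> (\<And>k. k \<in> H \<Longrightarrow> f k = g k) \<Longrightarrow> \<phi> L g = \<phi> K f"
  shows "(\<Union>(L, g)\<in>germ K f. \<phi> L g) = \<phi> K f"
proof -
  have "\<phi> L g = \<phi> K f" if Lg: "(L, g) \<in> germ K f" for L g
  proof -
    obtain H where "(L, g) \<in> partial_homs R M F" "H \<in> symmetric_filter R F" "H \<subseteq> K" "H \<subseteq> L"
      "\<forall>k\<in>H. f k = g k"
      using Lg unfolding germ_class_def Image_singleton_iff germ_rel_iff by blast
    then show ?thesis by (intro assms(2)) blast+
  qed
  moreover have "(K, f) \<in> germ K f"
    unfolding germ_class_def using germ_rel_equiv assms(1) by (rule equiv_class_self)
  ultimately have "(\<lambda>(L, g). \<phi> L g) ` germ K f = {\<phi> K f}" by fast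
  then show ?thesis by simp
qed

end

context symmetric_module
begin

abbreviation TF where "TF \<equiv> torsionfree_quotient M F"

lemma partial_homs_act:
  assumes f: "(K, f) \<in> partial_homs R M F" and t: "t \<in> carrier E"
  shows "(right_colon E K t, \<lambda>k. f (t \<otimes>\<^bsub>E\<^esub> k)) \<in> partial_homs R M F"
  using t by (intro partial_homsI symmetric_filter_colon[OF partial_homsD(1)[OF f]])
    (simp_all add: right_colon_def partial_homsD(2-4)[OF f] E.r_distr flip: E.m_assoc)

lemma partial_homs_add:
  assumes f: "(K, f) \<in> partial_homs R M F" and g: "(L, g) \<in> partial_homs R M F"
  shows "(K \<inter> L, \<lambda>k. f k \<oplus>\<^bsub>TF\<^esub> g k) \<in> partial_homs R M F"
  by (intro partial_homsI symmetric_filter_inter[OF partial_homsD(1)[OF f] partial_homsD(1)[OF g]])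
    (simp_all add: partial_homsD(2-4)[OF f] partial_homsD(2-4)[OF g] N.M.a_ac N.env_act_add_left)

lemma partial_homs_minus:
  assumes f: "(K, f) \<in> partial_homs R M F"
  shows "(K, \<lambda>k. \<ominus>\<^bsub>TF\<^esub> f k) \<in> partial_homs R M F"
proof (intro partial_homsI)
  have "env_act TF (\<ominus>\<^bsub>TF\<^esub> x) t = \<ominus>\<^bsub>TF\<^esub> env_act TF x t"
    if "x \<in> carrier TF" "t \<in> carrier E" for x t
    using that
    by (intro additive_map_minus[OF N.M.abelian_group_axioms N.M.abelian_group_axioms, of "\<lambda>x. env_act TF x t"])
      (auto simp: N.env_act_add_left N.env_act_closed)
  then show "\<ominus>\<^bsub>TF\<^esub> f (k \<otimes>\<^bsub>E\<^esub> t) = env_act TF (\<ominus>\<^bsub>TF\<^esub> f k) t"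
    if "k \<in> K" "t \<in> carrier E" for k t
    using that by (simp add: partial_homsD(2-4)[OF f])
qed (simp_all add: partial_homsD[OF f] N.M.minus_add)

lemma partial_homs_const:
  assumes "n \<in> carrier TF"
  shows "(carrier E, env_act TF n) \<in> partial_homs R M F"
  using assms by (intro partial_homsI symmetric_filter_carrier)
    (simp_all add: N.env_act_closed N.env_act_add N.env_act_mult)

lemma partial_homs_zero: "(carrier E, \<lambda>_. \<zero>\<^bsub>TF\<^esub>) \<in> partial_homs R M F"
  by (intro partial_homsI symmetric_filter_carrier) (simp_all add: N.env_act_zero_left)

lemma quotient_map_closed: "m \<in> carrier M \<Longrightarrow> quotient_map R M F m \<in> carrier Q"
  by (simp add: quotient_map_def partial_homs_const)

lemma zero_Q: "\<zero>\<^bsub>Q\<^esub> = germ (carrier E) (\<lambda>_. \<zero>\<^bsub>TF\<^esub>)"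
  by (simp add: module_of_quotients_def)

lemma germ_eq_zero_iff:
  assumes f: "(K, f) \<in> partial_homs R M F"
  shows "germ K f = \<zero>\<^bsub>Q\<^esub> \<longleftrightarrow> (\<exists>H\<in>symmetric_filter R F. H \<subseteq> K \<and> (\<forall>k\<in>H. f k = \<zero>\<^bsub>TF\<^esub>))"
  unfolding zero_Q germ_eq_iff[OF f partial_homs_zero]
  using partial_homsD(5)[OF f] by (intro bex_cong refl) auto

lemma add_germ:
  assumes f: "(K, f) \<in> partial_homs R M F" and g: "(L, g) \<in> partial_homs R M F"
  shows "germ K f \<oplus>\<^bsub>Q\<^esub> germ L g = germ (K \<inter> L) (\<lambda>k. f k \<oplus>\<^bsub>TF\<^esub> g k)"
proof -
  \<comment> \<open>\<open>germ_UN\<close> treats one argument at a time, so the inner union is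
    collapsed beforehand, for an arbitrary representative of the first summand.\<close>
  have inner: "(\<Union>(L, g)\<in>germ L g. germ (K \<inter> L) (\<lambda>k. f k \<oplus>\<^bsub>TF\<^esub> g k)) =
      germ (K \<inter> L) (\<lambda>k. f k \<oplus>\<^bsub>TF\<^esub> g k)"
    if f: "(K, f) \<in> partial_homs R M F" for K f
  proof (rule germ_UN[OF g])
    fix L' g' H assume *: "(L', g') \<in> partial_homs R M F" "H \<in> symmetric_filter R F" "H \<subseteq> L" "H \<subseteq> L'"
      "\<And>k. k \<in> H \<Longrightarrow> g k = g' k"
    show "germ (K \<inter> L') (\<lambda>k. f k \<oplus>\<^bsub>TF\<^esub> g' k) = germ (K \<inter> L) (\<lambda>k. f k \<oplus>\<^bsub>TF\<^esub> g k)"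
      by (rule germ_eqI[OF partial_homs_add partial_homs_add symmetric_filter_inter[OF partial_homsD(1)[OF f] *(2)]])
        (use * f g in auto)
  qed
  have "germ K f \<oplus>\<^bsub>Q\<^esub> germ L g = (\<Union>(K, f)\<in>germ K f. \<Union>(L, g)\<in>germ L g. germ (K \<inter> L) (\<lambda>k. f k \<oplus>\<^bsub>TF\<^esub> g k))"
    by (simp add: module_of_quotients_def)
  also have "\<dots> = (\<Union>(L, g)\<in>germ L g. germ (K \<inter> L) (\<lambda>k. f k \<oplus>\<^bsub>TF\<^esub> g k))"
  proof (rule germ_UN[OF f])
    fix K' f' H assume *: "(K', f') \<in> partial_homs R M F" "H \<in> symmetric_filter R F" "H \<subseteq> K" "H \<subseteq> K'"
      "\<And>k. k \<in> H \<Longrightarrow> f k = f' k"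
    show "(\<Union>(L, g)\<in>germ L g. germ (K' \<inter> L) (\<lambda>k. f' k \<oplus>\<^bsub>TF\<^esub> g k)) =
        (\<Union>(L, g)\<in>germ L g. germ (K \<inter> L) (\<lambda>k. f k \<oplus>\<^bsub>TF\<^esub> g k))"
      unfolding inner[OF f] inner[OF *(1)]
      by (rule germ_eqI[OF partial_homs_add partial_homs_add symmetric_filter_inter[OF *(2) partial_homsD(1)[OF g]]])
        (use * f g in auto)
  qed
  also have "\<dots> = germ (K \<inter> L) (\<lambda>k. f k \<oplus>\<^bsub>TF\<^esub> g k)" by (rule inner[OF f])
  finally show ?thesis .
qed

abbreviation qact :: "('a, 'm) germ \<Rightarrow> 'a tensor \<Rightarrow> ('a, 'm) germ" where
  "qact \<equiv> germ_act R M F"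

lemma act_germ:
  assumes f: "(K, f) \<in> partial_homs R M F" and t: "t \<in> carrier E"
  shows "qact (germ K f) t = germ (right_colon E K t) (\<lambda>k. f (t \<otimes>\<^bsub>E\<^esub> k))"
  unfolding germ_act_def
proof (rule germ_UN[OF f])
  fix L g H assume *: "(L, g) \<in> partial_homs R M F" "H \<in> symmetric_filter R F" "H \<subseteq> K" "H \<subseteq> L"
    "\<And>k. k \<in> H \<Longrightarrow> f k = g k"
  show "germ (right_colon E L t) (\<lambda>k. g (t \<otimes>\<^bsub>E\<^esub> k)) =
      germ (right_colon E K t) (\<lambda>k. f (t \<otimes>\<^bsub>E\<^esub> k))"
    by (rule germ_eqI[OF partial_homs_act partial_homs_act symmetric_filter_colon[OF *(2) t]])
      (use * f t in \<open>auto simp: right_colon_def\<close>)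
qed

lemma qact_closed:
  assumes "X \<in> carrier Q" "t \<in> carrier E"
  shows "qact X t \<in> carrier Q"
  using assms(1) by (rule germ_cases) (simp add: act_germ assms(2) partial_homs_act)

lemma lsmult_Q: "lsmult Q s X = qact X (pure_tensor R \<one> s)"
  and rsmult_Q: "rsmult Q X r = qact X (pure_tensor R r \<one>)"
  by (simp_all add: module_of_quotients_def)

lemma Q_abelian_group: "abelian_group Q"
proof (rule abelian_groupI)
  show "\<zero>\<^bsub>Q\<^esub> \<in> carrier Q" by (simp add: zero_Q partial_homs_zero)
next
  fix X Y assume "X \<in> carrier Q" "Y \<in> carrier Q"
  then obtain K f L g where f: "(K, f) \<in> partial_homs R M F" "X = germ K f"
    and g: "(L, g) \<in> partial_homs R M F" "Y = germ L g" by (elim germ_cases)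
  show "X \<oplus>\<^bsub>Q\<^esub> Y \<in> carrier Q" unfolding f g add_germ[OF f(1) g(1)]
    by (rule germ_closed[OF partial_homs_add[OF f(1) g(1)]])
  show "X \<oplus>\<^bsub>Q\<^esub> Y = Y \<oplus>\<^bsub>Q\<^esub> X"
    unfolding f g add_germ[OF f(1) g(1)] add_germ[OF g(1) f(1)]
    by (rule germ_eqI[OF partial_homs_add[OF f(1) g(1)] partial_homs_add[OF g(1) f(1)]
          symmetric_filter_inter[OF partial_homsD(1)[OF f(1)] partial_homsD(1)[OF g(1)]]])
      (auto simp: N.M.a_comm partial_homsD(2)[OF f(1)] partial_homsD(2)[OF g(1)])
  fix Z assume "Z \<in> carrier Q"
  then obtain P h where h: "(P, h) \<in> partial_homs R M F" "Z = germ P h" by (elim germ_cases)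
  note fg = partial_homs_add[OF f(1) g(1)] and gh = partial_homs_add[OF g(1) h(1)]
  show "X \<oplus>\<^bsub>Q\<^esub> Y \<oplus>\<^bsub>Q\<^esub> Z = X \<oplus>\<^bsub>Q\<^esub> (Y \<oplus>\<^bsub>Q\<^esub> Z)"
    unfolding f g h add_germ[OF f(1) g(1)] add_germ[OF g(1) h(1)] add_germ[OF fg h(1)] add_germ[OF f(1) gh]
    by (rule germ_eqI[OF partial_homs_add[OF fg h(1)] partial_homs_add[OF f(1) gh]
          partial_homsD(1)[OF partial_homs_add[OF fg h(1)]]])
      (auto simp: N.M.a_assoc partial_homsD(2)[OF f(1)] partial_homsD(2)[OF g(1)] partial_homsD(2)[OF h(1)])
next
  fix X assume "X \<in> carrier Q"
  then obtain K f where f: "(K, f) \<in> partial_homs R M F" "X = germ K f" by (rule germ_cases)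
  note mf = partial_homs_minus[OF f(1)]
  show "\<zero>\<^bsub>Q\<^esub> \<oplus>\<^bsub>Q\<^esub> X = X"
    unfolding f zero_Q add_germ[OF partial_homs_zero f(1)]
    by (rule germ_eqI[OF partial_homs_add[OF partial_homs_zero f(1)] f(1) partial_homsD(1)[OF f(1)]])
      (auto simp: partial_homsD[OF f(1)])
  show "\<exists>Y\<in>carrier Q. Y \<oplus>\<^bsub>Q\<^esub> X = \<zero>\<^bsub>Q\<^esub>"
  proof
    show "germ K (\<lambda>k. \<ominus>\<^bsub>TF\<^esub> f k) \<in> carrier Q" using mf by (rule germ_closed)
    show "germ K (\<lambda>k. \<ominus>\<^bsub>TF\<^esub> f k) \<oplus>\<^bsub>Q\<^esub> X = \<zero>\<^bsub>Q\<^esub>"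
      unfolding f add_germ[OF mf f(1)] zero_Q
      by (rule germ_eqI[OF partial_homs_add[OF mf f(1)] partial_homs_zero partial_homsD(1)[OF f(1)]])
        (auto simp: partial_homsD[OF f(1)] N.M.l_neg)
  qed
qed

lemma qact_add:
  assumes "X \<in> carrier Q" and s: "s \<in> carrier E" and t: "t \<in> carrier E"
  shows "qact X (s \<oplus>\<^bsub>E\<^esub> t) = qact X s \<oplus>\<^bsub>Q\<^esub> qact X t"
proof -
  obtain K f where f: "(K, f) \<in> partial_homs R M F" "X = germ K f" using assms(1) by (rule germ_cases)
  note D = partial_homsD[OF f(1)]
  note s' = partial_homs_act[OF f(1) s] and t' = partial_homs_act[OF f(1) t]
  have st: "s \<oplus>\<^bsub>E\<^esub> t \<in> carrier E" using s t by simp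
  show ?thesis
    unfolding f act_germ[OF f(1) s] act_germ[OF f(1) t] act_germ[OF f(1) st] add_germ[OF s' t']
    by (rule germ_eqI[OF partial_homs_act[OF f(1) st] partial_homs_add[OF s' t']
          partial_homsD(1)[OF partial_homs_add[OF s' t']]])
      (auto simp: right_colon_def E.l_distr s t D(3) D(6))
qed

lemma qact_add_left:
  assumes "X \<in> carrier Q" "Y \<in> carrier Q" and t: "t \<in> carrier E"
  shows "qact (X \<oplus>\<^bsub>Q\<^esub> Y) t = qact X t \<oplus>\<^bsub>Q\<^esub> qact Y t"
proof -
  obtain K f L g where f: "(K, f) \<in> partial_homs R M F" "X = germ K f"
    and g: "(L, g) \<in> partial_homs R M F" "Y = germ L g" using assms(1,2) by (elim germ_cases)
  note fg = partial_homs_add[OF f(1) g(1)]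
  note ft = partial_homs_act[OF f(1) t] and gt = partial_homs_act[OF g(1) t]
  show ?thesis
    unfolding f g add_germ[OF f(1) g(1)] act_germ[OF fg t] act_germ[OF f(1) t] act_germ[OF g(1) t] add_germ[OF ft gt]
    by (rule germ_eqI[OF partial_homs_act[OF fg t] partial_homs_add[OF ft gt]
          partial_homsD(1)[OF partial_homs_act[OF fg t]]])
      (auto simp: right_colon_def)
qed

lemma qact_mult:
  assumes "X \<in> carrier Q" and s: "s \<in> carrier E" and t: "t \<in> carrier E"
  shows "qact X (s \<otimes>\<^bsub>E\<^esub> t) = qact (qact X s) t"
proof -
  obtain K f where f: "(K, f) \<in> partial_homs R M F" "X = germ K f" using assms(1) by (rule germ_cases)
  note s' = partial_homs_act[OF f(1) s]
  have st: "s \<otimes>\<^bsub>E\<^esub> t \<in> carrier E" using s t by simp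
  show ?thesis
    unfolding f act_germ[OF f(1) s] act_germ[OF f(1) st] act_germ[OF s' t]
    by (rule germ_eqI[OF partial_homs_act[OF f(1) st] partial_homs_act[OF s' t]
          partial_homsD(1)[OF partial_homs_act[OF f(1) st]]])
      (auto simp: right_colon_def E.m_assoc s t)
qed

lemma qact_one:
  assumes "X \<in> carrier Q"
  shows "qact X \<one>\<^bsub>E\<^esub> = X"
proof -
  obtain K f where f: "(K, f) \<in> partial_homs R M F" "X = germ K f" using assms by (rule germ_cases)
  have one: "\<one>\<^bsub>E\<^esub> \<in> carrier E" by simp
  show ?thesis
    unfolding f act_germ[OF f(1) one]
    by (rule germ_eqI[OF partial_homs_act[OF f(1) one] f(1) partial_homsD(1)[OF f(1)]])
      (auto simp: right_colon_def partial_homsD(5)[OF f(1)])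
qed

text \<open>The two actions are those of 1 \<otimes> s and r \<otimes> 1, so every law is a law of
  the right action of the enveloping ring. The left and right actions commute because these tensors
  do.\<close>

lemma Q_bimodule: "bimodule R Q"
proof (intro bimodule.intro left_module.intro right_module.intro left_module_axioms.intro
    right_module_axioms.intro bimodule_axioms.intro Q_abelian_group)
qed (simp_all add: R.ring_axioms lsmult_Q rsmult_Q qact_closed qact_add_left
    pure_tensor_add_left pure_tensor_add_right pure_tensor_mult qact_one
    flip: qact_add qact_mult tensor_class_one)

sublocale Q: bimodule R Q by (rule Q_bimodule)

text \<open>For \<open>k\<close> in the domain, linearity gives f (k t) = f k t for every
  \<open>t\<close>, so the translate of the germ by \<open>k\<close> is multiplication by
  \<open>f k\<close>, defined everywhere. Thus the domain of a representative multiplies the germ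
  into the image of \<open>M\<close>.\<close>

lemma qact_eq_quotient_map:
  assumes f: "(K, f) \<in> partial_homs R M F" and k: "k \<in> K" and m: "m \<in> carrier M" "f k = proj m"
  shows "qact (germ K f) k = quotient_map R M F m"
proof -
  have kc: "k \<in> carrier E" using partial_homsD(5)[OF f k] .
  note m' = partial_homs_const[OF proj_closed[OF m(1)]]
  show ?thesis
    unfolding quotient_map_def act_germ[OF f kc]
    by (rule germ_eqI[OF partial_homs_act[OF f kc] m' symmetric_filter_carrier])
      (use k m in \<open>auto simp: right_colon_def partial_homsD(4,8)[OF f]\<close>)
qed

lemma quotient_map_env_act:
  assumes m: "m \<in> carrier M" and t: "t \<in> carrier E"
  shows "quotient_map R M F (env_act M m t) = qact (quotient_map R M F m) t"
  using qact_eq_quotient_map[OF partial_homs_const[OF proj_closed[OF m]] t, of "env_act M m t"]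
    proj_env_act[OF m t] m t
  by (simp add: quotient_map_def env_act_closed)

lemma quotient_map_add:
  assumes "m \<in> carrier M" "n \<in> carrier M"
  shows "quotient_map R M F (m \<oplus>\<^bsub>M\<^esub> n) = quotient_map R M F m \<oplus>\<^bsub>Q\<^esub> quotient_map R M F n"
proof -
  note m = partial_homs_const[OF proj_closed[OF assms(1)]]
  note n = partial_homs_const[OF proj_closed[OF assms(2)]]
  have mn: "m \<oplus>\<^bsub>M\<^esub> n \<in> carrier M" using assms by simp
  show ?thesis
    unfolding quotient_map_def add_germ[OF m n]
    by (rule germ_eqI[OF partial_homs_const[OF proj_closed[OF mn]] partial_homs_add[OF m n]
          symmetric_filter_carrier])
      (use assms in \<open>auto simp: proj_add N.env_act_add_left\<close>)
qed

lemma quotient_map_lsmult: "m \<in> carrier M \<Longrightarrow> a \<in> carrier R \<Longrightarrow>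
    quotient_map R M F (lsmult M a m) = lsmult Q a (quotient_map R M F m)"
  using quotient_map_env_act[of m "pure_tensor R \<one> a"] by (simp add: lsmult_Q env_act_pure rsmult_one)

lemma quotient_map_rsmult: "m \<in> carrier M \<Longrightarrow> a \<in> carrier R \<Longrightarrow>
    quotient_map R M F (rsmult M m a) = rsmult Q (quotient_map R M F m) a"
  using quotient_map_env_act[of m "pure_tensor R a \<one>"] by (simp add: rsmult_Q env_act_pure lsmult_one)

end

section \<open>Extension of derivations\<close>

lemma (in abelian_group) add_diff_add:
  assumes "x \<in> carrier G" "y \<in> carrier G" "z \<in> carrier G"
  shows "(x \<oplus> y) \<ominus> (z \<oplus> y) = x \<ominus> z"
proof -
  have "(x \<oplus> y) \<ominus> (z \<oplus> y) = (x \<ominus> z) \<oplus> (y \<ominus> y)"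
    using assms by (simp add: a_minus_def minus_add a_ac)
  then show ?thesis using assms by (simp add: a_minus_def r_neg)
qed

lemma (in abelian_group) diff_add_add:
  assumes "x \<in> carrier G" "y \<in> carrier G" "z \<in> carrier G"
  shows "x \<ominus> (z \<oplus> y) \<oplus> z = x \<ominus> y"
proof -
  have "x \<ominus> (z \<oplus> y) \<oplus> z = (x \<ominus> y) \<oplus> (z \<ominus> z)"
    using assms by (simp add: a_minus_def minus_add a_ac)
  then show ?thesis using assms by (simp add: a_minus_def r_neg)
qed

text \<open>The derivation descends to cosets because it preserves torsion
  (\<open>symmetric_torsion_derivation\<close>); \<open>the_elem\<close> picks the only value taken
  on a coset.\<close>

definition quotient_derivation ::
    "('a, 'm, 'e) bimodule_scheme \<Rightarrow> 'a filter_pair \<Rightarrow> ('m \<Rightarrow> 'm) \<Rightarrow> 'm set \<Rightarrow> 'm set" where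
  "quotient_derivation M F d X = the_elem ((\<lambda>x. symmetric_torsion M F +>\<^bsub>M\<^esub> d x) ` X)"

text \<open>The formula is dictated by the Leibniz rule for the enveloping action: any extension
  satisfies (d' X) k = d' (X k) - X (D k), and X k comes from \<open>M\<close> for \<open>k\<close>
  in the domain, where the extension is prescribed. The domain is cut down so that D k may be
  inserted into \<open>f\<close>.\<close>

definition extension_map ::
    "('a, 'c) ring_scheme \<Rightarrow> ('a, 'm, 'e) bimodule_scheme \<Rightarrow> ('a \<Rightarrow> 'a) \<Rightarrow> ('m \<Rightarrow> 'm) \<Rightarrow>
     'a filter_pair \<Rightarrow> ('a, 'm) germ \<Rightarrow> ('a, 'm) germ" where
  "extension_map R M \<delta> d F X =
     (\<Union>(K, f)\<in>X. germ_class R M F {k \<in> K. env_derivation R \<delta> k \<in> K}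
        (\<lambda>k. quotient_derivation M F d (f k) \<ominus>\<^bsub>torsionfree_quotient M F\<^esub> f (env_derivation R \<delta> k)))"

context symmetric_module
begin

context
  fixes \<delta> d assumes \<delta>: "derivation R \<delta>" and d: "module_derivation R M \<delta> d"
begin

abbreviation D where "D \<equiv> env_derivation R \<delta>"
abbreviation dq where "dq \<equiv> quotient_derivation M F d"

lemma dq_proj:
  assumes x: "x \<in> carrier M"
  shows "dq (proj x) = proj (d x)"
proof -
  have "proj (d y) = proj (d x)" if "y \<in> proj x" for y
  proof -
    have y: "y \<in> carrier M" "y \<ominus>\<^bsub>M\<^esub> x \<in> symmetric_torsion M F"
      using that M.mem_rcoset[OF symmetric_torsion_additive_subgroup x] by auto
    have "d y \<ominus>\<^bsub>M\<^esub> d x = d (y \<ominus>\<^bsub>M\<^esub> x)"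
      by (rule additive_map_diff[OF M.abelian_group_axioms M.abelian_group_axioms, symmetric])
        (use x y in \<open>auto simp: module_derivationD[OF d]\<close>)
    then show ?thesis
      using symmetric_torsion_derivation[OF \<delta> d y(2)] x y
      by (simp add: proj_eq_iff module_derivationD[OF d])
  qed
  moreover have "x \<in> proj x"
    using M.mem_rcoset[OF symmetric_torsion_additive_subgroup x] x
      additive_subgroup.zero_closed[OF symmetric_torsion_additive_subgroup] by (simp add: M.diff_self)
  ultimately have "(\<lambda>y. proj (d y)) ` proj x = {proj (d x)}" by blast
  then show ?thesis by (simp add: quotient_derivation_def)
qed

lemma dq_module_derivation: "module_derivation R TF \<delta> dq"
  unfolding module_derivation_def
  by (auto simp: torsionfree_carrier dq_proj module_derivationD[OF d] proj_rsmult proj_lsmult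
      derivationD(1)[OF \<delta>] simp flip: proj_add)

lemma dq_closed: "n \<in> carrier TF \<Longrightarrow> dq n \<in> carrier TF"
  by (rule module_derivationD(1)[OF dq_module_derivation])

text \<open>Neither summand is linear over the enveloping ring, but the defect is the same term
  \<open>env_act TF (f k) (D t)\<close> in both, and it cancels in the difference.\<close>

lemma partial_homs_derivation:
  assumes f: "(K, f) \<in> partial_homs R M F"
  shows "({k \<in> K. D k \<in> K}, \<lambda>k. dq (f k) \<ominus>\<^bsub>TF\<^esub> f (D k)) \<in> partial_homs R M F"
proof (intro partial_homsI symmetric_filter_derivation[OF partial_homsD(1)[OF f] \<delta>])
  note f' = partial_homsD[OF f] and dq' = module_derivationD[OF dq_module_derivation]
  fix k assume "k \<in> {k \<in> K. D k \<in> K}"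
  then have k: "k \<in> K" "D k \<in> K" "k \<in> carrier E" using f'(5) by auto
  then show "dq (f k) \<ominus>\<^bsub>TF\<^esub> f (D k) \<in> carrier TF" using f' by (simp add: dq_closed)
  {
    fix l assume "l \<in> {k \<in> K. D k \<in> K}"
    then have l: "l \<in> K" "D l \<in> K" "l \<in> carrier E" using f'(5) by auto
    show "dq (f (k \<oplus>\<^bsub>E\<^esub> l)) \<ominus>\<^bsub>TF\<^esub> f (D (k \<oplus>\<^bsub>E\<^esub> l)) =
        dq (f k) \<ominus>\<^bsub>TF\<^esub> f (D k) \<oplus>\<^bsub>TF\<^esub> (dq (f l) \<ominus>\<^bsub>TF\<^esub> f (D l))"
      using k l
      by (simp add: env_derivation_add[OF \<delta>] f' dq')
        (simp add: a_minus_def N.M.minus_add N.M.a_ac f' dq')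
  next
    fix t assume t: "t \<in> carrier E"
    then have Dt: "D t \<in> carrier E" by (rule env_derivation_closed[OF \<delta>])
    have c: "dq (f k) \<in> carrier TF" "f (D k) \<in> carrier TF" "f k \<in> carrier TF"
      using k f' dq' by auto
    have "dq (f (k \<otimes>\<^bsub>E\<^esub> t)) = env_act TF (dq (f k)) t \<oplus>\<^bsub>TF\<^esub> env_act TF (f k) (D t)"
      using k t by (simp add: f' N.module_derivation_env_act[OF \<delta> dq_module_derivation])
    moreover have "f (D (k \<otimes>\<^bsub>E\<^esub> t)) = env_act TF (f (D k)) t \<oplus>\<^bsub>TF\<^esub> env_act TF (f k) (D t)"
      using k t Dt by (simp add: f' env_derivation_mult[OF \<delta>])
    ultimately show "dq (f (k \<otimes>\<^bsub>E\<^esub> t)) \<ominus>\<^bsub>TF\<^esub> f (D (k \<otimes>\<^bsub>E\<^esub> t)) =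
        env_act TF (dq (f k) \<ominus>\<^bsub>TF\<^esub> f (D k)) t"
      using c t Dt
      by (simp add: N.env_act_diff_left N.env_act_closed N.M.add_diff_add)
  }
qed

abbreviation d' where "d' \<equiv> extension_map R M \<delta> d F"

lemma extension_map_germ:
  assumes f: "(K, f) \<in> partial_homs R M F"
  shows "d' (germ K f) = germ {k \<in> K. D k \<in> K} (\<lambda>k. dq (f k) \<ominus>\<^bsub>TF\<^esub> f (D k))"
  unfolding extension_map_def
proof (rule germ_UN[OF f])
  fix L g H assume *: "(L, g) \<in> partial_homs R M F" "H \<in> symmetric_filter R F" "H \<subseteq> K" "H \<subseteq> L"
    "\<And>k. k \<in> H \<Longrightarrow> f k = g k"
  show "germ {k \<in> L. D k \<in> L} (\<lambda>k. dq (g k) \<ominus>\<^bsub>TF\<^esub> g (D k)) =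
      germ {k \<in> K. D k \<in> K} (\<lambda>k. dq (f k) \<ominus>\<^bsub>TF\<^esub> f (D k))"
    by (rule germ_eqI[OF partial_homs_derivation[OF *(1)] partial_homs_derivation[OF f]
          symmetric_filter_derivation[OF *(2) \<delta>]])
      (use * in auto)
qed

text \<open>Evaluated at \<open>k\<close>, the two sides differ by the splitting of D (t k) into D t
  k and t D k inside \<open>f\<close>. Taking \<open>t\<close> with a 1 in one coordinate yields
  both Leibniz rules of a bimodule.\<close>

lemma extension_map_act:
  assumes "X \<in> carrier Q" and t: "t \<in> carrier E"
  shows "d' (qact X t) = qact (d' X) t \<oplus>\<^bsub>Q\<^esub> qact X (D t)"
proof -
  obtain K f where f: "(K, f) \<in> partial_homs R M F" "X = germ K f" using assms(1) by (rule germ_cases)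
  note f' = partial_homsD[OF f(1)]
  have Dt: "D t \<in> carrier E" using t by (rule env_derivation_closed[OF \<delta>])
  note ft = partial_homs_act[OF f(1) t] and df = partial_homs_derivation[OF f(1)]
    and fDt = partial_homs_act[OF f(1) Dt]
  note dft = partial_homs_act[OF df t] and ftd = partial_homs_derivation[OF ft]
  note sum = partial_homs_add[OF dft fDt]
  show ?thesis
    unfolding f(2) act_germ[OF f(1) t] extension_map_germ[OF ft] extension_map_germ[OF f(1)]
      act_germ[OF df t] act_germ[OF f(1) Dt] add_germ[OF dft fDt]
  proof (rule germ_eqI[OF ftd sum symmetric_filter_inter[OF partial_homsD(1)[OF ftd] partial_homsD(1)[OF sum]]])
    fix k assume "k \<in> {k \<in> right_colon E K t. D k \<in> right_colon E K t} \<inter>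
        (right_colon E {k \<in> K. D k \<in> K} t \<inter> right_colon E K (D t))"
    then have k: "k \<in> carrier E" "t \<otimes>\<^bsub>E\<^esub> k \<in> K" "t \<otimes>\<^bsub>E\<^esub> D k \<in> K"
      "D t \<otimes>\<^bsub>E\<^esub> k \<in> K"
      by (auto simp: right_colon_def)
    then have "f (D (t \<otimes>\<^bsub>E\<^esub> k)) = f (D t \<otimes>\<^bsub>E\<^esub> k) \<oplus>\<^bsub>TF\<^esub> f (t \<otimes>\<^bsub>E\<^esub> D k)"
      using t by (simp add: env_derivation_mult[OF \<delta>] f')
    then show "dq (f (t \<otimes>\<^bsub>E\<^esub> k)) \<ominus>\<^bsub>TF\<^esub> f (t \<otimes>\<^bsub>E\<^esub> D k) =
        dq (f (t \<otimes>\<^bsub>E\<^esub> k)) \<ominus>\<^bsub>TF\<^esub> f (D (t \<otimes>\<^bsub>E\<^esub> k)) \<oplus>\<^bsub>TF\<^esub> f (D t \<otimes>\<^bsub>E\<^esub> k)"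
      using k f' by (simp add: dq_closed N.M.diff_add_add)
  qed auto
qed

lemma extension_map_extension: "is_extension R M \<delta> d F d'"
  unfolding is_extension_def module_derivation_def
proof (intro conjI ballI funcsetI)
  fix X assume X: "X \<in> carrier Q"
  then obtain K f where f: "(K, f) \<in> partial_homs R M F" "X = germ K f" by (rule germ_cases)
  show "d' X \<in> carrier Q"
    unfolding f(2) extension_map_germ[OF f(1)] by (rule germ_closed[OF partial_homs_derivation[OF f(1)]])
  {
    fix Y assume "Y \<in> carrier Q"
    then obtain L g where g: "(L, g) \<in> partial_homs R M F" "Y = germ L g" by (rule germ_cases)
    note fg = partial_homs_add[OF f(1) g(1)]
    note df = partial_homs_derivation[OF f(1)] and dg = partial_homs_derivation[OF g(1)]
      and dfg = partial_homs_derivation[OF fg]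
    note sum = partial_homs_add[OF df dg]
    show "d' (X \<oplus>\<^bsub>Q\<^esub> Y) = d' X \<oplus>\<^bsub>Q\<^esub> d' Y"
      unfolding f(2) g(2) add_germ[OF f(1) g(1)] extension_map_germ[OF f(1)] extension_map_germ[OF g(1)]
        extension_map_germ[OF fg] add_germ[OF df dg]
    proof (rule germ_eqI[OF dfg sum partial_homsD(1)[OF sum]])
      fix k assume "k \<in> {k \<in> K. D k \<in> K} \<inter> {k \<in> L. D k \<in> L}"
      then have c: "f k \<in> carrier TF" "g k \<in> carrier TF" "f (D k) \<in> carrier TF" "g (D k) \<in> carrier TF"
        using partial_homsD(2)[OF f(1)] partial_homsD(2)[OF g(1)] by auto
      then show "dq (f k \<oplus>\<^bsub>TF\<^esub> g k) \<ominus>\<^bsub>TF\<^esub> (f (D k) \<oplus>\<^bsub>TF\<^esub> g (D k)) =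
          dq (f k) \<ominus>\<^bsub>TF\<^esub> f (D k) \<oplus>\<^bsub>TF\<^esub> (dq (g k) \<ominus>\<^bsub>TF\<^esub> g (D k))"
        by (simp add: module_derivationD[OF dq_module_derivation] a_minus_def N.M.minus_add N.M.a_ac)
    qed auto
  next
    fix r assume r: "r \<in> carrier R"
    then have \<delta>r: "\<delta> r \<in> carrier R" by (rule derivationD(1)[OF \<delta>])
    \<comment> \<open>Since \<delta> 1 = 0, these two values turn \<open>extension_map_act\<close>
      into the right and the left Leibniz rule.\<close>
    have "D (pure_tensor R r \<one>) = pure_tensor R (\<delta> r) \<one>" "D (pure_tensor R \<one> r) = pure_tensor R \<one> (\<delta> r)"
      using r \<delta>r by (simp_all add: env_derivation_pure[OF \<delta>] derivation_one[OF \<delta>] pure_tensor_zero)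
    then show "d' (rsmult Q X r) = rsmult Q (d' X) r \<oplus>\<^bsub>Q\<^esub> rsmult Q X (\<delta> r)"
      and "d' (lsmult Q r X) = lsmult Q (\<delta> r) X \<oplus>\<^bsub>Q\<^esub> lsmult Q r (d' X)"
      using extension_map_act[OF X, of "pure_tensor R r \<one>"] extension_map_act[OF X, of "pure_tensor R \<one> r"]
        r \<delta>r X \<open>d' X \<in> carrier Q\<close>
      by (simp_all add: rsmult_Q lsmult_Q Q.M.a_comm qact_closed)
  }
next
  fix m assume m: "m \<in> carrier M"
  note pm = partial_homs_const[OF proj_closed[OF m]]
  have dm: "d m \<in> carrier M" using m by (rule module_derivationD(1)[OF d])
  \<comment> \<open>The representative here is t \<mapsto> m t, and d (m t) - m (D t) = (d m) t by
    the Leibniz rule for the enveloping action.\<close>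
  show "d' (quotient_map R M F m) = quotient_map R M F (d m)"
    unfolding quotient_map_def extension_map_germ[OF pm]
    by (rule germ_eqI[OF partial_homs_derivation[OF pm] partial_homs_const[OF proj_closed[OF dm]]
          symmetric_filter_carrier])
      (use m dm in \<open>auto simp: env_derivation_closed[OF \<delta>] N.module_derivation_env_act[OF \<delta> dq_module_derivation]
          dq_proj N.env_act_closed a_minus_def N.M.a_assoc N.M.r_neg\<close>)
qed

end

end

lemma symmetric_moduleI:
  "bimodule R M \<Longrightarrow> gabriel_pair R F \<Longrightarrow> symmetric_module R M F"
  by (simp add: symmetric_module_def symmetric_theory_def symmetric_theory_axioms_def bimodule_def
      left_module_def)

proposition module_derivation_extends:
  assumes "bimodule R M" "gabriel_pair R F" "derivation R \<delta>" "module_derivation R M \<delta> d"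
  shows "extends R M \<delta> d F"
  unfolding extends_def
  using symmetric_module.extension_map_extension[OF symmetric_moduleI[OF assms(1,2)] assms(3,4)] by blast

text \<open>The comparison map composes a representative with the projection \<open>c\<close> and
  leaves its domain alone. As \<open>c\<close> is linear and commutes with the induced derivations,
  both composites are given by the same function on the same member, namely those \<open>k\<close>
  in \<open>K\<close> with D k in \<open>K\<close>.\<close>

proposition extensions_agree_of_filter_inclusion:
  assumes M: "bimodule R M" and F: "gabriel_pair R F" and G: "gabriel_pair R G"
    and \<delta>: "derivation R \<delta>" and d: "module_derivation R M \<delta> d"
    and sub: "symmetric_filter R F \<subseteq> symmetric_filter R G"
  shows "extensions_agree R M \<delta> d F G"
proof -
  interpret F: symmetric_module R M F using M F by (rule symmetric_moduleI)
  interpret G: symmetric_module R M G using M G by (rule symmetric_moduleI)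
  \<comment> \<open>The projection between the two torsion-free quotients, written as in
    \<open>comparison_map\<close>.\<close>
  define c where "c X = (\<Union>x\<in>X. symmetric_torsion M G +>\<^bsub>M\<^esub> x)" for X
  \<comment> \<open>Obtained from the inclusion of symmetric filters through annihilators: a member
    annihilating \<open>x\<close> is also a member of the larger filter.\<close>
  have torsion: "symmetric_torsion M F \<subseteq> symmetric_torsion M G"
  proof
    fix x assume "x \<in> symmetric_torsion M F"
    then obtain K where K: "x \<in> carrier M" "K \<in> symmetric_filter R F"
      "\<And>k. k \<in> K \<Longrightarrow> env_act M x k = \<zero>\<^bsub>M\<^esub>"
      by (rule F.symmetric_torsionE) blast
    have "K \<in> symmetric_filter R G" using sub K(2) by blast
    then show "x \<in> symmetric_torsion M G" by (rule G.symmetric_torsionI[OF K(1) _ K(3)])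
  qed
  have c_proj: "c (F.proj x) = G.proj x" if x: "x \<in> carrier M" for x
  proof -
    have "G.proj y = G.proj x" if "y \<in> F.proj x" for y
    proof -
      have y: "y \<in> carrier M" "y \<ominus>\<^bsub>M\<^esub> x \<in> symmetric_torsion M F"
        using that F.M.mem_rcoset[OF F.symmetric_torsion_additive_subgroup x] by auto
      have "y \<ominus>\<^bsub>M\<^esub> x \<in> symmetric_torsion M G" using torsion y(2) by blast
      then show ?thesis using x y(1) by (simp add: G.proj_eq_iff)
    qed
    moreover have "x \<in> F.proj x"
      using F.M.mem_rcoset[OF F.symmetric_torsion_additive_subgroup x] x
        additive_subgroup.zero_closed[OF F.symmetric_torsion_additive_subgroup]
      by (simp add: F.M.diff_self)
    ultimately have "G.proj ` F.proj x = {G.proj x}" by blast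
    then show ?thesis by (simp add: c_def)
  qed
  have c_closed: "c n \<in> carrier G.TF" if "n \<in> carrier F.TF" for n
    using that by (auto simp: F.torsionfree_carrier c_proj)
  have c_add: "c (n \<oplus>\<^bsub>F.TF\<^esub> n') = c n \<oplus>\<^bsub>G.TF\<^esub> c n'" if "n \<in> carrier F.TF" "n' \<in> carrier F.TF" for n n'
    using that by (auto simp: F.torsionfree_carrier c_proj G.proj_add simp flip: F.proj_add)
  have c_diff: "c (n \<ominus>\<^bsub>F.TF\<^esub> n') = c n \<ominus>\<^bsub>G.TF\<^esub> c n'" if "n \<in> carrier F.TF" "n' \<in> carrier F.TF" for n n'
    using that by (intro additive_map_diff[OF F.N.M.abelian_group_axioms G.N.M.abelian_group_axioms])
      (auto simp: c_closed c_add)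
  have c_act: "c (env_act F.TF n t) = env_act G.TF (c n) t"
    if "n \<in> carrier F.TF" "t \<in> carrier (env_ring R)" for n t
    using that by (auto simp: F.torsionfree_carrier F.proj_env_act c_proj G.proj_env_act F.env_act_closed)
  have c_der: "c (quotient_derivation M F d n) = quotient_derivation M G d (c n)" if "n \<in> carrier F.TF" for n
    using that by (auto simp: F.torsionfree_carrier c_proj F.dq_proj[OF \<delta> d] G.dq_proj[OF \<delta> d]
        module_derivationD[OF d])
  have hom: "(K, \<lambda>k. c (f k)) \<in> partial_homs R M G" if f: "(K, f) \<in> partial_homs R M F" for K f
    using subsetD[OF sub F.partial_homsD(1)[OF f]]
    by (intro G.partial_homsI) (simp_all add: F.partial_homsD(2-4)[OF f] c_closed c_add c_act)
  have comp: "comparison_map R M F G (F.germ K f) = G.germ K (\<lambda>k. c (f k))"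
    if f: "(K, f) \<in> partial_homs R M F" for K f
    unfolding comparison_map_def c_def[symmetric]
  proof (rule F.germ_UN[OF f])
    fix L g H assume *: "(L, g) \<in> partial_homs R M F" "H \<in> symmetric_filter R F" "H \<subseteq> K" "H \<subseteq> L"
      "\<And>k. k \<in> H \<Longrightarrow> f k = g k"
    show "G.germ L (\<lambda>k. c (g k)) = G.germ K (\<lambda>k. c (f k))"
      by (rule G.germ_eqI[OF hom[OF *(1)] hom[OF f] subsetD[OF sub *(2)]]) (use * in auto)
  qed
  have "extension_map R M \<delta> d G (comparison_map R M F G X) =
      comparison_map R M F G (extension_map R M \<delta> d F X)" if X: "X \<in> carrier F.Q" for X
  proof -
    obtain K f where f: "(K, f) \<in> partial_homs R M F" "X = F.germ K f"
      using X by (rule F.germ_cases)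
    note df = F.partial_homs_derivation[OF \<delta> d f(1)]
    show ?thesis
      unfolding f(2) comp[OF f(1)] G.extension_map_germ[OF \<delta> d hom[OF f(1)]]
        F.extension_map_germ[OF \<delta> d f(1)] comp[OF df]
      by (rule G.germ_eqI[OF G.partial_homs_derivation[OF \<delta> d hom[OF f(1)]] hom[OF df]
            subsetD[OF sub F.partial_homsD(1)[OF df]]])
        (auto simp: c_diff c_der F.partial_homsD(2)[OF f(1)] F.dq_closed[OF \<delta> d])
  qed
  then show ?thesis
    unfolding extensions_agree_def
    using sub F.extension_map_extension[OF \<delta> d] G.extension_map_extension[OF \<delta> d] by blast
qed

section \<open>Particular torsion theories\<close>

lemma regular_bimodule_simps [simp]:
  "carrier (regular_bimodule R) = carrier R" "\<zero>\<^bsub>regular_bimodule R\<^esub> = \<zero>\<^bsub>R\<^esub>"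
  "ring.add (regular_bimodule R) = ring.add R"
  "lsmult (regular_bimodule R) = monoid.mult R" "rsmult (regular_bimodule R) = monoid.mult R"
  by (simp_all add: regular_bimodule_def)

lemma additive_subgroup_regular_bimodule [simp]:
  "additive_subgroup I (regular_bimodule R) \<longleftrightarrow> additive_subgroup I R"
  by (simp add: additive_subgroup_def subgroup_def m_inv_def)

lemma (in ring) regular_bimodule_bimodule: "bimodule R (regular_bimodule R)"
proof -
  have "abelian_group (regular_bimodule R)"
    by (rule abelian_groupI) (auto simp: a_ac intro: bexI[of _ "\<ominus> _"] l_neg)
  then show ?thesis
    by (intro bimodule.intro left_module.intro right_module.intro left_module_axioms.intro
        right_module_axioms.intro bimodule_axioms.intro)
      (auto simp: ring_axioms l_distr r_distr m_assoc)
qed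

lemma derivation_module_derivation:
  "derivation R \<delta> \<Longrightarrow> module_derivation R (regular_bimodule R) \<delta> \<delta>"
  by (auto simp: derivation_def module_derivation_def)

lemma left_torsion_regular_opposite [simp]:
  "left_torsion (regular_bimodule (opposite R)) F = right_torsion (regular_bimodule R) F"
  by (simp add: left_torsion_def right_torsion_def)

section \<open>Dense ideals and the Lambek theory\<close>

context ring
begin

lemma left_gabriel_filterI:
  assumes "\<And>I. I \<in> F \<Longrightarrow> left_ideal R I" and "carrier R \<in> F"
    and "\<And>I J. I \<in> F \<Longrightarrow> left_ideal R J \<Longrightarrow> I \<subseteq> J \<Longrightarrow> J \<in> F"
    and "\<And>I J. I \<in> F \<Longrightarrow> J \<in> F \<Longrightarrow> I \<inter> J \<in> F"
    and "\<And>I a. I \<in> F \<Longrightarrow> a \<in> carrier R \<Longrightarrow> left_colon R I a \<in> F"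
    and "\<And>I J. J \<in> F \<Longrightarrow> left_ideal R I \<Longrightarrow> \<forall>a\<in>J. left_colon R I a \<in> F \<Longrightarrow> I \<in> F"
  shows "left_gabriel_filter R F"
  unfolding left_gabriel_filter_def
proof (intro conjI ballI allI impI; (elim conjE)?)
  show "F \<noteq> {}" using assms(2) by auto
qed (fact assms)+

lemma left_ideal_inter: "left_ideal R K \<Longrightarrow> left_ideal R L \<Longrightarrow> left_ideal R (K \<inter> L)"
  by (auto simp: left_ideal_iff)

lemma left_ideal_carrier: "left_ideal R (carrier R)"
  by (auto simp: left_ideal_iff)

lemma left_ideal_subset: "left_ideal R I \<Longrightarrow> I \<subseteq> carrier R"
  by (simp add: left_ideal_iff)

lemma left_ideal_mult: "left_ideal R I \<Longrightarrow> a \<in> I \<Longrightarrow> r \<in> carrier R \<Longrightarrow> r \<otimes> a \<in> I"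
  by (simp add: left_ideal_iff)

lemma dense_left_idealE:
  assumes "dense_left_ideal R I" "x \<in> carrier R" "y \<in> carrier R" "x \<noteq> \<zero>"
  obtains r where "r \<in> carrier R" "r \<otimes> y \<in> I" "r \<otimes> x \<noteq> \<zero>"
  using assms unfolding dense_left_ideal_def by blast

lemma left_gabriel_filter_dense: "left_gabriel_filter R {I. dense_left_ideal R I}"
proof (rule left_gabriel_filterI, unfold mem_Collect_eq)
  show "left_ideal R I" if "dense_left_ideal R I" for I
    using that by (simp add: dense_left_ideal_def)
  show "dense_left_ideal R (carrier R)"
    unfolding dense_left_ideal_def by (auto simp: left_ideal_carrier intro!: bexI[of _ \<one>])
  show "dense_left_ideal R J" if "dense_left_ideal R I" "left_ideal R J" "I \<subseteq> J" for I J
    using that unfolding dense_left_ideal_def by blast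
  show "dense_left_ideal R (I \<inter> J)" if I: "dense_left_ideal R I" and J: "dense_left_ideal R J" for I J
    unfolding dense_left_ideal_def
  proof (intro conjI ballI impI)
    show "left_ideal R (I \<inter> J)" using I J by (simp add: dense_left_ideal_def left_ideal_inter)
    fix x y assume xy: "x \<in> carrier R" "y \<in> carrier R" "x \<noteq> \<zero>"
    obtain r where r: "r \<in> carrier R" "r \<otimes> y \<in> I" "r \<otimes> x \<noteq> \<zero>" using I xy by (rule dense_left_idealE)
    \<comment> \<open>Density of \<open>J\<close> is applied to r x and r y instead of x and y, so
      that the single multiplier s r serves both ideals.\<close>
    obtain s where s: "s \<in> carrier R" "s \<otimes> (r \<otimes> y) \<in> J" "s \<otimes> (r \<otimes> x) \<noteq> \<zero>"
      using dense_left_idealE[OF J, of "r \<otimes> x" "r \<otimes> y"] r xy by auto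
    have "s \<otimes> (r \<otimes> y) \<in> I" using I r s by (simp add: dense_left_ideal_def left_ideal_mult)
    with r s xy show "\<exists>r\<in>carrier R. r \<otimes> y \<in> I \<inter> J \<and> r \<otimes> x \<noteq> \<zero>"
      by (intro bexI[of _ "s \<otimes> r"]) (auto simp: m_assoc)
  qed
  show "dense_left_ideal R (left_colon R I a)" if I: "dense_left_ideal R I" and a: "a \<in> carrier R" for I a
    unfolding dense_left_ideal_def
  proof (intro conjI ballI impI)
    show "left_ideal R (left_colon R I a)" using I a by (simp add: dense_left_ideal_def left_ideal_colon)
    fix x y assume xy: "x \<in> carrier R" "y \<in> carrier R" "x \<noteq> \<zero>"
    obtain r where r: "r \<in> carrier R" "r \<otimes> (y \<otimes> a) \<in> I" "r \<otimes> x \<noteq> \<zero>"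
      using dense_left_idealE[OF I, of x "y \<otimes> a"] xy a by auto
    then show "\<exists>r\<in>carrier R. r \<otimes> y \<in> left_colon R I a \<and> r \<otimes> x \<noteq> \<zero>"
      using xy a by (intro bexI[of _ r]) (auto simp: left_colon_def m_assoc)
  qed
  show "dense_left_ideal R I"
    if J: "dense_left_ideal R J" and I: "left_ideal R I" and IJ: "\<forall>a\<in>J. dense_left_ideal R (left_colon R I a)"
    for I J
    unfolding dense_left_ideal_def
  proof (intro conjI ballI impI I)
    fix x y assume xy: "x \<in> carrier R" "y \<in> carrier R" "x \<noteq> \<zero>"
    obtain r where r: "r \<in> carrier R" "r \<otimes> y \<in> J" "r \<otimes> x \<noteq> \<zero>" using J xy by (rule dense_left_idealE)
    have "dense_left_ideal R (left_colon R I (r \<otimes> y))" using IJ r(2) by blast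
    \<comment> \<open>With target 1, density of the colon ideal produces an element \<open>s\<close>
      of that ideal which does not annihilate r x.\<close>
    then obtain s where s: "s \<in> carrier R" "s \<otimes> \<one> \<in> left_colon R I (r \<otimes> y)" "s \<otimes> (r \<otimes> x) \<noteq> \<zero>"
      using dense_left_idealE[of "left_colon R I (r \<otimes> y)" "r \<otimes> x" \<one>] r xy by auto
    then show "\<exists>r\<in>carrier R. r \<otimes> y \<in> I \<and> r \<otimes> x \<noteq> \<zero>"
      using r xy by (intro bexI[of _ "s \<otimes> r"]) (auto simp: left_colon_def m_assoc)
  qed
qed

lemma lambek_gabriel_pair: "gabriel_pair R (lambek_pair R)"
  using left_gabriel_filter_dense ring.left_gabriel_filter_dense[OF opposite_ring]
  by (simp add: gabriel_pair_def lambek_pair_def)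

text \<open>Density at \<open>x\<close> and \<open>y\<close> says that the colon ideal of
  \<open>I\<close> by \<open>y\<close> does not annihilate \<open>x\<close>. That colon ideal is a
  member of the filter, and a member annihilates no nonzero element.\<close>

lemma left_torsion_zero_dense:
  assumes F: "left_gabriel_filter R F" and tf: "left_torsion (regular_bimodule R) F = {\<zero>}"
    and I: "I \<in> F"
  shows "dense_left_ideal R I"
  unfolding dense_left_ideal_def
proof (intro conjI ballI impI)
  show "left_ideal R I" using F I by (rule left_gabriel_filterD(1))
  fix x y assume xy: "x \<in> carrier R" "y \<in> carrier R" "x \<noteq> \<zero>"
  have "left_colon R I y \<in> F" using F I xy(2) by (rule left_gabriel_filterD(4))
  moreover have "x \<notin> left_torsion (regular_bimodule R) F" using tf xy(3) by simp
  ultimately have "\<not> (\<forall>a\<in>left_colon R I y. a \<otimes> x = \<zero>)"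
    using xy(1) unfolding left_torsion_def by auto
  then show "\<exists>r\<in>carrier R. r \<otimes> y \<in> I \<and> r \<otimes> x \<noteq> \<zero>" unfolding left_colon_def by blast
qed

lemma right_torsion_zero_dense:
  assumes "right_gabriel_filter R F" "right_torsion (regular_bimodule R) F = {\<zero>}" "I \<in> F"
  shows "dense_right_ideal R I"
  using ring.left_torsion_zero_dense[OF opposite_ring, of F I] assms by simp

lemma symmetric_filter_mono:
  "fst F \<subseteq> fst G \<Longrightarrow> snd F \<subseteq> snd G \<Longrightarrow> symmetric_filter R F \<subseteq> symmetric_filter R G"
  unfolding symmetric_filter_def by blast

lemma faithful_on_both_sides_lambek:
  assumes "gabriel_pair R F" "faithful_on_both_sides R F"
  shows "symmetric_filter R F \<subseteq> symmetric_filter R (lambek_pair R)"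
  using assms left_torsion_zero_dense right_torsion_zero_dense
  by (intro symmetric_filter_mono)
    (auto simp: gabriel_pair_def faithful_on_both_sides_def lambek_pair_def)

section \<open>Regular elements and the classical theory\<close>

lemma regular_elementsD:
  assumes "t \<in> regular_elements R"
  shows "t \<in> carrier R" "x \<in> carrier R \<Longrightarrow> t \<otimes> x = \<zero> \<Longrightarrow> x = \<zero>"
    "x \<in> carrier R \<Longrightarrow> x \<otimes> t = \<zero> \<Longrightarrow> x = \<zero>"
  using assms unfolding regular_elements_def by blast+

lemma regular_elements_mult:
  assumes s: "s \<in> regular_elements R" and t: "t \<in> regular_elements R"
  shows "s \<otimes> t \<in> regular_elements R"
proof -
  note s = regular_elementsD[OF s] and t = regular_elementsD[OF t]
  have "x = \<zero>" if x: "x \<in> carrier R" and "s \<otimes> t \<otimes> x = \<zero>" for x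
    using s(2)[of "t \<otimes> x"] t(2)[of x] that s(1) t(1) by (simp add: m_assoc)
  moreover have "x = \<zero>" if x: "x \<in> carrier R" and "x \<otimes> (s \<otimes> t) = \<zero>" for x
    using t(3)[of "x \<otimes> s"] s(3)[of x] that s(1) t(1) by (simp add: m_assoc)
  ultimately show ?thesis using m_closed[OF s(1) t(1)] unfolding regular_elements_def by blast
qed

lemma one_regular: "\<one> \<in> regular_elements R"
  by (simp add: regular_elements_def)

text \<open>Multipliers are chained: a regular \<open>s\<close> for the first condition followed by
  a regular \<open>t\<close> for the second gives t s, which is again regular.\<close>

lemma left_gabriel_filter_classical:
  "left_gabriel_filter R {I. left_ideal R I \<and> (\<forall>r\<in>carrier R. \<exists>s\<in>regular_elements R. s \<otimes> r \<in> I)}"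
proof (rule left_gabriel_filterI, unfold mem_Collect_eq)
  show "left_ideal R (carrier R) \<and> (\<forall>r\<in>carrier R. \<exists>s\<in>regular_elements R. s \<otimes> r \<in> carrier R)"
    using one_regular by (auto simp: left_ideal_carrier)
  fix I assume I: "left_ideal R I \<and> (\<forall>r\<in>carrier R. \<exists>s\<in>regular_elements R. s \<otimes> r \<in> I)"
  then show "left_ideal R I" by simp
  show "left_ideal R J \<and> (\<forall>r\<in>carrier R. \<exists>s\<in>regular_elements R. s \<otimes> r \<in> J)"
    if "left_ideal R J" "I \<subseteq> J" for J
    using I that by blast
  show "left_ideal R (left_colon R I a) \<and>
      (\<forall>r\<in>carrier R. \<exists>s\<in>regular_elements R. s \<otimes> r \<in> left_colon R I a)" if a: "a \<in> carrier R" for a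
  proof (intro conjI ballI)
    show "left_ideal R (left_colon R I a)" using I a by (simp add: left_ideal_colon)
    fix r assume r: "r \<in> carrier R"
    then obtain s where "s \<in> regular_elements R" "s \<otimes> (r \<otimes> a) \<in> I" using I a by (metis m_closed)
    then show "\<exists>s\<in>regular_elements R. s \<otimes> r \<in> left_colon R I a"
      using r a by (intro bexI[of _ s]) (auto simp: left_colon_def m_assoc regular_elementsD(1))
  qed
  fix J assume J: "left_ideal R J \<and> (\<forall>r\<in>carrier R. \<exists>s\<in>regular_elements R. s \<otimes> r \<in> J)"
  show "left_ideal R (I \<inter> J) \<and> (\<forall>r\<in>carrier R. \<exists>s\<in>regular_elements R. s \<otimes> r \<in> I \<inter> J)"
  proof (intro conjI ballI)
    show "left_ideal R (I \<inter> J)" using I J by (simp add: left_ideal_inter)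
    fix r assume r: "r \<in> carrier R"
    then obtain s where s: "s \<in> regular_elements R" "s \<otimes> r \<in> I" using I by blast
    have "s \<otimes> r \<in> carrier R" using s r by (simp add: regular_elementsD(1))
    then obtain t where t: "t \<in> regular_elements R" "t \<otimes> (s \<otimes> r) \<in> J" using J by blast
    have "t \<otimes> (s \<otimes> r) \<in> I" using I s t by (simp add: left_ideal_mult regular_elementsD(1))
    with s t r show "\<exists>s\<in>regular_elements R. s \<otimes> r \<in> I \<inter> J"
      by (intro bexI[of _ "t \<otimes> s"]) (auto simp: m_assoc regular_elementsD(1) regular_elements_mult)
  qed
next
  fix I J assume J: "left_ideal R J \<and> (\<forall>r\<in>carrier R. \<exists>s\<in>regular_elements R. s \<otimes> r \<in> J)"
    and I: "left_ideal R I"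
    and IJ: "\<forall>a\<in>J. left_ideal R (left_colon R I a) \<and>
      (\<forall>r\<in>carrier R. \<exists>s\<in>regular_elements R. s \<otimes> r \<in> left_colon R I a)"
  show "left_ideal R I \<and> (\<forall>r\<in>carrier R. \<exists>s\<in>regular_elements R. s \<otimes> r \<in> I)"
  proof (intro conjI ballI I)
    fix r assume r: "r \<in> carrier R"
    then obtain s where s: "s \<in> regular_elements R" "s \<otimes> r \<in> J" using J by blast
    \<comment> \<open>The condition on the colon ideal is used at 1, so that \<open>t\<close> itself
      lies in it and t (s r) is in \<open>I\<close>.\<close>
    then obtain t where t: "t \<in> regular_elements R" "t \<otimes> \<one> \<in> left_colon R I (s \<otimes> r)"
      using IJ by (metis one_closed)
    with s r show "\<exists>s\<in>regular_elements R. s \<otimes> r \<in> I"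
      by (intro bexI[of _ "t \<otimes> s"])
        (auto simp: left_colon_def m_assoc regular_elementsD(1) regular_elements_mult)
  qed
qed

lemma classical_gabriel_pair: "gabriel_pair R (classical_pair R)"
  using left_gabriel_filter_classical ring.left_gabriel_filter_classical[OF opposite_ring]
  by (simp add: gabriel_pair_def classical_pair_def)

text \<open>The membership condition at r = 1. A regular element in the ideal is what later forces
  faithfulness and, once it is invertible, makes the ideal generate everything.\<close>

lemma mem_classical_left:
  assumes "I \<in> fst (classical_pair R)"
  obtains s where "s \<in> regular_elements R" "s \<in> I"
proof -
  have "\<exists>s\<in>regular_elements R. s \<otimes> \<one> \<in> I" using assms unfolding classical_pair_def by auto
  then show ?thesis using that by (auto simp: regular_elementsD(1))
qed

lemma mem_classical_right:
  assumes "J \<in> snd (classical_pair R)"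
  obtains s where "s \<in> regular_elements R" "s \<in> J"
proof -
  have "\<exists>s\<in>regular_elements R. \<one> \<otimes> s \<in> J" using assms unfolding classical_pair_def by auto
  then show ?thesis using that by (auto simp: regular_elementsD(1))
qed

lemma left_torsion_zeroI:
  assumes F: "left_gabriel_filter R F"
    and 0: "\<And>x I. x \<in> carrier R \<Longrightarrow> I \<in> F \<Longrightarrow> (\<And>a. a \<in> I \<Longrightarrow> a \<otimes> x = \<zero>) \<Longrightarrow> x = \<zero>"
  shows "left_torsion (regular_bimodule R) F = {\<zero>}"
proof (intro equalityI subsetI)
  fix x assume "x \<in> left_torsion (regular_bimodule R) F"
  then obtain I where "x \<in> carrier R" "I \<in> F" "\<forall>a\<in>I. a \<otimes> x = \<zero>" by (auto simp: left_torsion_def)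
  then show "x \<in> {\<zero>}" using 0[of x I] by blast
next
  fix x assume "x \<in> {\<zero>}"
  then show "x \<in> left_torsion (regular_bimodule R) F"
    using left_gabriel_filter_carrier[OF F] by (auto simp: left_torsion_def intro!: bexI[of _ "carrier R"])
qed

lemma right_torsion_zeroI:
  assumes F: "right_gabriel_filter R F"
    and 0: "\<And>x I. x \<in> carrier R \<Longrightarrow> I \<in> F \<Longrightarrow> (\<And>a. a \<in> I \<Longrightarrow> x \<otimes> a = \<zero>) \<Longrightarrow> x = \<zero>"
  shows "right_torsion (regular_bimodule R) F = {\<zero>}"
  using ring.left_torsion_zeroI[OF opposite_ring, of F] assms by simp

lemma classical_faithful: "faithful_on_both_sides R (classical_pair R)"
  unfolding faithful_on_both_sides_def
proof
  note F = classical_gabriel_pair[unfolded gabriel_pair_def]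
  show "left_torsion (regular_bimodule R) (fst (classical_pair R)) = {\<zero>}"
  proof (rule left_torsion_zeroI[OF conjunct1[OF F]])
    fix x I assume x: "x \<in> carrier R" "\<And>a. a \<in> I \<Longrightarrow> a \<otimes> x = \<zero>" and "I \<in> fst (classical_pair R)"
    then obtain s where "s \<in> regular_elements R" "s \<in> I" by (elim mem_classical_left)
    then show "x = \<zero>" using x regular_elementsD(2) by blast
  qed
  show "right_torsion (regular_bimodule R) (snd (classical_pair R)) = {\<zero>}"
  proof (rule right_torsion_zeroI[OF conjunct2[OF F]])
    fix x I assume x: "x \<in> carrier R" "\<And>a. a \<in> I \<Longrightarrow> x \<otimes> a = \<zero>" and "I \<in> snd (classical_pair R)"
    then obtain s where "s \<in> regular_elements R" "s \<in> I" by (elim mem_classical_right)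
    then show "x = \<zero>" using x regular_elementsD(3) by blast
  qed
qed

text \<open>The torsion-free module to test is \<open>R / T\<close>, where \<open>T / I\<close> is the torsion submodule of
  \<open>R / I\<close>. The coset of \<open>1\<close> is annihilated by the essential left ideal \<open>I\<close>.\<close>

lemma essential_left_ideal_mem_goldie:
  assumes F: "left_gabriel_filter R F"
    and goldie: "\<And>N :: ('a, 'a set) bimodule. left_module R N \<Longrightarrow>
        left_torsion N F = {\<zero>\<^bsub>N\<^esub>} \<Longrightarrow> nonsingular_left_module R N"
    and I: "essential_left_ideal R I"
  shows "I \<in> F"
proof -
  interpret M: bimodule R "regular_bimodule R" by (rule regular_bimodule_bimodule)
  have Il: "left_ideal R I" using I by (simp add: essential_left_ideal_def)
  define T where "T = {r \<in> carrier R. left_colon R I r \<in> F}"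
  define N where "N = quotient_bimodule (regular_bimodule R) T"
  have colon: "left_ideal R (left_colon R I r)" if "r \<in> carrier R" for r
    using Il that by (rule left_ideal_colon)
  have sub: "T \<subseteq> carrier R" by (auto simp: T_def)
  have "left_colon R I \<zero> = carrier R" using Il by (auto simp: left_colon_def left_ideal_iff)
  then have zero: "\<zero> \<in> T" using left_gabriel_filter_carrier[OF F] by (simp add: T_def)
  have diff: "x \<ominus> y \<in> T" if "x \<in> T" "y \<in> T" for x y
  proof -
    have xy: "x \<in> carrier R" "y \<in> carrier R" using that sub by auto
    have "left_colon R I x \<inter> left_colon R I y \<in> F"
      using that left_gabriel_filterD(3)[OF F] by (simp add: T_def)
    moreover have "left_colon R I x \<inter> left_colon R I y \<subseteq> left_colon R I (x \<ominus> y)"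
      using Il xy by (auto simp: left_colon_def left_ideal_iff minus_eq r_distr r_minus)
    ultimately show ?thesis
      using left_gabriel_filterD(2)[OF F _ colon] xy by (simp add: T_def)
  qed
  have mult: "r \<otimes> x \<in> T" if "r \<in> carrier R" "x \<in> T" for r x
  proof -
    have x: "x \<in> carrier R" "left_colon R I x \<in> F" using that by (auto simp: T_def)
    have "left_colon R (left_colon R I x) r = left_colon R I (r \<otimes> x)"
      using x that by (auto simp: left_colon_def m_assoc)
    then show ?thesis
      using left_gabriel_filterD(4)[OF F x(2) that(1)] x that by (simp add: T_def)
  qed
  have T: "additive_subgroup T R" using sub zero diff by (simp add: additive_subgroup_iff)
  have IT: "I \<subseteq> T"
  proof
    fix x assume x: "x \<in> I"
    then have xc: "x \<in> carrier R" using left_ideal_subset[OF Il] by auto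
    have "left_colon R I x = carrier R" using Il x by (auto simp: left_colon_def left_ideal_iff)
    then show "x \<in> T" using left_gabriel_filter_carrier[OF F] xc by (simp add: T_def)
  qed
  have N: "left_module R N"
    unfolding N_def by (rule M.quotient_left_module) (use T mult in auto)
  have N_carrier: "carrier N = (\<lambda>x. T +>\<^bsub>regular_bimodule R\<^esub> x) ` carrier R"
    using M.M.rcosets_eq_image[of T] by (simp add: N_def)
  have N_zero: "T +>\<^bsub>regular_bimodule R\<^esub> x = \<zero>\<^bsub>N\<^esub> \<longleftrightarrow> x \<in> T" if "x \<in> carrier R" for x
    using M.M.rcoset_eq_subgroup_iff[of T x] T that by (simp add: N_def)
  have N_mult: "lsmult N a (T +>\<^bsub>regular_bimodule R\<^esub> x) = T +>\<^bsub>regular_bimodule R\<^esub> (a \<otimes> x)"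
    if "a \<in> carrier R" "x \<in> carrier R" for a x
    using M.quotient_lsmult[of T a x] T mult that by (simp add: N_def)
  have N_zero_mem: "\<zero>\<^bsub>N\<^esub> \<in> carrier N" using N_zero[OF zero_closed] zero unfolding N_carrier by (metis imageI zero_closed)
  have "left_torsion N F = {\<zero>\<^bsub>N\<^esub>}"
  proof (intro equalityI subsetI)
    fix n assume "n \<in> left_torsion N F"
    then obtain x J where x: "x \<in> carrier R" "n = T +>\<^bsub>regular_bimodule R\<^esub> x"
      and J: "J \<in> F" "\<forall>a\<in>J. lsmult N a n = \<zero>\<^bsub>N\<^esub>"
      by (auto simp: left_torsion_def N_carrier)
    have Jc: "J \<subseteq> carrier R" using left_gabriel_filterD(1)[OF F J(1)] by (rule left_ideal_subset)
    have "left_colon R (left_colon R I x) a \<in> F" if "a \<in> J" for a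
    proof -
      have a: "a \<in> carrier R" using that Jc by auto
      have "a \<otimes> x \<in> T" using J(2) that x a N_mult[OF a x(1)] N_zero[of "a \<otimes> x"] by simp
      moreover have "left_colon R (left_colon R I x) a = left_colon R I (a \<otimes> x)"
        using x a by (auto simp: left_colon_def m_assoc)
      ultimately show ?thesis by (simp add: T_def)
    qed
    \<comment> \<open>The last Gabriel axiom for the colon ideal of \<open>I\<close> by
      \<open>x\<close> and the member \<open>J\<close>; this is why the quotient by \<open>T\<close>
      has no torsion left.\<close>
    then have "left_colon R I x \<in> F"
      using left_gabriel_filterD(5)[OF F J(1) colon[OF x(1)]] by blast
    then have "x \<in> T" using x by (simp add: T_def)
    then show "n \<in> {\<zero>\<^bsub>N\<^esub>}" using x N_zero by simp
  next
    fix n assume "n \<in> {\<zero>\<^bsub>N\<^esub>}"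
    then show "n \<in> left_torsion N F"
      using N_zero_mem left_gabriel_filter_carrier[OF F] left_module.lsmult_zero[OF N]
      by (auto simp: left_torsion_def)
  qed
  then have ns: "nonsingular_left_module R N" by (rule goldie[OF N])
  \<comment> \<open>The annihilator of the coset of 1 is \<open>T\<close>, which is essential since
    it contains \<open>I\<close>. Nonsingularity then puts 1 into \<open>T\<close>, and by the
    definition of \<open>T\<close> this means that \<open>I\<close> is in the filter.\<close>
  have "{a \<in> carrier R. lsmult N a (T +>\<^bsub>regular_bimodule R\<^esub> \<one>) = \<zero>\<^bsub>N\<^esub>} = T"
    using N_mult[OF _ one_closed] N_zero sub by auto
  moreover have "essential_left_ideal R T"
    unfolding essential_left_ideal_def
  proof (intro conjI allI impI)
    show "left_ideal R T" using sub zero diff mult by (simp add: left_ideal_iff)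
    fix L assume L: "left_ideal R L \<and> L \<noteq> {\<zero>}"
    then have "I \<inter> L \<noteq> {\<zero>}" using I unfolding essential_left_ideal_def by blast
    moreover have "\<zero> \<in> I" "\<zero> \<in> L" using Il L by (auto simp: left_ideal_iff)
    ultimately show "T \<inter> L \<noteq> {\<zero>}" using IT by blast
  qed
  ultimately have "T +>\<^bsub>regular_bimodule R\<^esub> \<one> = \<zero>\<^bsub>N\<^esub>"
    using ns N_carrier unfolding nonsingular_left_module_def by auto
  then have "\<one> \<in> T" using N_zero by simp
  moreover have "left_colon R I \<one> = I" using left_ideal_subset[OF Il] by (auto simp: left_colon_def)
  ultimately show ?thesis by (simp add: T_def)
qed

text \<open>Density with y = x, for a nonzero \<open>x\<close> in \<open>L\<close>, yields a nonzero
  r x in both ideals.\<close>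

lemma dense_essential_left_ideal:
  assumes "dense_left_ideal R I"
  shows "essential_left_ideal R I"
  unfolding essential_left_ideal_def
proof (intro conjI allI impI)
  show Il: "left_ideal R I" using assms by (simp add: dense_left_ideal_def)
  fix L assume L: "left_ideal R L \<and> L \<noteq> {\<zero>}"
  then obtain x where x: "x \<in> L" "x \<noteq> \<zero>" "x \<in> carrier R"
    unfolding left_ideal_iff by blast
  obtain r where "r \<in> carrier R" "r \<otimes> x \<in> I" "r \<otimes> x \<noteq> \<zero>"
    using assms x(3) x(3) x(2) by (rule dense_left_idealE)
  moreover from this have "r \<otimes> x \<in> L" using L x by (simp add: left_ideal_mult)
  ultimately show "I \<inter> L \<noteq> {\<zero>}" by blast
qed

end

lemma opposite_opposite_ring [simp]: "opposite (opposite R) = R"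
  by (simp add: opposite_def)

lemma nonsingular_left_module_opposite:
  "nonsingular_left_module (opposite R) N = nonsingular_right_module R (opposite_module N)"
  by (simp add: nonsingular_left_module_def nonsingular_right_module_def)

lemma (in ring) lambek_goldie:
  assumes G: "goldie_pair R G"
  shows "symmetric_filter R (lambek_pair R) \<subseteq> symmetric_filter R G"
proof (rule symmetric_filter_mono)
  have G': "left_gabriel_filter R (fst G)" "right_gabriel_filter R (snd G)"
    using G by (auto simp: goldie_pair_def gabriel_pair_def)
  show "fst (lambek_pair R) \<subseteq> fst G"
    using G G' essential_left_ideal_mem_goldie[of "fst G"] dense_essential_left_ideal
    by (auto simp: lambek_pair_def goldie_pair_def)
  have "I \<in> snd G" if "dense_right_ideal R I" for I
  proof (rule ring.essential_left_ideal_mem_goldie[OF opposite_ring])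
    show "left_gabriel_filter (opposite R) (snd G)" using G' by simp
    show "essential_left_ideal (opposite R) I"
      using ring.dense_essential_left_ideal[OF opposite_ring, of I] that by simp
    fix N :: "('a, 'a set) bimodule"
    assume N: "left_module (opposite R) N" and tf: "left_torsion N (snd G) = {\<zero>\<^bsub>N\<^esub>}"
    \<comment> \<open>The Goldie property speaks about right modules over \<open>R\<close>, whereas
      \<open>N\<close> is a left module over the opposite ring; swapping the actions translates
      between the two.\<close>
    have "right_module R (opposite_module N)"
      using left_module.right_module_opposite[OF N] by simp
    moreover have "right_torsion (opposite_module N) (snd G) = {\<zero>\<^bsub>opposite_module N\<^esub>}"
      using tf left_torsion_opposite_module[of "opposite_module N" "snd G"] by simp
    ultimately have "nonsingular_right_module R (opposite_module N)"
      using G unfolding goldie_pair_def by blast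
    then show "nonsingular_left_module (opposite R) N" by (simp add: nonsingular_left_module_opposite)
  qed
  then show "snd (lambek_pair R) \<subseteq> snd G" by (auto simp: lambek_pair_def)
qed

section \<open>Torsion-freeness of the ring of quotients of a faithful theory\<close>

lemma (in abelian_group) diff_eq_zero_iff:
  assumes "x \<in> carrier G" "y \<in> carrier G"
  shows "x \<ominus> y = \<zero> \<longleftrightarrow> x = y"
proof
  assume "x \<ominus> y = \<zero>"
  then have "(x \<oplus> \<ominus> y) \<oplus> y = y" using assms by (simp add: a_minus_def)
  then show "x = y" using assms by (simp add: a_assoc l_neg)
qed (use assms in \<open>simp add: diff_self\<close>)

text \<open>Faithfulness is required on each side, because elements of \<open>R\<close> are going to
  be tested by multiplication on one side only, by members of a one-sided filter.\<close>

locale faithful_theory = symmetric_theory R F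
  for R :: "('a, 'c) ring_scheme" (structure) and F :: "'a filter_pair" +
  assumes faithful: "faithful_on_both_sides R F"
begin

sublocale S: symmetric_module R "regular_bimodule R" F
  using regular_bimodule_bimodule gabriel by (rule symmetric_moduleI)

lemma left_faithful:
  assumes "x \<in> carrier R" "I \<in> fst F" "\<And>i. i \<in> I \<Longrightarrow> i \<otimes> x = \<zero>"
  shows "x = \<zero>"
proof -
  have "x \<in> left_torsion (regular_bimodule R) (fst F)" using assms by (auto simp: left_torsion_def)
  then show ?thesis using faithful by (simp add: faithful_on_both_sides_def)
qed

lemma right_faithful:
  assumes "x \<in> carrier R" "J \<in> snd F" "\<And>j. j \<in> J \<Longrightarrow> x \<otimes> j = \<zero>"
  shows "x = \<zero>"
proof -
  have "x \<in> right_torsion (regular_bimodule R) (snd F)" using assms by (auto simp: right_torsion_def)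
  then show ?thesis using faithful by (simp add: faithful_on_both_sides_def)
qed

lemma symmetric_torsion_zero: "symmetric_torsion (regular_bimodule R) F = {\<zero>}"
  using faithful by (auto simp: symmetric_torsion_def faithful_on_both_sides_def)

abbreviation iota :: "'a \<Rightarrow> ('a, 'a) germ" where
  "iota \<equiv> quotient_map R (regular_bimodule R) F"

lemma iota_closed [simp]: "r \<in> carrier R \<Longrightarrow> iota r \<in> carrier S.Q"
  using S.quotient_map_closed[of r] by simp

lemma iota_add: "r \<in> carrier R \<Longrightarrow> s \<in> carrier R \<Longrightarrow> iota (r \<oplus> s) = iota r \<oplus>\<^bsub>S.Q\<^esub> iota s"
  using S.quotient_map_add[of r s] by simp

lemma iota_lsmult: "r \<in> carrier R \<Longrightarrow> s \<in> carrier R \<Longrightarrow> iota (r \<otimes> s) = lsmult S.Q r (iota s)"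
  using S.quotient_map_lsmult[of s r] by simp

lemma iota_rsmult: "r \<in> carrier R \<Longrightarrow> s \<in> carrier R \<Longrightarrow> iota (r \<otimes> s) = rsmult S.Q (iota r) s"
  using S.quotient_map_rsmult[of r s] by simp

lemma iota_zero: "iota \<zero> = \<zero>\<^bsub>S.Q\<^esub>"
  by (rule additive_map_zero[OF abelian_group_axioms S.Q_abelian_group]) (auto simp: iota_add)

text \<open>If the class of \<open>r\<close> vanishes, some member of the symmetric filter
  annihilates the coset of \<open>r\<close>. Since torsion is zero it annihilates \<open>r\<close>,
  which is then torsion itself.\<close>

lemma iota_eq_zero:
  assumes r: "r \<in> carrier R" and 0: "iota r = \<zero>\<^bsub>S.Q\<^esub>"
  shows "r = \<zero>"
proof -
  have rM: "r \<in> carrier (regular_bimodule R)" using r by simp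
  obtain H where H: "H \<in> symmetric_filter R F" "H \<subseteq> carrier E"
    "\<forall>k\<in>H. env_act S.TF (S.proj r) k = \<zero>\<^bsub>S.TF\<^esub>"
    using 0 S.germ_eq_zero_iff[OF S.partial_homs_const[OF S.proj_closed[OF rM]]]
    by (auto simp: quotient_map_def)
  have "env_act (regular_bimodule R) r k = \<zero>" if k: "k \<in> H" for k
  proof -
    have kE: "k \<in> carrier E" using H(2) k by auto
    have "S.proj (env_act (regular_bimodule R) r k) = \<zero>\<^bsub>S.TF\<^esub>"
      using H(3) k S.proj_env_act[OF rM kE] by simp
    then show ?thesis
      using S.proj_eq_zero_iff[OF S.env_act_closed[OF rM kE]] by (simp add: symmetric_torsion_zero)
  qed
  then have "r \<in> symmetric_torsion (regular_bimodule R) F"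
    using S.symmetric_torsionI[OF rM H(1)] by simp
  then show ?thesis by (simp add: symmetric_torsion_zero)
qed

lemma iota_diff: "r \<in> carrier R \<Longrightarrow> s \<in> carrier R \<Longrightarrow> iota (r \<ominus> s) = iota r \<ominus>\<^bsub>S.Q\<^esub> iota s"
  by (rule additive_map_diff[OF abelian_group_axioms S.Q_abelian_group]) (auto simp: iota_add)

lemma iota_inj: "r \<in> carrier R \<Longrightarrow> s \<in> carrier R \<Longrightarrow> iota r = iota s \<Longrightarrow> r = s"
  using iota_eq_zero[of "r \<ominus> s"] iota_diff[of r s] by (simp add: S.Q.M.diff_self diff_eq_zero_iff)

section \<open>Elements of the quotient as pairs of partial one-sided multiplications\<close>

definition right_dom :: "('a, 'a) germ \<Rightarrow> 'a set" where
  "right_dom X = {j \<in> carrier R. \<exists>r\<in>carrier R. rsmult S.Q X j = iota r}"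

definition left_dom :: "('a, 'a) germ \<Rightarrow> 'a set" where
  "left_dom X = {i \<in> carrier R. \<exists>r\<in>carrier R. lsmult S.Q i X = iota r}"

definition right_val :: "('a, 'a) germ \<Rightarrow> 'a \<Rightarrow> 'a" where
  "right_val X j = (THE r. r \<in> carrier R \<and> rsmult S.Q X j = iota r)"

definition left_val :: "('a, 'a) germ \<Rightarrow> 'a \<Rightarrow> 'a" where
  "left_val X i = (THE r. r \<in> carrier R \<and> lsmult S.Q i X = iota r)"

lemma right_val_eq: "r \<in> carrier R \<Longrightarrow> rsmult S.Q X j = iota r \<Longrightarrow> right_val X j = r"
  unfolding right_val_def by (rule the_equality) (auto intro: iota_inj)

lemma left_val_eq: "r \<in> carrier R \<Longrightarrow> lsmult S.Q i X = iota r \<Longrightarrow> left_val X i = r"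
  unfolding left_val_def by (rule the_equality) (auto intro: iota_inj)

lemma right_dom:
  assumes "j \<in> right_dom X"
  shows "j \<in> carrier R" "right_val X j \<in> carrier R" "rsmult S.Q X j = iota (right_val X j)"
proof -
  obtain r where "j \<in> carrier R" "r \<in> carrier R" "rsmult S.Q X j = iota r"
    using assms unfolding right_dom_def by blast
  then show "j \<in> carrier R" "right_val X j \<in> carrier R" "rsmult S.Q X j = iota (right_val X j)"
    using right_val_eq by simp_all
qed

lemma left_dom:
  assumes "i \<in> left_dom X"
  shows "i \<in> carrier R" "left_val X i \<in> carrier R" "lsmult S.Q i X = iota (left_val X i)"
proof -
  obtain r where "i \<in> carrier R" "r \<in> carrier R" "lsmult S.Q i X = iota r"
    using assms unfolding left_dom_def by blast
  then show "i \<in> carrier R" "left_val X i \<in> carrier R" "lsmult S.Q i X = iota (left_val X i)"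
    using left_val_eq by simp_all
qed

lemma right_domI: "j \<in> carrier R \<Longrightarrow> r \<in> carrier R \<Longrightarrow> rsmult S.Q X j = iota r \<Longrightarrow> j \<in> right_dom X"
  unfolding right_dom_def by blast

lemma left_domI: "i \<in> carrier R \<Longrightarrow> r \<in> carrier R \<Longrightarrow> lsmult S.Q i X = iota r \<Longrightarrow> i \<in> left_dom X"
  unfolding left_dom_def by blast

text \<open>The domain \<open>K\<close> of a representative contains j \<otimes> 1 and 1 \<otimes> i
  for \<open>j\<close> and \<open>i\<close> in members of the one-sided filters, and
  \<open>K\<close> multiplies \<open>X\<close> into the image of \<open>R\<close>
  (\<open>qact_eq_quotient_map\<close>).\<close>

lemma dom_in_filter:
  assumes X: "X \<in> carrier S.Q"
  shows "right_dom X \<in> snd F" and "left_dom X \<in> fst F"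
proof -
  obtain K f where f: "(K, f) \<in> partial_homs R (regular_bimodule R) F" "X = S.germ K f"
    using X by (rule S.germ_cases)
  obtain I J where IJ: "I \<in> fst F" "J \<in> snd F" "\<And>j. j \<in> J \<Longrightarrow> pure_tensor R j \<one> \<in> K"
    "\<And>i. i \<in> I \<Longrightarrow> pure_tensor R \<one> i \<in> K"
    using S.partial_homsD(1)[OF f(1)] by (rule symmetric_filterE) blast
  have ex: "\<exists>r\<in>carrier R. S.qact X k = iota r" if k: "k \<in> K" for k
  proof -
    obtain r where "r \<in> carrier (regular_bimodule R)" "f k = S.proj r"
      using S.partial_homsD(2)[OF f(1) k] S.torsionfree_carrier by blast
    then show ?thesis using S.qact_eq_quotient_map[OF f(1) k] f(2) by auto
  qed
  show "right_dom X \<in> snd F"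
  proof (rule right_gabriel_filterD(2)[OF right_gabriel IJ(2)])
    show "J \<subseteq> right_dom X"
      using ex[OF IJ(3)] snd_subset[OF IJ(2)] by (auto simp: right_dom_def S.rsmult_Q)
    show "right_ideal R (right_dom X)"
      unfolding right_ideal_iff
    proof (intro conjI ballI subsetI)
      show "\<zero> \<in> right_dom X"
        using X by (intro right_domI[of _ \<zero>]) (simp_all add: S.Q.zero_rsmult iota_zero)
      fix j assume j: "j \<in> right_dom X"
      show "j \<in> carrier R" using right_dom(1)[OF j] .
      show "j \<ominus> j' \<in> right_dom X" if j': "j' \<in> right_dom X" for j'
        using right_dom[OF j] right_dom[OF j'] X
        by (intro right_domI[of _ "right_val X j \<ominus> right_val X j'"]) (simp_all add: S.Q.diff_rsmult iota_diff)
      show "j \<otimes> r \<in> right_dom X" if r: "r \<in> carrier R" for r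
        using right_dom[OF j] r X
        by (intro right_domI[of _ "right_val X j \<otimes> r"]) (simp_all add: S.Q.rsmult_assoc iota_rsmult)
    qed
  qed
  show "left_dom X \<in> fst F"
  proof (rule left_gabriel_filterD(2)[OF left_gabriel IJ(1)])
    show "I \<subseteq> left_dom X"
      using ex[OF IJ(4)] fst_subset[OF IJ(1)] by (auto simp: left_dom_def S.lsmult_Q)
    show "left_ideal R (left_dom X)"
      unfolding left_ideal_iff
    proof (intro conjI ballI subsetI)
      show "\<zero> \<in> left_dom X"
        using X by (intro left_domI[of _ \<zero>]) (simp_all add: S.Q.zero_lsmult iota_zero)
      fix j assume j: "j \<in> left_dom X"
      show "j \<in> carrier R" using left_dom(1)[OF j] .
      show "j \<ominus> j' \<in> left_dom X" if j': "j' \<in> left_dom X" for j'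
        using left_dom[OF j] left_dom[OF j'] X
        by (intro left_domI[of _ "left_val X j \<ominus> left_val X j'"]) (simp_all add: S.Q.diff_lsmult iota_diff)
      show "r \<otimes> j \<in> left_dom X" if r: "r \<in> carrier R" for r
        using left_dom[OF j] r X
        by (intro left_domI[of _ "r \<otimes> left_val X j"]) (simp_all add: S.Q.lsmult_assoc iota_lsmult)
    qed
  qed
qed

text \<open>Vanishing on the right forces vanishing on the left: if i X is the image of
  \<open>r\<close>, then r j = i (X j) = 0 for all \<open>j\<close> in \<open>J\<close>, so r = 0 by
  right faithfulness. Hence the kernel of a representative contains both kinds of generators and is
  a member of the filter. Equality in the quotient can therefore be tested by right multiplications
  alone.\<close>

lemma right_torsionfree_zero:
  assumes X: "X \<in> carrier S.Q" and J: "J \<in> snd F" and 0: "\<And>j. j \<in> J \<Longrightarrow> rsmult S.Q X j = \<zero>\<^bsub>S.Q\<^esub>"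
  shows "X = \<zero>\<^bsub>S.Q\<^esub>"
proof -
  obtain K f where f: "(K, f) \<in> partial_homs R (regular_bimodule R) F" "X = S.germ K f"
    using X by (rule S.germ_cases)
  note f' = S.partial_homsD[OF f(1)]
  obtain I J' where IJ: "I \<in> fst F" "J' \<in> snd F" "\<And>j. j \<in> J' \<Longrightarrow> pure_tensor R j \<one> \<in> K"
    "\<And>i. i \<in> I \<Longrightarrow> pure_tensor R \<one> i \<in> K"
    using f'(1) by (rule symmetric_filterE) blast
  let ?H = "{k \<in> K. f k = \<zero>\<^bsub>S.TF\<^esub>}"
  have val: "\<exists>r\<in>carrier R. f k = S.proj r \<and> S.qact X k = iota r" if k: "k \<in> K" for k
  proof -
    obtain r where "r \<in> carrier (regular_bimodule R)" "f k = S.proj r"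
      using f'(2)[OF k] S.torsionfree_carrier by blast
    then show ?thesis using S.qact_eq_quotient_map[OF f(1) k] f(2) by auto
  qed
  have proj0: "S.proj \<zero> = \<zero>\<^bsub>S.TF\<^esub>"
    using S.proj_eq_zero_iff[of \<zero>] by (simp add: symmetric_torsion_zero)
  have "?H \<in> symmetric_filter R F"
  proof (rule symmetric_filterI[OF _ IJ(1)])
    show "right_ideal E ?H"
      unfolding E.right_ideal_iff
      using f' S.partial_homs_diff[OF f(1) f'(9) f'(9)] S.N.M.diff_self
        S.partial_homs_diff[OF f(1)]
      by (auto simp: S.N.env_act_zero_left E.diff_self)
    show "J \<inter> J' \<in> snd F" using J IJ(2) by (rule right_gabriel_filterD(3)[OF right_gabriel])
    fix j assume j: "j \<in> J \<inter> J'"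
    obtain r where r: "r \<in> carrier R" "f (pure_tensor R j \<one>) = S.proj r"
      "S.qact X (pure_tensor R j \<one>) = iota r"
      using val[OF IJ(3)] j by blast
    then have "r = \<zero>" using 0[of j] j iota_eq_zero by (simp add: S.rsmult_Q)
    then show "pure_tensor R j \<one> \<in> ?H" using r(2) j IJ(3) proj0 by simp
  next
    fix i assume i: "i \<in> I"
    obtain r where r: "r \<in> carrier R" "f (pure_tensor R \<one> i) = S.proj r"
      "S.qact X (pure_tensor R \<one> i) = iota r"
      using val[OF IJ(4)] i by blast
    have ic: "i \<in> carrier R" using fst_subset[OF IJ(1) i] .
    have "r \<otimes> j = \<zero>" if j: "j \<in> J" for j
    proof -
      have jc: "j \<in> carrier R" using snd_subset[OF J j] .
      have "iota (r \<otimes> j) = rsmult S.Q (lsmult S.Q i X) j"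
        using r jc by (simp add: iota_rsmult S.lsmult_Q)
      also have "\<dots> = lsmult S.Q i (rsmult S.Q X j)"
        using ic jc X by (rule S.Q.lsmult_rsmult)
      also have "\<dots> = \<zero>\<^bsub>S.Q\<^esub>" using 0[OF j] S.Q.lsmult_zero[OF ic] by simp
      finally show ?thesis using r(1) jc by (simp add: iota_eq_zero)
    qed
    then have "r = \<zero>" using r(1) J by (rule right_faithful[rotated 2])
    then show "pure_tensor R \<one> i \<in> ?H" using r(2) i IJ(4) proj0 by simp
  qed
  then show ?thesis
    unfolding f(2) S.germ_eq_zero_iff[OF f(1)] by (intro bexI[of _ ?H]) auto
qed

lemma right_torsionfree:
  assumes X: "X \<in> carrier S.Q" and Y: "Y \<in> carrier S.Q" and J: "J \<in> snd F"
    and eq: "\<And>j. j \<in> J \<Longrightarrow> rsmult S.Q X j = rsmult S.Q Y j"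
  shows "X = Y"
proof -
  have "X \<ominus>\<^bsub>S.Q\<^esub> Y = \<zero>\<^bsub>S.Q\<^esub>"
  proof (rule right_torsionfree_zero[OF _ J])
    fix j assume j: "j \<in> J"
    then have jc: "j \<in> carrier R" using snd_subset[OF J] by blast
    show "rsmult S.Q (X \<ominus>\<^bsub>S.Q\<^esub> Y) j = \<zero>\<^bsub>S.Q\<^esub>"
      using eq[OF j] X Y jc by (simp add: S.Q.rsmult_diff S.Q.M.diff_self)
  qed (use X Y in simp)
  then show ?thesis using X Y S.Q.M.diff_eq_zero_iff by simp
qed

end

section \<open>Compatible pairs\<close>

locale compatible_pair = faithful_theory R F
  for R :: "('a, 'c) ring_scheme" (structure) and F :: "'a filter_pair" +
  fixes I J :: "'a set" and f g :: "'a \<Rightarrow> 'a"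
  assumes I: "I \<in> fst F" and J: "J \<in> snd F"
    and f_closed: "\<And>i. i \<in> I \<Longrightarrow> f i \<in> carrier R"
    and f_add: "\<And>i i'. i \<in> I \<Longrightarrow> i' \<in> I \<Longrightarrow> f (i \<oplus> i') = f i \<oplus> f i'"
    and f_mult: "\<And>r i. r \<in> carrier R \<Longrightarrow> i \<in> I \<Longrightarrow> f (r \<otimes> i) = r \<otimes> f i"
    and g_closed: "\<And>j. j \<in> J \<Longrightarrow> g j \<in> carrier R"
    and compatible: "\<And>i j. i \<in> I \<Longrightarrow> j \<in> J \<Longrightarrow> f i \<otimes> j = i \<otimes> g j"
begin

text \<open>For the element \<open>x\<close> to be constructed and p = (r, s), the intended value is
  v s x r = f (v s) r. The value \<open>\<zero>\<close> outside of \<open>I\<close> is a default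
  that keeps the function total; it breaks additivity in \<open>s\<close> for unsuitable
  \<open>v\<close>.\<close>

definition weight :: "'a \<Rightarrow> 'a \<times> 'a \<Rightarrow> 'a" where
  "weight v p = (if v \<otimes> snd p \<in> I then f (v \<otimes> snd p) else \<zero>) \<otimes> fst p"

lemma weight_closed: "v \<in> carrier R \<Longrightarrow> weight v \<in> RR \<rightarrow> carrier R"
  by (auto simp: weight_def f_closed)

text \<open>If the pair is \<open>(f, g)\<close> with \<open>f i = i x\<close> and \<open>g j = x j\<close>, then \<open>weighted_sum v u\<close> is
  \<open>v (x u)\<close> for all \<open>v\<close> in a member of the filter, so \<open>evaluates t n\<close> says \<open>x t = n\<close>. The
  tensor \<open>t\<close> involves only finitely many elements of \<open>R\<close>, which \<open>v\<close> multiplies into \<open>I\<close>.\<close>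

abbreviation weighted_sum :: "'a \<Rightarrow> ('a \<times> 'a \<Rightarrow>\<^sub>0 int) \<Rightarrow> 'a" where
  "weighted_sum v u \<equiv> frag_sum R (weight v) u"

definition evaluates :: "'a tensor \<Rightarrow> 'a \<Rightarrow> bool" where
  "evaluates t n \<longleftrightarrow> n \<in> carrier R \<and> (\<exists>u. Poly_Mapping.keys u \<subseteq> RR \<and> t = tensor_class R u \<and>
     (\<exists>V\<in>fst F. \<forall>v\<in>V. v \<otimes> n = weighted_sum v u))"

lemma evaluatesI:
  assumes "n \<in> carrier R" "Poly_Mapping.keys u \<subseteq> RR" "t = tensor_class R u" "V \<in> fst F"
    "\<And>v. v \<in> V \<Longrightarrow> v \<otimes> n = weighted_sum v u"
  shows "evaluates t n"
  unfolding evaluates_def using assms by blast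

lemma evaluatesE:
  assumes "evaluates t n"
  obtains u V where "n \<in> carrier R" "Poly_Mapping.keys u \<subseteq> RR" "t = tensor_class R u" "V \<in> fst F"
    "\<And>v. v \<in> V \<Longrightarrow> v \<otimes> n = weighted_sum v u"
  using assms unfolding evaluates_def by blast

lemma fst_inter: "V \<in> fst F \<Longrightarrow> W \<in> fst F \<Longrightarrow> V \<inter> W \<in> fst F"
  by (rule left_gabriel_filterD(3)[OF left_gabriel])

lemma fst_colon: "V \<in> fst F \<Longrightarrow> a \<in> carrier R \<Longrightarrow> left_colon R V a \<in> fst F"
  by (rule left_gabriel_filterD(4)[OF left_gabriel])

lemma fst_carrier: "carrier R \<in> fst F"
  by (rule left_gabriel_filter_carrier[OF left_gabriel])

text \<open>The weight is additive in the first coordinate for every \<open>v\<close>, but in the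
  second only if \<open>v\<close> multiplies both entries into \<open>I\<close>. So the sum vanishes
  merely on a member depending on \<open>u\<close>, an intersection of finitely many colon ideals,
  and this is why \<open>evaluates\<close> quantifies over members.\<close>

lemma weighted_sum_relation:
  assumes "u \<in> bilinear_ideal R"
  shows "\<exists>V\<in>fst F. \<forall>v\<in>V. weighted_sum v u = \<zero>"
  using assms
proof (induction rule: bilinear_ideal_induct)
  case zero
  then show ?case using fst_carrier by auto
next
  case (left r r' s)
  show ?case
  proof (intro bexI[OF _ fst_carrier] ballI)
    fix v assume v: "v \<in> carrier R"
    have c: "weight v (r, s) \<in> carrier R" "weight v (r', s) \<in> carrier R" "weight v (r \<oplus> r', s) \<in> carrier R"
      using funcset_mem[OF weight_closed[OF v]] left by auto
    have "weight v (r \<oplus> r', s) = weight v (r, s) \<oplus> weight v (r', s)"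
      using v left by (auto simp: weight_def f_closed r_distr)
    then show "weighted_sum v (frag_of (r \<oplus> r', s) - frag_of (r, s) - frag_of (r', s)) = \<zero>"
      using left c by (simp add: frag_sum_diff[OF weight_closed[OF v]] keys_diff_subset keys_frag_of)
        (simp add: a_minus_def a_ac r_neg r_neg2 r_neg1)
  qed
next
  case (right r s s')
  show ?case
  proof (intro bexI[OF _ fst_inter[OF fst_colon[OF I right(2)] fst_colon[OF I right(3)]]] ballI)
    fix v assume "v \<in> left_colon R I s \<inter> left_colon R I s'"
    then have v: "v \<in> carrier R" "v \<otimes> s \<in> I" "v \<otimes> s' \<in> I" by (auto simp: left_colon_def)
    have vs: "v \<otimes> (s \<oplus> s') = v \<otimes> s \<oplus> v \<otimes> s'" using v right by (simp add: r_distr)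
    moreover have "v \<otimes> s \<oplus> v \<otimes> s' \<in> I"
      using left_gabriel_filterD(1)[OF left_gabriel I] v(2,3)
      by (simp add: left_ideal_def additive_subgroup.a_closed)
    ultimately have "weight v (r, s \<oplus> s') = weight v (r, s) \<oplus> weight v (r, s')"
      using v right by (simp add: weight_def f_add f_closed l_distr)
    moreover have "weight v (r, s) \<in> carrier R" "weight v (r, s') \<in> carrier R" "weight v (r, s \<oplus> s') \<in> carrier R"
      using funcset_mem[OF weight_closed[OF v(1)]] right by auto
    ultimately show "weighted_sum v (frag_of (r, s \<oplus> s') - frag_of (r, s) - frag_of (r, s')) = \<zero>"
      using right by (simp add: frag_sum_diff[OF weight_closed[OF v(1)]] keys_diff_subset keys_frag_of)
        (simp add: a_minus_def a_ac r_neg r_neg2 r_neg1)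
  qed
next
  case (diff u w)
  then obtain V W where VW: "V \<in> fst F" "\<forall>v\<in>V. weighted_sum v u = \<zero>" "W \<in> fst F" "\<forall>v\<in>W. weighted_sum v w = \<zero>"
    by blast
  show ?case
  proof (intro bexI[OF _ fst_inter[OF VW(1,3)]] ballI)
    fix v assume v: "v \<in> V \<inter> W"
    then have vc: "v \<in> carrier R" using fst_subset[OF VW(1)] by blast
    show "weighted_sum v (u - w) = \<zero>"
      using v VW diff by (simp add: frag_sum_diff[OF weight_closed[OF vc]] diff_self)
  qed
qed

text \<open>Two representatives of a tensor differ by an element of the bilinear ideal, so v (n - m)
  = 0 for all \<open>v\<close> in some member of the left filter, and left faithfulness
  applies.\<close>

lemma evaluates_unique:
  assumes n: "evaluates t n" and m: "evaluates t m"
  shows "n = m"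
proof -
  obtain u V where u: "n \<in> carrier R" "Poly_Mapping.keys u \<subseteq> RR" "t = tensor_class R u" "V \<in> fst F"
    "\<And>v. v \<in> V \<Longrightarrow> v \<otimes> n = weighted_sum v u"
    using n by (rule evaluatesE) blast
  obtain w W where w: "m \<in> carrier R" "Poly_Mapping.keys w \<subseteq> RR" "t = tensor_class R w" "W \<in> fst F"
    "\<And>v. v \<in> W \<Longrightarrow> v \<otimes> m = weighted_sum v w"
    using m by (rule evaluatesE) blast
  have "tensor_class R (u - w) = \<zero>\<^bsub>E\<^esub>"
    using u(2,3) w(2,3) by (simp add: tensor_class_diff E.diff_self tensor_class_closed)
  then have "u - w \<in> bilinear_ideal R"
    using u(2) w(2) by (intro tensor_class_eq_0) (simp_all add: keys_diff_subset)
  then obtain V' where V': "V' \<in> fst F" "\<forall>v\<in>V'. weighted_sum v (u - w) = \<zero>"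
    using weighted_sum_relation by blast
  have "n \<ominus> m = \<zero>"
  proof (rule left_faithful[OF _ fst_inter[OF V'(1) fst_inter[OF u(4) w(4)]]])
    fix v assume v: "v \<in> V' \<inter> (V \<inter> W)"
    then have vc: "v \<in> carrier R" using fst_subset[OF V'(1)] by blast
    have "v \<otimes> (n \<ominus> m) = weighted_sum v u \<ominus> weighted_sum v w"
      using u(1,5) w(1,5) v vc by (simp add: minus_eq r_distr r_minus)
    also have "\<dots> = weighted_sum v (u - w)"
      using u(2) w(2) by (simp add: frag_sum_diff[OF weight_closed[OF vc]])
    finally show "v \<otimes> (n \<ominus> m) = \<zero>" using V'(2) v by simp
  qed (use u w in simp)
  then show ?thesis using u(1) w(1) by (simp add: diff_eq_zero_iff)
qed

lemma evaluates_closed: "evaluates t n \<Longrightarrow> t \<in> carrier E" "evaluates t n \<Longrightarrow> n \<in> carrier R"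
  by (auto simp: evaluates_def tensor_class_closed)

lemma evaluates_zero: "evaluates \<zero>\<^bsub>E\<^esub> \<zero>"
  by (rule evaluatesI[of _ 0, OF _ _ _ fst_carrier]) (auto simp: tensor_class_0)

lemma evaluates_add_diff:
  assumes n: "evaluates s n" and m: "evaluates t m"
  shows "evaluates (s \<oplus>\<^bsub>E\<^esub> t) (n \<oplus> m)" "evaluates (s \<ominus>\<^bsub>E\<^esub> t) (n \<ominus> m)"
proof -
  obtain u V where u: "n \<in> carrier R" "Poly_Mapping.keys u \<subseteq> RR" "s = tensor_class R u" "V \<in> fst F"
    "\<And>v. v \<in> V \<Longrightarrow> v \<otimes> n = weighted_sum v u"
    using n by (rule evaluatesE) blast
  obtain w W where w: "m \<in> carrier R" "Poly_Mapping.keys w \<subseteq> RR" "t = tensor_class R w" "W \<in> fst F"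
    "\<And>v. v \<in> W \<Longrightarrow> v \<otimes> m = weighted_sum v w"
    using m by (rule evaluatesE) blast
  have vc: "v \<in> carrier R" if "v \<in> V \<inter> W" for v using that fst_subset[OF u(4)] by blast
  show "evaluates (s \<oplus>\<^bsub>E\<^esub> t) (n \<oplus> m)"
    by (rule evaluatesI[of _ "u + w", OF _ _ _ fst_inter[OF u(4) w(4)]])
      (use u w in \<open>simp_all add: keys_add_subset tensor_class_add frag_sum_add[OF weight_closed[OF vc]]
        r_distr vc\<close>)
  show "evaluates (s \<ominus>\<^bsub>E\<^esub> t) (n \<ominus> m)"
    by (rule evaluatesI[of _ "u - w", OF _ _ _ fst_inter[OF u(4) w(4)]])
      (use u w in \<open>simp_all add: keys_diff_subset tensor_class_diff frag_sum_diff[OF weight_closed[OF vc]]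
        minus_eq r_distr r_minus vc\<close>)
qed

text \<open>Multiplication by a \<otimes> b turns (r, s) into (r a, b s). Associativity moves
  \<open>b\<close> over to \<open>v\<close>, so that the same test for membership in
  \<open>I\<close> is made on both sides, and \<open>a\<close> comes out on the right.\<close>

lemma weighted_sum_mult:
  assumes "Poly_Mapping.keys u \<subseteq> RR" and ab: "a \<in> carrier R" "b \<in> carrier R" and v: "v \<in> carrier R"
  shows "weighted_sum v (frag_mult R u (frag_of (a, b))) = weighted_sum (v \<otimes> b) u \<otimes> a"
proof -
  have vb: "v \<otimes> b \<in> carrier R" using v ab by simp
  have "Poly_Mapping.keys u \<subseteq> RR \<and>
      weighted_sum v (frag_mult R u (frag_of (a, b))) = weighted_sum (v \<otimes> b) u \<otimes> a"
    using assms(1)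
  proof (induction u rule: frag_induction)
    case zero
    then show ?case using ab by simp
  next
    case (one p)
    then obtain r s where p: "p = (r, s)" "r \<in> carrier R" "s \<in> carrier R" by auto
    have c: "weight (v \<otimes> b) (r, s) \<in> carrier R" "weight v (r \<otimes> a, b \<otimes> s) \<in> carrier R"
      using funcset_mem[OF weight_closed[OF vb]] funcset_mem[OF weight_closed[OF v]] p ab by auto
    have "weight v (r \<otimes> a, b \<otimes> s) = weight (v \<otimes> b) (r, s) \<otimes> a"
      using p ab v f_closed by (simp add: weight_def m_assoc)
    then show ?case using p c by (simp add: pair_mult_def keys_frag_of)
  next
    case (diff w w')
    have k: "Poly_Mapping.keys (frag_mult R w (frag_of (a, b))) \<subseteq> RR"
      "Poly_Mapping.keys (frag_mult R w' (frag_of (a, b))) \<subseteq> RR"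
      using diff ab by (simp_all add: frag_mult_closed keys_frag_of)
    show ?case
      using diff k ab frag_sum_closed[OF weight_closed[OF vb]]
      by (simp add: frag_mult_diff_left frag_sum_diff[OF weight_closed[OF v]]
          frag_sum_diff[OF weight_closed[OF vb]] keys_diff_subset minus_eq l_distr l_minus)
  qed
  then show ?thesis by simp
qed

lemma evaluates_pure:
  assumes n: "evaluates t n" and ab: "a \<in> carrier R" "b \<in> carrier R"
  shows "evaluates (t \<otimes>\<^bsub>E\<^esub> pure_tensor R a b) (b \<otimes> (n \<otimes> a))"
proof -
  obtain u V where u: "n \<in> carrier R" "Poly_Mapping.keys u \<subseteq> RR" "t = tensor_class R u" "V \<in> fst F"
    "\<And>v. v \<in> V \<Longrightarrow> v \<otimes> n = weighted_sum v u"
    using n by (rule evaluatesE) blast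
  show ?thesis
  proof (rule evaluatesI[of _ "frag_mult R u (frag_of (a, b))", OF _ _ _ fst_colon[OF u(4) ab(2)]])
    show "Poly_Mapping.keys (frag_mult R u (frag_of (a, b))) \<subseteq> RR"
      using u(2) ab by (intro frag_mult_closed) (simp_all add: keys_frag_of)
    show "t \<otimes>\<^bsub>E\<^esub> pure_tensor R a b = tensor_class R (frag_mult R u (frag_of (a, b)))"
      using u(2,3) ab by (simp add: tensor_class_mult keys_frag_of pure_tensor_eq)
    fix v assume "v \<in> left_colon R V b"
    then have v: "v \<in> carrier R" "v \<otimes> b \<in> V" by (auto simp: left_colon_def)
    have "v \<otimes> (b \<otimes> (n \<otimes> a)) = (v \<otimes> b \<otimes> n) \<otimes> a" using v ab u(1) by (simp add: m_assoc)
    then show "v \<otimes> (b \<otimes> (n \<otimes> a)) = weighted_sum v (frag_mult R u (frag_of (a, b)))"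
      using weighted_sum_mult[OF u(2) ab v(1)] u(5)[OF v(2)] by simp
  qed (use u ab in simp)
qed

lemma evaluates_mult:
  assumes n: "evaluates t n" and e: "e \<in> carrier E"
  shows "evaluates (t \<otimes>\<^bsub>E\<^esub> e) (env_act (regular_bimodule R) n e)"
  using e
proof (induction rule: env_ring_induct)
  have nc: "n \<in> carrier (regular_bimodule R)" and tc: "t \<in> carrier E"
    using evaluates_closed[OF n] by auto
  {
    case zero
    then show ?case using tc S.env_act_zero[OF nc] evaluates_zero by simp
  next
    case (pure a b)
    then show ?case using evaluates_pure[OF n pure] S.env_act_pure[OF nc pure] by simp
  next
    case (diff a b)
    have "env_act (regular_bimodule R) n (a \<ominus>\<^bsub>E\<^esub> b) =
        env_act (regular_bimodule R) n a \<ominus> env_act (regular_bimodule R) n b"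
      using additive_map_diff[OF E.abelian_group_axioms abelian_group_axioms, of "env_act (regular_bimodule R) n" a b]
        diff S.env_act_closed[OF nc] S.env_act_add[OF nc] by simp
    then show ?case
      using evaluates_add_diff(2)[OF diff(3,4)] diff(1,2) tc
      by (simp add: E.minus_eq E.r_distr E.r_minus)
  }
qed

text \<open>The place where compatibility enters: for \<open>v\<close> in \<open>I\<close> the
  weighted sum is f v \<cdot> j, which has to be v \<cdot> g j.\<close>

lemma evaluates_right: "j \<in> J \<Longrightarrow> evaluates (pure_tensor R j \<one>) (g j)"
proof -
  assume j: "j \<in> J"
  then have jc: "j \<in> carrier R" using snd_subset[OF J] by blast
  show ?thesis
  proof (rule evaluatesI[of _ "frag_of (j, \<one>)", OF _ _ _ I])
    fix v assume v: "v \<in> I"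
    then have vc: "v \<in> carrier R" using fst_subset[OF I] by blast
    have w: "weight v (j, \<one>) = f v \<otimes> j" using v vc by (simp add: weight_def)
    have "weighted_sum v (frag_of (j, \<one>)) = f v \<otimes> j"
      using f_closed[OF v] jc by (subst frag_sum_of) (simp_all add: w)
    then show "v \<otimes> g j = weighted_sum v (frag_of (j, \<one>))" using compatible[OF v j] by simp
  qed (use jc g_closed[OF j] in \<open>simp_all add: keys_frag_of pure_tensor_eq\<close>)
qed

lemma evaluates_left: "i \<in> I \<Longrightarrow> evaluates (pure_tensor R \<one> i) (f i)"
proof -
  assume i: "i \<in> I"
  then have ic: "i \<in> carrier R" using fst_subset[OF I] by blast
  show ?thesis
  proof (rule evaluatesI[of _ "frag_of (\<one>, i)", OF _ _ _ fst_carrier])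
    fix v assume v: "v \<in> carrier R"
    have "v \<otimes> i \<in> I" using left_gabriel_filterD(1)[OF left_gabriel I] i v by (rule left_ideal_mult)
    then have w: "weight v (\<one>, i) = v \<otimes> f i" using v i f_closed[OF i] by (simp add: weight_def f_mult)
    have "weighted_sum v (frag_of (\<one>, i)) = v \<otimes> f i"
      using f_closed[OF i] v by (subst frag_sum_of) (simp_all add: w)
    then show "v \<otimes> f i = weighted_sum v (frag_of (\<one>, i))" by simp
  qed (use ic f_closed[OF i] in \<open>simp_all add: keys_frag_of pure_tensor_eq\<close>)
qed

text \<open>The tensors having a value form a right ideal that contains the generators coming from
  \<open>I\<close> and \<open>J\<close>, hence a member of the filter. By uniqueness of values,
  evaluation is a homomorphism on it, and its germ is the required element.\<close>

lemma realization:
  "\<exists>x\<in>carrier S.Q. (\<forall>j\<in>J. rsmult S.Q x j = iota (g j)) \<and> (\<forall>i\<in>I. lsmult S.Q i x = iota (f i))"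
proof -
  let ?K = "{t. \<exists>n. evaluates t n}" and ?\<phi> = "\<lambda>t. S.proj (THE n. evaluates t n)"
  have the: "(THE n. evaluates t n) = n" if "evaluates t n" for t n
    using that evaluates_unique by (intro the_equality)
  have "right_ideal E ?K"
    unfolding E.right_ideal_iff
  proof (intro conjI ballI subsetI)
    show "t \<in> carrier E" if "t \<in> ?K" for t using that evaluates_closed by auto
    show "\<zero>\<^bsub>E\<^esub> \<in> ?K" using evaluates_zero by auto
    show "s \<ominus>\<^bsub>E\<^esub> t \<in> ?K" if "s \<in> ?K" "t \<in> ?K" for s t
      using that evaluates_add_diff(2) by blast
    show "t \<otimes>\<^bsub>E\<^esub> e \<in> ?K" if "t \<in> ?K" "e \<in> carrier E" for t e
      using that evaluates_mult by blast
  qed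
  then have K: "?K \<in> symmetric_filter R F"
    using evaluates_left evaluates_right by (intro symmetric_filterI[OF _ I J]) auto
  have \<phi>: "(?K, ?\<phi>) \<in> partial_homs R (regular_bimodule R) F"
  proof (rule S.partial_homsI[OF K])
    fix k assume "k \<in> ?K"
    then obtain n where n: "evaluates k n" by blast
    have nc: "n \<in> carrier (regular_bimodule R)" using evaluates_closed(2)[OF n] by simp
    show "?\<phi> k \<in> carrier S.TF" unfolding the[OF n] using nc by (rule S.proj_closed)
    show "?\<phi> (k \<otimes>\<^bsub>E\<^esub> e) = env_act S.TF (?\<phi> k) e" if e: "e \<in> carrier E" for e
      unfolding the[OF n] the[OF evaluates_mult[OF n e]] using S.proj_env_act[OF nc e] by simp
    fix l assume "l \<in> ?K"
    then obtain m where m: "evaluates l m" by blast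
    have mc: "m \<in> carrier (regular_bimodule R)" using evaluates_closed(2)[OF m] by simp
    show "?\<phi> (k \<oplus>\<^bsub>E\<^esub> l) = ?\<phi> k \<oplus>\<^bsub>S.TF\<^esub> ?\<phi> l"
      unfolding the[OF n] the[OF m] the[OF evaluates_add_diff(1)[OF n m]]
      using S.proj_add[OF nc mc] by simp
  qed
  have val: "S.qact (S.germ ?K ?\<phi>) t = iota n" if "evaluates t n" for t n
    using that evaluates_closed(2)[OF that] the[OF that]
    by (intro S.qact_eq_quotient_map[OF \<phi>]) auto
  show ?thesis
  proof (intro bexI conjI ballI)
    show "S.germ ?K ?\<phi> \<in> carrier S.Q" using \<phi> by (rule S.germ_closed)
    show "rsmult S.Q (S.germ ?K ?\<phi>) j = iota (g j)" if "j \<in> J" for j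
      using val[OF evaluates_right[OF that]] by (simp only: S.rsmult_Q)
    show "lsmult S.Q i (S.germ ?K ?\<phi>) = iota (f i)" if "i \<in> I" for i
      using val[OF evaluates_left[OF that]] by (simp only: S.lsmult_Q)
  qed
qed

end

section \<open>The symmetric ring of quotients as a ring\<close>

text \<open>The colon ideal of the preimage by \<open>i\<close> contains the colon ideal of
  \<open>I\<close> by \<phi> i, because r i has image r \<phi> i. The last Gabriel axiom then lifts
  membership from \<open>D\<close> to the preimage.\<close>

lemma (in ring) left_gabriel_filter_preimage:
  assumes F: "left_gabriel_filter R F" and D: "D \<in> F" and I: "I \<in> F"
    and closed: "\<And>i. i \<in> D \<Longrightarrow> \<phi> i \<in> carrier R"
    and diff: "\<And>i j. i \<in> D \<Longrightarrow> j \<in> D \<Longrightarrow> \<phi> (i \<ominus> j) = \<phi> i \<ominus> \<phi> j"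
    and mult: "\<And>r i. r \<in> carrier R \<Longrightarrow> i \<in> D \<Longrightarrow> \<phi> (r \<otimes> i) = r \<otimes> \<phi> i"
  shows "{i \<in> D. \<phi> i \<in> I} \<in> F"
proof (rule left_gabriel_filterD(5)[OF F D])
  note I' = left_gabriel_filterD(1)[OF F I, unfolded left_ideal_iff]
  note D' = left_gabriel_filterD(1)[OF F D, unfolded left_ideal_iff]
  have Dc: "i \<in> carrier R" if "i \<in> D" for i using D' that by blast
  have zero: "\<phi> \<zero> = \<zero>"
    using diff[of \<zero> \<zero>] closed[of \<zero>] D' by (simp add: diff_self[of \<zero>] diff_self[of "\<phi> \<zero>"])
  show l: "left_ideal R {i \<in> D. \<phi> i \<in> I}"
    unfolding left_ideal_iff
  proof (intro conjI ballI subsetI)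
    show "\<zero> \<in> {i \<in> D. \<phi> i \<in> I}" using D' I' zero by simp
    fix i assume i: "i \<in> {i \<in> D. \<phi> i \<in> I}"
    then show "i \<in> carrier R" using Dc by blast
    show "i \<ominus> j \<in> {i \<in> D. \<phi> i \<in> I}" if "j \<in> {i \<in> D. \<phi> i \<in> I}" for j
      using i that D' I' diff by simp
    show "r \<otimes> i \<in> {i \<in> D. \<phi> i \<in> I}" if "r \<in> carrier R" for r
      using i that D' I' mult by simp
  qed
  fix i assume i: "i \<in> D"
  show "left_colon R {i \<in> D. \<phi> i \<in> I} i \<in> F"
  proof (rule left_gabriel_filterD(2)[OF F left_gabriel_filterD(4)[OF F I closed[OF i]]])
    show "left_ideal R (left_colon R {i \<in> D. \<phi> i \<in> I} i)" using l Dc[OF i] by (rule left_ideal_colon)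
    show "left_colon R I (\<phi> i) \<subseteq> left_colon R {i \<in> D. \<phi> i \<in> I} i"
      using i D' mult by (auto simp: left_colon_def)
  qed
qed

lemma (in ring) right_gabriel_filter_preimage:
  assumes "right_gabriel_filter R F" "D \<in> F" "I \<in> F"
    and "\<And>i. i \<in> D \<Longrightarrow> \<phi> i \<in> carrier R"
    and "\<And>i j. i \<in> D \<Longrightarrow> j \<in> D \<Longrightarrow> \<phi> (i \<ominus> j) = \<phi> i \<ominus> \<phi> j"
    and "\<And>r i. r \<in> carrier R \<Longrightarrow> i \<in> D \<Longrightarrow> \<phi> (i \<otimes> r) = \<phi> i \<otimes> r"
  shows "{i \<in> D. \<phi> i \<in> I} \<in> F"
  using ring.left_gabriel_filter_preimage[OF opposite_ring, of F D I \<phi>] assms by simp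

context faithful_theory
begin

abbreviation RQ where "RQ \<equiv> ring_of_quotients R F"

text \<open>The property inside the description that defines the product of
  \<open>ring_of_quotients\<close>, named so that existence and uniqueness can be stated.\<close>

definition is_product :: "('a, 'a) germ \<Rightarrow> ('a, 'a) germ \<Rightarrow> ('a, 'a) germ \<Rightarrow> bool" where
  "is_product p q x \<longleftrightarrow> x \<in> carrier S.Q \<and>
     (\<forall>j\<in>carrier R. \<forall>r\<in>carrier R. rsmult S.Q q j = iota r \<longrightarrow> rsmult S.Q x j = rsmult S.Q p r) \<and>
     (\<forall>i\<in>carrier R. \<forall>r\<in>carrier R. lsmult S.Q i p = iota r \<longrightarrow> lsmult S.Q i x = lsmult S.Q r q)"

lemma RQ_simps [simp]:
  "carrier RQ = carrier S.Q" "\<zero>\<^bsub>RQ\<^esub> = \<zero>\<^bsub>S.Q\<^esub>" "ring.add RQ = ring.add S.Q" "\<one>\<^bsub>RQ\<^esub> = iota \<one>"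
  "p \<otimes>\<^bsub>RQ\<^esub> q = (THE x. is_product p q x)"
  by (simp_all add: ring_of_quotients_def Let_def is_product_def)

lemma left_val_add:
  "i \<in> left_dom X \<Longrightarrow> i' \<in> left_dom X \<Longrightarrow> X \<in> carrier S.Q \<Longrightarrow>
     left_val X (i \<oplus> i') = left_val X i \<oplus> left_val X i'"
  using left_dom[of i X] left_dom[of i' X]
  by (intro left_val_eq) (simp_all add: S.Q.lsmult_l_distr iota_add)

lemma left_val_mult:
  "i \<in> left_dom X \<Longrightarrow> r \<in> carrier R \<Longrightarrow> X \<in> carrier S.Q \<Longrightarrow> left_val X (r \<otimes> i) = r \<otimes> left_val X i"
  using left_dom[of i X] by (intro left_val_eq) (simp_all add: S.Q.lsmult_assoc iota_lsmult)

lemma right_val_preimage: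
  assumes X: "X \<in> carrier S.Q" and J: "J \<in> snd F"
  shows "{j \<in> right_dom X. right_val X j \<in> J} \<in> snd F"
proof (rule right_gabriel_filter_preimage[OF right_gabriel dom_in_filter(1)[OF X] J])
  fix j assume "j \<in> right_dom X"
  note j = right_dom[OF this]
  show "right_val X j \<in> carrier R" by (rule j(2))
  show "right_val X (j \<otimes> r) = right_val X j \<otimes> r" if "r \<in> carrier R" for r
    using j X that by (intro right_val_eq) (simp_all add: S.Q.rsmult_assoc iota_rsmult)
  fix j' assume "j' \<in> right_dom X"
  note j' = right_dom[OF this]
  show "right_val X (j \<ominus> j') = right_val X j \<ominus> right_val X j'"
    using j j' X by (intro right_val_eq) (simp_all add: S.Q.diff_rsmult iota_diff)
qed

lemma left_val_preimage:
  assumes X: "X \<in> carrier S.Q" and I: "I \<in> fst F"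
  shows "{i \<in> left_dom X. left_val X i \<in> I} \<in> fst F"
proof (rule left_gabriel_filter_preimage[OF left_gabriel dom_in_filter(2)[OF X] I])
  fix i assume i': "i \<in> left_dom X"
  note i = left_dom[OF this]
  show "left_val X i \<in> carrier R" by (rule i(2))
  show "left_val X (r \<otimes> i) = r \<otimes> left_val X i" if "r \<in> carrier R" for r
    using i' that X by (rule left_val_mult)
  fix j assume "j \<in> left_dom X"
  note j = left_dom[OF this]
  show "left_val X (i \<ominus> j) = left_val X i \<ominus> left_val X j"
    using i j X by (intro left_val_eq) (simp_all add: S.Q.diff_lsmult iota_diff)
qed

text \<open>The candidate is realized from the composites i \<mapsto> (i X) Y and j \<mapsto> X (Y
  j), which are compatible by the associativity of the bimodule actions. Realization controls it
  only on \<open>?I\<close> and \<open>?J\<close>; the equations for all other elements multiplied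
  into \<open>R\<close> follow from torsion-freeness.\<close>

lemma is_product_exists:
  assumes X: "X \<in> carrier S.Q" and Y: "Y \<in> carrier S.Q"
  shows "\<exists>x. is_product X Y x"
proof -
  let ?I = "{i \<in> left_dom X. left_val X i \<in> left_dom Y}"
  let ?J = "{j \<in> right_dom Y. right_val Y j \<in> right_dom X}"
  let ?f = "\<lambda>i. left_val Y (left_val X i)" and ?g = "\<lambda>j. right_val X (right_val Y j)"
  have J: "?J \<in> snd F" using Y dom_in_filter(1)[OF X] by (rule right_val_preimage)
  have I: "?I \<in> fst F" using X dom_in_filter(2)[OF Y] by (rule left_val_preimage)
  have "compatible_pair R F ?I ?J ?f ?g"
  proof (intro compatible_pair.intro compatible_pair_axioms.intro faithful_theory_axioms I J)
    fix i assume i: "i \<in> ?I"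
    then have i1: "i \<in> left_dom X" and i2: "left_val X i \<in> left_dom Y" by auto
    show "?f i \<in> carrier R" using left_dom(2)[OF i2] .
    show "?f (i \<oplus> i') = ?f i \<oplus> ?f i'" if "i' \<in> ?I" for i'
      using that i X Y by (simp add: left_val_add)
    show "?f (r \<otimes> i) = r \<otimes> ?f i" if "r \<in> carrier R" for r
      using that i X Y by (simp add: left_val_mult)
    fix j assume j: "j \<in> ?J"
    then have j1: "j \<in> right_dom Y" and j2: "right_val Y j \<in> right_dom X" by auto
    note [simp] = left_dom[OF i1] left_dom[OF i2] right_dom[OF j1] right_dom[OF j2] X Y
    have "iota (?f i \<otimes> j) = rsmult S.Q (lsmult S.Q (left_val X i) Y) j"
      by (simp add: iota_rsmult)
    also have "\<dots> = lsmult S.Q (left_val X i) (rsmult S.Q Y j)"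
      by (rule S.Q.lsmult_rsmult) simp_all
    also have "\<dots> = iota (left_val X i \<otimes> right_val Y j)" by (simp add: iota_lsmult)
    also have "\<dots> = rsmult S.Q (lsmult S.Q i X) (right_val Y j)" by (simp add: iota_rsmult)
    also have "\<dots> = lsmult S.Q i (rsmult S.Q X (right_val Y j))"
      by (rule S.Q.lsmult_rsmult) simp_all
    also have "\<dots> = iota (i \<otimes> ?g j)" by (simp add: iota_lsmult)
    finally show "?f i \<otimes> j = i \<otimes> ?g j" by (intro iota_inj) simp_all
  next
    fix j assume "j \<in> ?J"
    then show "?g j \<in> carrier R" using right_dom(2) by blast
  qed
  from compatible_pair.realization[OF this]
  obtain x where x: "x \<in> carrier S.Q" and "\<forall>j\<in>?J. rsmult S.Q x j = iota (?g j)"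
    by (elim bexE conjE) (rule that)
  note xJ = bspec[OF this(2)]
  have J1: "rsmult S.Q Y j = iota (right_val Y j)" "right_val Y j \<in> carrier R" "j \<in> carrier R"
    "rsmult S.Q X (right_val Y j) = rsmult S.Q x j"
    if "j \<in> ?J" for j
    using right_dom[of j Y] right_dom[of "right_val Y j" X] xJ[OF that] that by auto
  have "is_product X Y x"
    unfolding is_product_def
  proof (intro conjI ballI impI x)
    fix j r assume j: "j \<in> carrier R" "r \<in> carrier R" "rsmult S.Q Y j = iota r"
    show "rsmult S.Q x j = rsmult S.Q X r"
    \<comment> \<open>Here \<open>j\<close> multiplies \<open>Y\<close> into \<open>R\<close> but
      need not lie in \<open>?J\<close>. The test elements \<open>k\<close> are those with j k in
      \<open>?J\<close>.\<close>
    proof (rule right_torsionfree)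
      show "right_colon R ?J j \<in> snd F"
        using J j(1) by (rule right_gabriel_filterD(4)[OF right_gabriel])
      fix k assume "k \<in> right_colon R ?J j"
      then have k: "k \<in> carrier R" "j \<otimes> k \<in> ?J" by (simp_all only: right_colon_def mem_Collect_eq)
      have "right_val Y (j \<otimes> k) = r \<otimes> k"
        using j k(1) Y by (intro right_val_eq) (simp_all add: S.Q.rsmult_assoc iota_rsmult)
      then have "rsmult S.Q X (r \<otimes> k) = rsmult S.Q x (j \<otimes> k)" using J1(4)[OF k(2)] by simp
      then show "rsmult S.Q (rsmult S.Q x j) k = rsmult S.Q (rsmult S.Q X r) k"
        using j k x X by (simp add: S.Q.rsmult_assoc)
    qed (use x X j in simp_all)
  next
    fix i r assume i: "i \<in> carrier R" "r \<in> carrier R" "lsmult S.Q i X = iota r"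
    show "lsmult S.Q i x = lsmult S.Q r Y"
    \<comment> \<open>The left equation is also tested on the right: for \<open>k\<close> in
      \<open>?J\<close> both sides become i (X (Y k)), rebracketed through elements of
      \<open>R\<close>.\<close>
    proof (rule right_torsionfree[OF _ _ J])
      fix k assume k: "k \<in> ?J"
      have "rsmult S.Q (lsmult S.Q i x) k = lsmult S.Q i (rsmult S.Q X (right_val Y k))"
        using S.Q.lsmult_rsmult[OF i(1) J1(3)[OF k] x] J1(4)[OF k] by simp
      also have "\<dots> = rsmult S.Q (iota r) (right_val Y k)"
        using S.Q.lsmult_rsmult[OF i(1) J1(2)[OF k] X] i(3) by simp
      also have "\<dots> = lsmult S.Q r (rsmult S.Q Y k)"
        using iota_rsmult[OF i(2) J1(2)[OF k]] iota_lsmult[OF i(2) J1(2)[OF k]] J1(1)[OF k] by simp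
      also have "\<dots> = rsmult S.Q (lsmult S.Q r Y) k"
        using S.Q.lsmult_rsmult[OF i(2) J1(3)[OF k] Y] by simp
      finally show "rsmult S.Q (lsmult S.Q i x) k = rsmult S.Q (lsmult S.Q r Y) k" .
    qed (use x Y i in simp_all)
  qed
  then show ?thesis ..
qed

text \<open>Right multiplication by one member \<open>J\<close> decides equality
  (\<open>right_torsionfree\<close>). In the form \<open>RQ_mult_eqI\<close> this reduces identities
  between products to a comparison of right actions on a member of choice.\<close>

lemma is_product_unique:
  assumes X: "X \<in> carrier S.Q" and Y: "Y \<in> carrier S.Q" and x: "is_product X Y x" and J: "J \<in> snd F"
    and y: "y \<in> carrier S.Q"
    and eq: "\<And>j. j \<in> J \<Longrightarrow> \<exists>r\<in>carrier R. rsmult S.Q Y j = iota r \<and> rsmult S.Q y j = rsmult S.Q X r"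
  shows "x = y"
proof (rule right_torsionfree[OF _ y J])
  show "x \<in> carrier S.Q" using x by (simp add: is_product_def)
  fix j assume j: "j \<in> J"
  then obtain r where "r \<in> carrier R" "rsmult S.Q Y j = iota r" "rsmult S.Q y j = rsmult S.Q X r"
    using eq by blast
  then show "rsmult S.Q x j = rsmult S.Q y j"
    using x snd_subset[OF J j] by (simp add: is_product_def)
qed

lemma is_product_RQ:
  assumes X: "X \<in> carrier S.Q" and Y: "Y \<in> carrier S.Q"
  shows "is_product X Y (X \<otimes>\<^bsub>RQ\<^esub> Y)"
proof -
  obtain x where x: "is_product X Y x" using is_product_exists[OF X Y] ..
  have "y = x" if y: "is_product X Y y" for y
  proof (rule is_product_unique[OF X Y y dom_in_filter(1)[OF Y]])
    show "x \<in> carrier S.Q" using x by (simp add: is_product_def)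
    fix j assume "j \<in> right_dom Y"
    from right_dom[OF this] x
    show "\<exists>r\<in>carrier R. rsmult S.Q Y j = iota r \<and> rsmult S.Q x j = rsmult S.Q X r"
      by (intro bexI[of _ "right_val Y j"]) (simp_all add: is_product_def)
  qed
  then have "is_product X Y (THE x. is_product X Y x)" using x by (rule theI[rotated])
  then show ?thesis by simp
qed

lemma RQ_mult_closed: "X \<in> carrier S.Q \<Longrightarrow> Y \<in> carrier S.Q \<Longrightarrow> X \<otimes>\<^bsub>RQ\<^esub> Y \<in> carrier S.Q"
  using is_product_RQ by (simp add: is_product_def)

lemma RQ_mult_rsmult:
  "X \<in> carrier S.Q \<Longrightarrow> Y \<in> carrier S.Q \<Longrightarrow> j \<in> carrier R \<Longrightarrow> r \<in> carrier R \<Longrightarrow>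
     rsmult S.Q Y j = iota r \<Longrightarrow> rsmult S.Q (X \<otimes>\<^bsub>RQ\<^esub> Y) j = rsmult S.Q X r"
  using is_product_RQ[of X Y] unfolding is_product_def by blast

lemma RQ_mult_eqI:
  assumes "X \<in> carrier S.Q" "Y \<in> carrier S.Q" "J \<in> snd F" "y \<in> carrier S.Q"
    and "\<And>j. j \<in> J \<Longrightarrow> \<exists>r\<in>carrier R. rsmult S.Q Y j = iota r \<and> rsmult S.Q y j = rsmult S.Q X r"
  shows "X \<otimes>\<^bsub>RQ\<^esub> Y = y"
  using is_product_unique[OF assms(1,2) is_product_RQ[OF assms(1,2)] assms(3-5)] .

lemma snd_carrier: "carrier R \<in> snd F"
  by (rule right_gabriel_filter_carrier[OF right_gabriel])

lemma RQ_one_left: "X \<in> carrier S.Q \<Longrightarrow> iota \<one> \<otimes>\<^bsub>RQ\<^esub> X = X"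
proof (rule RQ_mult_eqI[OF _ _ dom_in_filter(1)[of X]])
  fix j assume "j \<in> right_dom X"
  from right_dom[OF this] show "\<exists>r\<in>carrier R. rsmult S.Q X j = iota r \<and> rsmult S.Q X j = rsmult S.Q (iota \<one>) r"
    by (intro bexI[of _ "right_val X j"]) (simp_all flip: iota_rsmult)
qed simp_all

lemma RQ_mult_iota:
  assumes "X \<in> carrier S.Q" "r \<in> carrier R"
  shows "X \<otimes>\<^bsub>RQ\<^esub> iota r = rsmult S.Q X r"
proof (rule RQ_mult_eqI[OF _ _ snd_carrier])
  fix j assume "j \<in> carrier R"
  then show "\<exists>s\<in>carrier R. rsmult S.Q (iota r) j = iota s \<and> rsmult S.Q (rsmult S.Q X r) j = rsmult S.Q X s"
    using assms by (intro bexI[of _ "r \<otimes> j"]) (simp_all add: iota_rsmult S.Q.rsmult_assoc)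
qed (use assms in simp_all)

lemma RQ_iota_mult:
  assumes "X \<in> carrier S.Q" "r \<in> carrier R"
  shows "iota r \<otimes>\<^bsub>RQ\<^esub> X = lsmult S.Q r X"
proof (rule RQ_mult_eqI[OF _ _ dom_in_filter(1)])
  fix j assume "j \<in> right_dom X"
  note j = right_dom[OF this]
  show "\<exists>s\<in>carrier R. rsmult S.Q X j = iota s \<and> rsmult S.Q (lsmult S.Q r X) j = rsmult S.Q (iota r) s"
    using j assms S.Q.lsmult_rsmult[OF assms(2) j(1) assms(1)]
    by (intro bexI[of _ "right_val X j"]) (simp_all flip: iota_rsmult iota_lsmult)
qed (use assms in simp_all)

lemma RQ_ring: "ring RQ"
proof (rule ringI)
  show "abelian_group RQ"
    by (rule abelian_groupI) (auto simp: S.Q.M.a_ac intro: bexI[of _ "\<ominus>\<^bsub>S.Q\<^esub> _"] S.Q.M.l_neg)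
  show "Group.monoid RQ"
  \<comment> \<open>The fifth rule would unfold the product into its definite description; it is
    removed so that the product stays folded.\<close>
  proof (rule monoidI, simp_all del: RQ_simps(5) add: RQ_mult_closed RQ_one_left)
    show "X \<otimes>\<^bsub>RQ\<^esub> iota \<one> = X" if "X \<in> carrier S.Q" for X
      using that by (simp only: RQ_mult_iota one_closed S.Q.rsmult_one)
    fix X Y Z assume XYZ: "X \<in> carrier S.Q" "Y \<in> carrier S.Q" "Z \<in> carrier S.Q"
    \<comment> \<open>On \<open>?J\<close> both Z j and Y (Z j) lie in \<open>R\<close>, and each
      bracketing sends \<open>j\<close> to X (Y (Z j)).\<close>
    let ?J = "{j \<in> right_dom Z. right_val Z j \<in> right_dom Y}"
    show "X \<otimes>\<^bsub>RQ\<^esub> Y \<otimes>\<^bsub>RQ\<^esub> Z = X \<otimes>\<^bsub>RQ\<^esub> (Y \<otimes>\<^bsub>RQ\<^esub> Z)"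
    proof (rule RQ_mult_eqI)
      show "?J \<in> snd F" using XYZ(3) dom_in_filter(1)[OF XYZ(2)] by (rule right_val_preimage)
      fix j assume "j \<in> ?J"
      then have "j \<in> right_dom Z" "right_val Z j \<in> right_dom Y" by auto
      note j = right_dom[OF this(1)] right_dom[OF this(2)]
      have "rsmult S.Q (Y \<otimes>\<^bsub>RQ\<^esub> Z) j = iota (right_val Y (right_val Z j))"
        using RQ_mult_rsmult[OF XYZ(2,3) j(1) j(2) j(3)] j(6) by simp
      then have "rsmult S.Q (X \<otimes>\<^bsub>RQ\<^esub> (Y \<otimes>\<^bsub>RQ\<^esub> Z)) j = rsmult S.Q X (right_val Y (right_val Z j))"
        by (rule RQ_mult_rsmult[OF XYZ(1) RQ_mult_closed[OF XYZ(2,3)] j(1) j(5)])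
      moreover have "rsmult S.Q (X \<otimes>\<^bsub>RQ\<^esub> Y) (right_val Z j) = rsmult S.Q X (right_val Y (right_val Z j))"
        by (rule RQ_mult_rsmult[OF XYZ(1,2) j(2) j(5) j(6)])
      ultimately show "\<exists>r\<in>carrier R. rsmult S.Q Z j = iota r \<and>
          rsmult S.Q (X \<otimes>\<^bsub>RQ\<^esub> (Y \<otimes>\<^bsub>RQ\<^esub> Z)) j = rsmult S.Q (X \<otimes>\<^bsub>RQ\<^esub> Y) r"
        using j(2,3) by (intro bexI[of _ "right_val Z j"]) simp_all
    qed (intro RQ_mult_closed XYZ)+
  qed
  fix X Y Z assume "X \<in> carrier RQ" "Y \<in> carrier RQ" "Z \<in> carrier RQ"
  then have X: "X \<in> carrier S.Q" and Y: "Y \<in> carrier S.Q" and Z: "Z \<in> carrier S.Q" by simp_all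
  have XY: "X \<oplus>\<^bsub>S.Q\<^esub> Y \<in> carrier S.Q" using X Y by simp
  have "(X \<oplus>\<^bsub>S.Q\<^esub> Y) \<otimes>\<^bsub>RQ\<^esub> Z = X \<otimes>\<^bsub>RQ\<^esub> Z \<oplus>\<^bsub>S.Q\<^esub> Y \<otimes>\<^bsub>RQ\<^esub> Z"
  proof (rule RQ_mult_eqI[OF XY Z dom_in_filter(1)[OF Z]])
    show "X \<otimes>\<^bsub>RQ\<^esub> Z \<oplus>\<^bsub>S.Q\<^esub> Y \<otimes>\<^bsub>RQ\<^esub> Z \<in> carrier S.Q"
      by (intro S.Q.M.a_closed RQ_mult_closed X Y Z)
    fix j assume "j \<in> right_dom Z"
    note j = right_dom[OF this]
    have "rsmult S.Q (X \<otimes>\<^bsub>RQ\<^esub> Z \<oplus>\<^bsub>S.Q\<^esub> Y \<otimes>\<^bsub>RQ\<^esub> Z) j =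
        rsmult S.Q X (right_val Z j) \<oplus>\<^bsub>S.Q\<^esub> rsmult S.Q Y (right_val Z j)"
      using RQ_mult_rsmult[OF X Z j] RQ_mult_rsmult[OF Y Z j]
        S.Q.rsmult_l_distr[OF j(1) RQ_mult_closed[OF X Z] RQ_mult_closed[OF Y Z]] by simp
    then show "\<exists>r\<in>carrier R. rsmult S.Q Z j = iota r \<and>
        rsmult S.Q (X \<otimes>\<^bsub>RQ\<^esub> Z \<oplus>\<^bsub>S.Q\<^esub> Y \<otimes>\<^bsub>RQ\<^esub> Z) j = rsmult S.Q (X \<oplus>\<^bsub>S.Q\<^esub> Y) r"
      using j X Y by (intro bexI[of _ "right_val Z j"]) (simp_all only: S.Q.rsmult_l_distr simp_thms)
  qed
  then show "(X \<oplus>\<^bsub>RQ\<^esub> Y) \<otimes>\<^bsub>RQ\<^esub> Z = X \<otimes>\<^bsub>RQ\<^esub> Z \<oplus>\<^bsub>RQ\<^esub> Y \<otimes>\<^bsub>RQ\<^esub> Z"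
    by (simp only: RQ_simps(3))
  have "Z \<otimes>\<^bsub>RQ\<^esub> (X \<oplus>\<^bsub>S.Q\<^esub> Y) = Z \<otimes>\<^bsub>RQ\<^esub> X \<oplus>\<^bsub>S.Q\<^esub> Z \<otimes>\<^bsub>RQ\<^esub> Y"
  proof (rule RQ_mult_eqI[OF Z XY])
    show "right_dom X \<inter> right_dom Y \<in> snd F"
      using dom_in_filter(1)[OF X] dom_in_filter(1)[OF Y] by (rule right_gabriel_filterD(3)[OF right_gabriel])
    show "Z \<otimes>\<^bsub>RQ\<^esub> X \<oplus>\<^bsub>S.Q\<^esub> Z \<otimes>\<^bsub>RQ\<^esub> Y \<in> carrier S.Q"
      by (intro S.Q.M.a_closed RQ_mult_closed X Y Z)
    fix j assume "j \<in> right_dom X \<inter> right_dom Y"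
    then have "j \<in> right_dom X" "j \<in> right_dom Y" by auto
    note j = right_dom[OF this(1)] right_dom[OF this(2)]
    have "rsmult S.Q (Z \<otimes>\<^bsub>RQ\<^esub> X \<oplus>\<^bsub>S.Q\<^esub> Z \<otimes>\<^bsub>RQ\<^esub> Y) j =
        rsmult S.Q Z (right_val X j \<oplus> right_val Y j)"
      using RQ_mult_rsmult[OF Z X j(1-3)] RQ_mult_rsmult[OF Z Y j(4-6)] j
        S.Q.rsmult_l_distr[OF j(1) RQ_mult_closed[OF Z X] RQ_mult_closed[OF Z Y]] Z
      by (simp add: S.Q.rsmult_r_distr del: RQ_simps(5))
    then show "\<exists>r\<in>carrier R. rsmult S.Q (X \<oplus>\<^bsub>S.Q\<^esub> Y) j = iota r \<and>
        rsmult S.Q (Z \<otimes>\<^bsub>RQ\<^esub> X \<oplus>\<^bsub>S.Q\<^esub> Z \<otimes>\<^bsub>RQ\<^esub> Y) j = rsmult S.Q Z r"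
      using j X Y
      by (intro bexI[of _ "right_val X j \<oplus> right_val Y j"])
        (simp_all add: S.Q.rsmult_l_distr iota_add del: RQ_simps(5))
  qed
  then show "Z \<otimes>\<^bsub>RQ\<^esub> (X \<oplus>\<^bsub>RQ\<^esub> Y) = Z \<otimes>\<^bsub>RQ\<^esub> X \<oplus>\<^bsub>RQ\<^esub> Z \<otimes>\<^bsub>RQ\<^esub> Y"
    by (simp only: RQ_simps(3))
qed

lemma iota_ring_hom: "iota \<in> ring_hom R RQ"
  by (rule ring_hom_memI) (simp_all del: RQ_simps(5) add: RQ_mult_iota iota_rsmult iota_add)

text \<open>The inverse is realized from the maps x t \<mapsto> x on R t and t x \<mapsto> x on t R.
  They are well defined because \<open>t\<close> can be cancelled on both sides, and compatible
  since x (t y) = (x t) y.\<close>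

lemma RQ_inverse:
  assumes t: "t \<in> regular_elements R" and I: "{x \<otimes> t | x. x \<in> carrier R} \<in> fst F"
    and J: "{t \<otimes> x | x. x \<in> carrier R} \<in> snd F"
  shows "\<exists>y\<in>carrier RQ. iota t \<otimes>\<^bsub>RQ\<^esub> y = \<one>\<^bsub>RQ\<^esub> \<and> y \<otimes>\<^bsub>RQ\<^esub> iota t = \<one>\<^bsub>RQ\<^esub>"
proof -
  note t' = regular_elementsD[OF t]
  let ?I = "{x \<otimes> t | x. x \<in> carrier R}" and ?J = "{t \<otimes> x | x. x \<in> carrier R}"
  let ?f = "\<lambda>i. THE x. x \<in> carrier R \<and> i = x \<otimes> t" and ?g = "\<lambda>j. THE x. x \<in> carrier R \<and> j = t \<otimes> x"
  have f: "?f (x \<otimes> t) = x" if x: "x \<in> carrier R" for x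
  proof (rule the_equality)
    fix y assume y: "y \<in> carrier R \<and> x \<otimes> t = y \<otimes> t"
    then have "(x \<ominus> y) \<otimes> t = \<zero>" using x t'(1) by (simp add: minus_eq l_distr l_minus r_neg)
    then show "y = x" using t'(3)[of "x \<ominus> y"] x y diff_eq_zero_iff by auto
  qed (use x in simp)
  have g: "?g (t \<otimes> x) = x" if x: "x \<in> carrier R" for x
  proof (rule the_equality)
    fix y assume y: "y \<in> carrier R \<and> t \<otimes> x = t \<otimes> y"
    then have "t \<otimes> (x \<ominus> y) = \<zero>" using x t'(1) by (simp add: minus_eq r_distr r_minus r_neg)
    then show "y = x" using t'(2)[of "x \<ominus> y"] x y diff_eq_zero_iff by auto
  qed (use x in simp)
  have "compatible_pair R F ?I ?J ?f ?g"
  proof (intro compatible_pair.intro compatible_pair_axioms.intro faithful_theory_axioms I J)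
    fix i assume "i \<in> ?I"
    then obtain x where x: "x \<in> carrier R" "i = x \<otimes> t" by blast
    show "?f i \<in> carrier R" unfolding x(2) f[OF x(1)] by (rule x(1))
    show "?f (i \<oplus> i') = ?f i \<oplus> ?f i'" if i': "i' \<in> ?I" for i'
    proof -
      obtain x' where x': "x' \<in> carrier R" "i' = x' \<otimes> t" using i' by blast
      have "i \<oplus> i' = (x \<oplus> x') \<otimes> t" using x x' t'(1) by (simp add: l_distr)
      then show ?thesis using f[of "x \<oplus> x'"] f[OF x(1)] f[OF x'(1)] x x' by simp
    qed
    show "?f (r \<otimes> i) = r \<otimes> ?f i" if r: "r \<in> carrier R" for r
    proof -
      have "r \<otimes> i = (r \<otimes> x) \<otimes> t" using x r t'(1) by (simp add: m_assoc)
      then show ?thesis using f[of "r \<otimes> x"] f[OF x(1)] x r by simp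
    qed
    fix j assume "j \<in> ?J"
    then obtain y where y: "y \<in> carrier R" "j = t \<otimes> y" by blast
    show "?f i \<otimes> j = i \<otimes> ?g j"
      unfolding x(2) y(2) f[OF x(1)] g[OF y(1)] using x(1) y(1) t'(1) by (simp add: m_assoc)
  next
    fix j assume "j \<in> ?J"
    then obtain y where y: "y \<in> carrier R" "j = t \<otimes> y" by blast
    show "?g j \<in> carrier R" unfolding y(2) g[OF y(1)] by (rule y(1))
  qed
  from compatible_pair.realization[OF this]
  obtain y where y: "y \<in> carrier S.Q" and "\<forall>j\<in>?J. rsmult S.Q y j = iota (?g j)"
    by (elim bexE conjE) (rule that)
  note yJ = bspec[OF this(2)]
  have ty: "rsmult S.Q y (t \<otimes> x) = iota x" if "x \<in> carrier R" for x
    using yJ[of "t \<otimes> x"] g[OF that] that by auto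
  have "iota t \<otimes>\<^bsub>RQ\<^esub> y = iota \<one>"
  proof (rule RQ_mult_eqI[OF _ y J])
    fix j assume "j \<in> ?J"
    then obtain x where x: "x \<in> carrier R" "j = t \<otimes> x" by blast
    then show "\<exists>r\<in>carrier R. rsmult S.Q y j = iota r \<and> rsmult S.Q (iota \<one>) j = rsmult S.Q (iota t) r"
      using ty t'(1) by (intro bexI[of _ x]) (simp_all flip: iota_rsmult)
  qed (use t'(1) in simp_all)
  moreover have "y \<otimes>\<^bsub>RQ\<^esub> iota t = iota \<one>"
  proof (rule RQ_mult_eqI[OF y _ snd_carrier])
    fix j assume "j \<in> carrier R"
    then show "\<exists>r\<in>carrier R. rsmult S.Q (iota t) j = iota r \<and> rsmult S.Q (iota \<one>) j = rsmult S.Q y r"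
      using ty t'(1) by (intro bexI[of _ "t \<otimes> j"]) (simp_all flip: iota_rsmult)
  qed (use t'(1) in simp_all)
  ultimately show ?thesis using y by (intro bexI[of _ y]) (simp_all del: RQ_simps(5))
qed

end

section \<open>Perfect theories and the classical ring of quotients\<close>

lemma (in ring) generate_eq_carrier:
  assumes H: "H \<subseteq> carrier R" and "\<And>z. z \<in> carrier R \<Longrightarrow> z \<in> H"
  shows "generate (add_monoid R) H = carrier R"
  using assms add.generate_incl[of H] generate.incl[of _ H "add_monoid R"] by auto

lemma (in ring) generate_induct:
  assumes gen: "generate (add_monoid R) H = carrier R" and H: "H \<subseteq> carrier R"
    and "P \<zero>" and "\<And>h. h \<in> H \<Longrightarrow> P h"
    and "\<And>x y. x \<in> carrier R \<Longrightarrow> y \<in> carrier R \<Longrightarrow> P x \<Longrightarrow> P y \<Longrightarrow> P (x \<ominus> y)"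
    and "z \<in> carrier R"
  shows "P z"
proof -
  have "additive_subgroup {x \<in> carrier R. P x} R"
    using assms(3,5) by (simp add: additive_subgroup_iff)
  then have "generate (add_monoid R) H \<subseteq> {x \<in> carrier R. P x}"
    using H assms(4) by (intro add.generate_subgroup_incl) (auto dest: additive_subgroup.a_subgroup)
  then show ?thesis using assms(6) unfolding gen by blast
qed

context faithful_theory
begin

lemma RQ_diff: "x \<ominus>\<^bsub>RQ\<^esub> y = x \<ominus>\<^bsub>S.Q\<^esub> y"
  by (simp add: a_minus_def a_inv_def m_inv_def)

text \<open>Write 1 as a sum of products x \<cdot> \<open>iota i\<close> with \<open>i\<close> in
  \<open>I\<close>. Each \<open>x\<close> is multiplied into \<open>R\<close> from the left by a
  member of the filter, so the intersection of these members is contained in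
  \<open>I\<close>.\<close>

lemma perfect_pair_fst_subset: "fst (perfect_pair R RQ iota) \<subseteq> fst F"
proof
  fix I assume "I \<in> fst (perfect_pair R RQ iota)"
  then have I: "left_ideal R I"
    and gen: "generate (add_monoid RQ) {s \<otimes>\<^bsub>RQ\<^esub> iota i | s i. s \<in> carrier RQ \<and> i \<in> I} = carrier RQ"
      (is "generate _ ?H = _")
    by (simp_all add: perfect_pair_def del: RQ_simps)
  note I' = I[unfolded left_ideal_iff]
  have Ic: "i \<in> carrier R" if "i \<in> I" for i using I' that by blast
  \<comment> \<open>The property that some member multiplies \<open>w\<close> into the image of
    \<open>I\<close> is proved for every \<open>w\<close>, because it passes to differences and
    holds for the generators; 1 is the instance wanted.\<close>
  have "\<exists>V\<in>fst F. \<forall>v\<in>V. \<exists>r\<in>I. lsmult S.Q v (iota \<one>) = iota r"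
  proof (rule ring.generate_induct[OF RQ_ring gen])
    show "?H \<subseteq> carrier RQ" using RQ_mult_closed Ic unfolding RQ_simps(1) by auto
    show "\<exists>V\<in>fst F. \<forall>v\<in>V. \<exists>r\<in>I. lsmult S.Q v \<zero>\<^bsub>RQ\<^esub> = iota r"
      using I' iota_zero left_gabriel_filter_carrier[OF left_gabriel]
      by (auto simp: S.Q.lsmult_zero intro!: bexI[of _ "carrier R"] bexI[of _ \<zero>])
    show "iota \<one> \<in> carrier RQ" by simp
  next
    fix w assume "w \<in> ?H"
    then obtain x i where x: "x \<in> carrier S.Q" "i \<in> I" "w = x \<otimes>\<^bsub>RQ\<^esub> iota i"
      unfolding RQ_simps(1) by blast
    have w: "w = rsmult S.Q x i" unfolding x(3) using x(1) Ic[OF x(2)] by (rule RQ_mult_iota)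
    show "\<exists>V\<in>fst F. \<forall>v\<in>V. \<exists>r\<in>I. lsmult S.Q v w = iota r"
    proof (intro bexI[OF _ dom_in_filter(2)[OF x(1)]] ballI)
      fix v assume "v \<in> left_dom x"
      note v = left_dom[OF this]
      have "lsmult S.Q v w = iota (left_val x v \<otimes> i)"
        unfolding w using S.Q.lsmult_rsmult[OF v(1) Ic[OF x(2)] x(1)] v iota_rsmult[OF v(2) Ic[OF x(2)]]
        by simp
      then show "\<exists>r\<in>I. lsmult S.Q v w = iota r" using left_ideal_mult[OF I x(2) v(2)] by blast
    qed
  next
    fix h h' assume hh: "h \<in> carrier RQ" "h' \<in> carrier RQ"
      and "\<exists>V\<in>fst F. \<forall>v\<in>V. \<exists>r\<in>I. lsmult S.Q v h = iota r"
      and "\<exists>V\<in>fst F. \<forall>v\<in>V. \<exists>r\<in>I. lsmult S.Q v h' = iota r"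
    then obtain V V' where V: "V \<in> fst F" "\<forall>v\<in>V. \<exists>r\<in>I. lsmult S.Q v h = iota r"
      "V' \<in> fst F" "\<forall>v\<in>V'. \<exists>r\<in>I. lsmult S.Q v h' = iota r" by blast
    show "\<exists>V\<in>fst F. \<forall>v\<in>V. \<exists>r\<in>I. lsmult S.Q v (h \<ominus>\<^bsub>RQ\<^esub> h') = iota r"
    proof (intro bexI[OF _ left_gabriel_filterD(3)[OF left_gabriel V(1,3)]] ballI)
      fix v assume v: "v \<in> V \<inter> V'"
      then have vc: "v \<in> carrier R" using fst_subset[OF V(1)] by blast
      obtain r r' where r: "r \<in> I" "lsmult S.Q v h = iota r" "r' \<in> I" "lsmult S.Q v h' = iota r'"
        using V(2,4) v by blast
      have "lsmult S.Q v (h \<ominus>\<^bsub>RQ\<^esub> h') = iota (r \<ominus> r')"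
        using vc hh r Ic by (simp add: RQ_diff S.Q.lsmult_diff iota_diff)
      then show "\<exists>r\<in>I. lsmult S.Q v (h \<ominus>\<^bsub>RQ\<^esub> h') = iota r" using I' r(1,3) by blast
    qed
  qed
  then obtain V where V: "V \<in> fst F" "\<forall>v\<in>V. \<exists>r\<in>I. lsmult S.Q v (iota \<one>) = iota r" by blast
  have "V \<subseteq> I"
  proof
    fix v assume v: "v \<in> V"
    then have vc: "v \<in> carrier R" using fst_subset[OF V(1)] by blast
    obtain r where r: "r \<in> I" "lsmult S.Q v (iota \<one>) = iota r" using V(2) v by blast
    then have "v = r" using vc Ic[OF r(1)] iota_lsmult[OF vc one_closed] by (intro iota_inj) simp_all
    then show "v \<in> I" using r(1) by simp
  qed
  then show "I \<in> fst F" by (rule left_gabriel_filterD(2)[OF left_gabriel V(1) I])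
qed

text \<open>Argued directly on the right: germs live over the enveloping ring of \<open>R\<close>,
  so passing to \<open>opposite R\<close> would replace the ring of quotients by a different
  object.\<close>

lemma perfect_pair_snd_subset: "snd (perfect_pair R RQ iota) \<subseteq> snd F"
proof
  fix J assume "J \<in> snd (perfect_pair R RQ iota)"
  then have J: "right_ideal R J"
    and gen: "generate (add_monoid RQ) {iota i \<otimes>\<^bsub>RQ\<^esub> s | i s. i \<in> J \<and> s \<in> carrier RQ} = carrier RQ"
      (is "generate _ ?H = _")
    by (simp_all add: perfect_pair_def del: RQ_simps)
  note J' = J[unfolded right_ideal_iff]
  have Jc: "i \<in> carrier R" if "i \<in> J" for i using J' that by blast
  have "\<exists>V\<in>snd F. \<forall>v\<in>V. \<exists>r\<in>J. rsmult S.Q (iota \<one>) v = iota r"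
  proof (rule ring.generate_induct[OF RQ_ring gen])
    show "?H \<subseteq> carrier RQ" using RQ_mult_closed Jc unfolding RQ_simps(1) by auto
    show "\<exists>V\<in>snd F. \<forall>v\<in>V. \<exists>r\<in>J. rsmult S.Q \<zero>\<^bsub>RQ\<^esub> v = iota r"
      using J' iota_zero right_gabriel_filter_carrier[OF right_gabriel]
      by (auto simp: S.Q.rsmult_zero intro!: bexI[of _ "carrier R"] bexI[of _ \<zero>])
    show "iota \<one> \<in> carrier RQ" by simp
  next
    fix w assume "w \<in> ?H"
    then obtain x i where x: "x \<in> carrier S.Q" "i \<in> J" "w = iota i \<otimes>\<^bsub>RQ\<^esub> x"
      unfolding RQ_simps(1) by blast
    have w: "w = lsmult S.Q i x" unfolding x(3) using x(1) Jc[OF x(2)] by (rule RQ_iota_mult)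
    show "\<exists>V\<in>snd F. \<forall>v\<in>V. \<exists>r\<in>J. rsmult S.Q w v = iota r"
    proof (intro bexI[OF _ dom_in_filter(1)[OF x(1)]] ballI)
      fix v assume "v \<in> right_dom x"
      note v = right_dom[OF this]
      have "rsmult S.Q w v = iota (i \<otimes> right_val x v)"
        unfolding w using S.Q.lsmult_rsmult[OF Jc[OF x(2)] v(1) x(1)] v iota_lsmult[OF Jc[OF x(2)] v(2)]
        by simp
      then show "\<exists>r\<in>J. rsmult S.Q w v = iota r" using J' x(2) v(2) by blast
    qed
  next
    fix h h' assume hh: "h \<in> carrier RQ" "h' \<in> carrier RQ"
      and "\<exists>V\<in>snd F. \<forall>v\<in>V. \<exists>r\<in>J. rsmult S.Q h v = iota r"
      and "\<exists>V\<in>snd F. \<forall>v\<in>V. \<exists>r\<in>J. rsmult S.Q h' v = iota r"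
    then obtain V V' where V: "V \<in> snd F" "\<forall>v\<in>V. \<exists>r\<in>J. rsmult S.Q h v = iota r"
      "V' \<in> snd F" "\<forall>v\<in>V'. \<exists>r\<in>J. rsmult S.Q h' v = iota r" by blast
    show "\<exists>V\<in>snd F. \<forall>v\<in>V. \<exists>r\<in>J. rsmult S.Q (h \<ominus>\<^bsub>RQ\<^esub> h') v = iota r"
    proof (intro bexI[OF _ right_gabriel_filterD(3)[OF right_gabriel V(1,3)]] ballI)
      fix v assume v: "v \<in> V \<inter> V'"
      then have vc: "v \<in> carrier R" using snd_subset[OF V(1)] by blast
      obtain r r' where r: "r \<in> J" "rsmult S.Q h v = iota r" "r' \<in> J" "rsmult S.Q h' v = iota r'"
        using V(2,4) v by blast
      have "rsmult S.Q (h \<ominus>\<^bsub>RQ\<^esub> h') v = iota (r \<ominus> r')"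
        using vc hh r Jc by (simp add: RQ_diff S.Q.rsmult_diff iota_diff)
      then show "\<exists>r\<in>J. rsmult S.Q (h \<ominus>\<^bsub>RQ\<^esub> h') v = iota r" using J' r(1,3) by blast
    qed
  qed
  then obtain V where V: "V \<in> snd F" "\<forall>v\<in>V. \<exists>r\<in>J. rsmult S.Q (iota \<one>) v = iota r" by blast
  have "V \<subseteq> J"
  proof
    fix v assume v: "v \<in> V"
    then have vc: "v \<in> carrier R" using snd_subset[OF V(1)] by blast
    obtain r where r: "r \<in> J" "rsmult S.Q (iota \<one>) v = iota r" using V(2) v by blast
    then have "v = r" using vc Jc[OF r(1)] iota_rsmult[OF one_closed vc] by (intro iota_inj) simp_all
    then show "v \<in> J" using r(1) by simp
  qed
  then show "J \<in> snd F" by (rule right_gabriel_filterD(2)[OF right_gabriel V(1) J])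
qed

end

lemma (in ring) principal_left_ideal:
  assumes t: "t \<in> carrier R"
  shows "left_ideal R {x \<otimes> t | x. x \<in> carrier R}"
  unfolding left_ideal_iff
proof (intro conjI ballI subsetI)
  show "\<zero> \<in> {x \<otimes> t | x. x \<in> carrier R}" using t by (intro CollectI exI[of _ \<zero>]) simp
  fix i assume "i \<in> {x \<otimes> t | x. x \<in> carrier R}"
  then obtain x where x: "x \<in> carrier R" "i = x \<otimes> t" by blast
  show "i \<in> carrier R" using x t by simp
  show "r \<otimes> i \<in> {x \<otimes> t | x. x \<in> carrier R}" if "r \<in> carrier R" for r
    using x t that by (intro CollectI exI[of _ "r \<otimes> x"]) (simp add: m_assoc)
  fix i' assume "i' \<in> {x \<otimes> t | x. x \<in> carrier R}"
  then obtain x' where x': "x' \<in> carrier R" "i' = x' \<otimes> t" by blast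
  show "i \<ominus> i' \<in> {x \<otimes> t | x. x \<in> carrier R}"
    using x x' t by (intro CollectI exI[of _ "x \<ominus> x'"]) (simp add: minus_eq l_distr l_minus)
qed

text \<open>A member of a classical filter contains a regular element \<open>t\<close>. With
  \<open>y\<close> inverse to \<open>f t\<close>, every \<open>z\<close> is the single product (z y)
  \<cdot> f t, respectively f t \<cdot> (y z).\<close>

lemma classical_subset_perfect_pair:
  assumes R: "ring R" and S: "ring S" and f: "f \<in> ring_hom R S"
    and inv: "\<And>t. t \<in> regular_elements R \<Longrightarrow>
      \<exists>y\<in>carrier S. f t \<otimes>\<^bsub>S\<^esub> y = \<one>\<^bsub>S\<^esub> \<and> y \<otimes>\<^bsub>S\<^esub> f t = \<one>\<^bsub>S\<^esub>"
  shows "fst (classical_pair R) \<subseteq> fst (perfect_pair R S f)"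
    and "snd (classical_pair R) \<subseteq> snd (perfect_pair R S f)"
proof -
  interpret R: ring R by fact
  interpret S: ring S by fact
  show "fst (classical_pair R) \<subseteq> fst (perfect_pair R S f)"
  proof
    fix I assume I: "I \<in> fst (classical_pair R)"
    then have Il: "left_ideal R I" by (simp add: classical_pair_def)
    obtain t where t: "t \<in> regular_elements R" "t \<in> I" using I by (rule R.mem_classical_left)
    obtain y where y: "y \<in> carrier S" "y \<otimes>\<^bsub>S\<^esub> f t = \<one>\<^bsub>S\<^esub>" using inv[OF t(1)] by blast
    have tc: "f t \<in> carrier S" using f R.regular_elementsD(1)[OF t(1)] by (rule ring_hom_closed)
    have "generate (add_monoid S) {s \<otimes>\<^bsub>S\<^esub> f i | s i. s \<in> carrier S \<and> i \<in> I} = carrier S"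
    proof (rule S.generate_eq_carrier)
      show "{s \<otimes>\<^bsub>S\<^esub> f i | s i. s \<in> carrier S \<and> i \<in> I} \<subseteq> carrier S"
        using R.left_ideal_subset[OF Il] ring_hom_closed[OF f] by blast
      fix z assume z: "z \<in> carrier S"
      then have "z = (z \<otimes>\<^bsub>S\<^esub> y) \<otimes>\<^bsub>S\<^esub> f t" using y tc by (simp add: S.m_assoc)
      then show "z \<in> {s \<otimes>\<^bsub>S\<^esub> f i | s i. s \<in> carrier S \<and> i \<in> I}" using z y(1) t(2) by blast
    qed
    then show "I \<in> fst (perfect_pair R S f)" using Il by (simp add: perfect_pair_def)
  qed
  show "snd (classical_pair R) \<subseteq> snd (perfect_pair R S f)"
  proof
    fix J assume J: "J \<in> snd (classical_pair R)"
    then have Jr: "right_ideal R J" by (simp add: classical_pair_def)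
    obtain t where t: "t \<in> regular_elements R" "t \<in> J" using J by (rule R.mem_classical_right)
    obtain y where y: "y \<in> carrier S" "f t \<otimes>\<^bsub>S\<^esub> y = \<one>\<^bsub>S\<^esub>" using inv[OF t(1)] by blast
    have tc: "f t \<in> carrier S" using f R.regular_elementsD(1)[OF t(1)] by (rule ring_hom_closed)
    have "generate (add_monoid S) {f j \<otimes>\<^bsub>S\<^esub> s | j s. j \<in> J \<and> s \<in> carrier S} = carrier S"
    proof (rule S.generate_eq_carrier)
      have "J \<subseteq> carrier R" using Jr by (simp add: R.right_ideal_iff)
      then show "{f j \<otimes>\<^bsub>S\<^esub> s | j s. j \<in> J \<and> s \<in> carrier S} \<subseteq> carrier S"
        using ring_hom_closed[OF f] by blast
      fix z assume z: "z \<in> carrier S"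
      then have "z = f t \<otimes>\<^bsub>S\<^esub> (y \<otimes>\<^bsub>S\<^esub> z)" using y tc by (simp flip: S.m_assoc)
      then show "z \<in> {f j \<otimes>\<^bsub>S\<^esub> s | j s. j \<in> J \<and> s \<in> carrier S}" using z y(1) t(2) by blast
    qed
    then show "J \<in> snd (perfect_pair R S f)" using Jr by (simp add: perfect_pair_def)
  qed
qed

text \<open>If \<open>I\<close> annihilates \<open>x\<close>, then all of S f(I) = S annihilates
  \<open>f x\<close>. In particular 1 does, so \<open>f x\<close> is zero and injectivity gives x =
  0.\<close>

lemma perfect_pair_faithful:
  assumes R: "ring R" and S: "ring S" and f: "f \<in> ring_hom R S" and inj: "inj_on f (carrier R)"
    and gabriel: "gabriel_pair R (perfect_pair R S f)"
  shows "faithful_on_both_sides R (perfect_pair R S f)"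
proof -
  interpret R: ring R by fact
  interpret S: ring S by fact
  note fc = ring_hom_closed[OF f]
  have f0: "f \<zero>\<^bsub>R\<^esub> = \<zero>\<^bsub>S\<^esub>" using f R S by (rule ring_hom_zero)
  show ?thesis
    unfolding faithful_on_both_sides_def
  proof
    show "left_torsion (regular_bimodule R) (fst (perfect_pair R S f)) = {\<zero>\<^bsub>R\<^esub>}"
    proof (rule R.left_torsion_zeroI)
      show "left_gabriel_filter R (fst (perfect_pair R S f))" using gabriel by (simp add: gabriel_pair_def)
      fix x I assume x: "x \<in> carrier R" and I: "I \<in> fst (perfect_pair R S f)"
        and Ix: "\<And>a. a \<in> I \<Longrightarrow> a \<otimes>\<^bsub>R\<^esub> x = \<zero>\<^bsub>R\<^esub>"
      let ?H = "{s \<otimes>\<^bsub>S\<^esub> f i | s i. s \<in> carrier S \<and> i \<in> I}"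
      have gen: "generate (add_monoid S) ?H = carrier S" and Il: "left_ideal R I"
        using I by (simp_all add: perfect_pair_def)
      have "\<one>\<^bsub>S\<^esub> \<otimes>\<^bsub>S\<^esub> f x = \<zero>\<^bsub>S\<^esub>"
      proof (rule S.generate_induct[OF gen, where P = "\<lambda>w. w \<otimes>\<^bsub>S\<^esub> f x = \<zero>\<^bsub>S\<^esub>"])
        show "?H \<subseteq> carrier S" using fc R.left_ideal_subset[OF Il] by blast
        fix w assume "w \<in> ?H"
        then obtain s i where s: "s \<in> carrier S" "i \<in> I" "w = s \<otimes>\<^bsub>S\<^esub> f i" by blast
        have ic: "i \<in> carrier R" using R.left_ideal_subset[OF Il] s(2) by blast
        have "f i \<otimes>\<^bsub>S\<^esub> f x = \<zero>\<^bsub>S\<^esub>" using ring_hom_mult[OF f ic x] Ix[OF s(2)] f0 by simp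
        then show "w \<otimes>\<^bsub>S\<^esub> f x = \<zero>\<^bsub>S\<^esub>" using s ic fc x by (simp add: S.m_assoc)
      qed (use fc[OF x] in \<open>simp_all add: S.minus_eq S.l_distr S.l_minus\<close>)
      then show "x = \<zero>\<^bsub>R\<^esub>" using fc[OF x] f0 inj x by (simp add: inj_on_def)
    qed
    show "right_torsion (regular_bimodule R) (snd (perfect_pair R S f)) = {\<zero>\<^bsub>R\<^esub>}"
    proof (rule R.right_torsion_zeroI)
      show "right_gabriel_filter R (snd (perfect_pair R S f))" using gabriel by (simp add: gabriel_pair_def)
      fix x J assume x: "x \<in> carrier R" and J: "J \<in> snd (perfect_pair R S f)"
        and Jx: "\<And>a. a \<in> J \<Longrightarrow> x \<otimes>\<^bsub>R\<^esub> a = \<zero>\<^bsub>R\<^esub>"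
      let ?H = "{f j \<otimes>\<^bsub>S\<^esub> s | j s. j \<in> J \<and> s \<in> carrier S}"
      have gen: "generate (add_monoid S) ?H = carrier S" and Jr: "right_ideal R J"
        using J by (simp_all add: perfect_pair_def)
      have Jc: "J \<subseteq> carrier R" using Jr by (simp add: R.right_ideal_iff)
      have "f x \<otimes>\<^bsub>S\<^esub> \<one>\<^bsub>S\<^esub> = \<zero>\<^bsub>S\<^esub>"
      proof (rule S.generate_induct[OF gen, where P = "\<lambda>w. f x \<otimes>\<^bsub>S\<^esub> w = \<zero>\<^bsub>S\<^esub>"])
        show "?H \<subseteq> carrier S" using fc Jc by blast
        fix w assume "w \<in> ?H"
        then obtain s j where s: "s \<in> carrier S" "j \<in> J" "w = f j \<otimes>\<^bsub>S\<^esub> s" by blast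
        have jc: "j \<in> carrier R" using Jc s(2) by blast
        have "f x \<otimes>\<^bsub>S\<^esub> f j = \<zero>\<^bsub>S\<^esub>" using ring_hom_mult[OF f x jc] Jx[OF s(2)] f0 by simp
        then show "f x \<otimes>\<^bsub>S\<^esub> w = \<zero>\<^bsub>S\<^esub>" using s jc fc x by (simp flip: S.m_assoc)
      qed (use fc[OF x] in \<open>simp_all add: S.minus_eq S.r_distr S.r_minus\<close>)
      then show "x = \<zero>\<^bsub>R\<^esub>" using fc[OF x] f0 inj x by (simp add: inj_on_def)
    qed
  qed
qed

lemma total_perfect_pair:
  assumes R: "ring R" and total: "total_symmetric_ring_of_quotients R S f"
  shows "gabriel_pair R (perfect_pair R S f)"
    and "symmetric_filter R (perfect_pair R S f) \<subseteq> symmetric_filter R (lambek_pair R)"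
proof -
  have p: "ring S" "f \<in> ring_hom R S" "gabriel_pair R (perfect_pair R S f)" "inj_on f (carrier R)"
    using total by (auto simp: total_symmetric_ring_of_quotients_def
        perfect_symmetric_ring_of_quotients_def)
  show "gabriel_pair R (perfect_pair R S f)" by fact
  show "symmetric_filter R (perfect_pair R S f) \<subseteq> symmetric_filter R (lambek_pair R)"
    using p perfect_pair_faithful[OF R p(1,2,4,3)] by (intro ring.faithful_on_both_sides_lambek[OF R])
qed

text \<open>Regular elements become invertible in the classical ring of quotients, which is therefore
  perfect and maps to the total one. Hence they are invertible there as well.\<close>

lemma classical_total:
  assumes R: "ring R" and ore: "left_ore R" "right_ore R"
    and total: "total_symmetric_ring_of_quotients R S f"
  shows "symmetric_filter R (classical_pair R) \<subseteq> symmetric_filter R (perfect_pair R S f)"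
proof -
  interpret R: ring R by fact
  interpret C: faithful_theory R "classical_pair R"
    by (intro faithful_theory.intro symmetric_theory.intro symmetric_theory_axioms.intro
        faithful_theory_axioms.intro R R.classical_gabriel_pair R.classical_faithful)
  have inv: "\<exists>y\<in>carrier C.RQ. C.iota t \<otimes>\<^bsub>C.RQ\<^esub> y = \<one>\<^bsub>C.RQ\<^esub> \<and> y \<otimes>\<^bsub>C.RQ\<^esub> C.iota t = \<one>\<^bsub>C.RQ\<^esub>"
    if t: "t \<in> regular_elements R" for t
  proof (rule C.RQ_inverse[OF t])
    have tc: "t \<in> carrier R" using t by (rule R.regular_elementsD(1))
    have "left_ideal R {x \<otimes>\<^bsub>R\<^esub> t | x. x \<in> carrier R}" using tc by (rule R.principal_left_ideal)
    \<comment> \<open>The left Ore condition at \<open>r\<close> and \<open>t\<close> says that a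
      left multiple s r by a regular \<open>s\<close> lies in R t.\<close>
    moreover have "\<exists>s\<in>regular_elements R. s \<otimes>\<^bsub>R\<^esub> r \<in> {x \<otimes>\<^bsub>R\<^esub> t | x. x \<in> carrier R}"
      if "r \<in> carrier R" for r
      using ore(1) that t unfolding left_ore_def by blast
    ultimately show "{x \<otimes>\<^bsub>R\<^esub> t | x. x \<in> carrier R} \<in> fst (classical_pair R)"
      by (simp add: classical_pair_def)
    have "right_ideal R {t \<otimes>\<^bsub>R\<^esub> x | x. x \<in> carrier R}"
      using ring.principal_left_ideal[OF R.opposite_ring, of t] tc by simp
    moreover have "\<exists>s\<in>regular_elements R. r \<otimes>\<^bsub>R\<^esub> s \<in> {t \<otimes>\<^bsub>R\<^esub> x | x. x \<in> carrier R}"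
      if "r \<in> carrier R" for r
      using ore(2) that t unfolding right_ore_def by blast
    ultimately show "{t \<otimes>\<^bsub>R\<^esub> x | x. x \<in> carrier R} \<in> snd (classical_pair R)"
      by (simp add: classical_pair_def)
  qed
  \<comment> \<open>The filters read off from the classical ring of quotients are the classical ones
    again: one inclusion holds for every faithful theory, the other because regular elements are
    invertible.\<close>
  have pair: "perfect_pair R C.RQ C.iota = classical_pair R"
    using C.perfect_pair_fst_subset C.perfect_pair_snd_subset
      classical_subset_perfect_pair[OF R C.RQ_ring C.iota_ring_hom inv]
    by (intro prod_eqI equalityI)
  have "perfect_symmetric_ring_of_quotients R C.RQ C.iota"
    unfolding perfect_symmetric_ring_of_quotients_def pair
  proof (intro conjI C.RQ_ring C.iota_ring_hom R.classical_gabriel_pair bexI ballI)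
    \<comment> \<open>After rewriting with \<open>pair\<close>, the ring of quotients of the perfect
      pair is the classical one itself, so the isomorphism is the identity.\<close>
    show "id \<in> ring_iso C.RQ C.RQ" by (simp add: ring_iso_def ring_hom_def del: C.RQ_simps)
  qed simp
  moreover have "inj_on C.iota (carrier R)" by (intro inj_onI C.iota_inj)
  ultimately obtain h where h: "h \<in> ring_hom C.RQ S" "\<forall>r\<in>carrier R. h (C.iota r) = f r"
    using total unfolding total_symmetric_ring_of_quotients_def by blast
  have S: "ring S" "f \<in> ring_hom R S"
    using total by (auto simp: total_symmetric_ring_of_quotients_def
        perfect_symmetric_ring_of_quotients_def)
  have "\<exists>y\<in>carrier S. f t \<otimes>\<^bsub>S\<^esub> y = \<one>\<^bsub>S\<^esub> \<and> y \<otimes>\<^bsub>S\<^esub> f t = \<one>\<^bsub>S\<^esub>" if t: "t \<in> regular_elements R" for t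
  proof -
    have tc: "t \<in> carrier R" using t by (rule R.regular_elementsD(1))
    have itc: "C.iota t \<in> carrier C.RQ" using C.iota_ring_hom tc by (rule ring_hom_closed)
    obtain y where y: "y \<in> carrier C.RQ" "C.iota t \<otimes>\<^bsub>C.RQ\<^esub> y = \<one>\<^bsub>C.RQ\<^esub>" "y \<otimes>\<^bsub>C.RQ\<^esub> C.iota t = \<one>\<^bsub>C.RQ\<^esub>"
      using inv[OF t] by blast
    have "f t \<otimes>\<^bsub>S\<^esub> h y = \<one>\<^bsub>S\<^esub>"
      using ring_hom_mult[OF h(1) itc y(1)] y(2) ring_hom_one[OF h(1)] h(2) tc by metis
    moreover have "h y \<otimes>\<^bsub>S\<^esub> f t = \<one>\<^bsub>S\<^esub>"
      using ring_hom_mult[OF h(1) y(1) itc] y(3) ring_hom_one[OF h(1)] h(2) tc by metis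
    ultimately show ?thesis using ring_hom_closed[OF h(1) y(1)] by blast
  qed
  note subset = classical_subset_perfect_pair[OF R S this]
  show ?thesis by (rule R.symmetric_filter_mono[OF subset])
qed

text \<open>Agreement is formulated along an inclusion of symmetric filters. The clauses for
  arbitrary faithful theories therefore assert existence of the extension, agreement under an
  inclusion in either direction, and the inclusion itself when both one-sided torsion submodules of
  \<open>R\<close> vanish. For the named theories the inclusions are established outright.\<close>

theorem corollary5:
  fixes R :: "('a, 'c) ring_scheme"
    and M :: "('a, 'm, 'e) bimodule_scheme"
    and S :: "('s, 'b) ring_scheme"
    and \<delta> :: "'a \<Rightarrow> 'a" and d :: "'m \<Rightarrow> 'm" and f :: "'a \<Rightarrow> 's"
  assumes "ring R" and "derivation R \<delta>"
    and "bimodule R M" and "module_derivation R M \<delta> d"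
  shows
    "((\<forall>F. gabriel_pair R F \<and> faithful R F \<longrightarrow>
        extends R (regular_bimodule R) \<delta> \<delta> F \<and>
        (faithful_on_both_sides R F \<longrightarrow>
           symmetric_filter R F \<subseteq> symmetric_filter R (lambek_pair R)) \<and>
        (symmetric_filter R F \<subseteq> symmetric_filter R (lambek_pair R) \<longrightarrow>
           extensions_agree R (regular_bimodule R) \<delta> \<delta> F (lambek_pair R)) \<and>
        (symmetric_filter R (lambek_pair R) \<subseteq> symmetric_filter R F \<longrightarrow>
           extensions_agree R (regular_bimodule R) \<delta> \<delta> (lambek_pair R) F)) \<and>
      (total_symmetric_ring_of_quotients R S f \<longrightarrow>
        extensions_agree R (regular_bimodule R) \<delta> \<delta> (perfect_pair R S f) (lambek_pair R))) \<and>

     ((\<forall>F. gabriel_pair R F \<and> differential R F \<and> faithful R F \<longrightarrow>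
        extends R M \<delta> d F \<and>
        (faithful_on_both_sides R F \<longrightarrow>
           symmetric_filter R F \<subseteq> symmetric_filter R (lambek_pair R)) \<and>
        (symmetric_filter R F \<subseteq> symmetric_filter R (lambek_pair R) \<longrightarrow>
           extensions_agree R M \<delta> d F (lambek_pair R)) \<and>
        (symmetric_filter R (lambek_pair R) \<subseteq> symmetric_filter R F \<longrightarrow>
           extensions_agree R M \<delta> d (lambek_pair R) F)) \<and>
      (total_symmetric_ring_of_quotients R S f \<longrightarrow>
        extensions_agree R M \<delta> d (perfect_pair R S f) (lambek_pair R))) \<and>

     (left_ore R \<and> right_ore R \<longrightarrow>
        extensions_agree R (regular_bimodule R) \<delta> \<delta> (classical_pair R) (lambek_pair R) \<and>
        (total_symmetric_ring_of_quotients R S f \<longrightarrow>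
          extensions_agree R (regular_bimodule R) \<delta> \<delta> (classical_pair R) (perfect_pair R S f))) \<and>

     (\<forall>G. goldie_pair R G \<longrightarrow>
        extensions_agree R (regular_bimodule R) \<delta> \<delta> (lambek_pair R) G \<and>
        (\<forall>F. gabriel_pair R F \<and> faithful R F \<longrightarrow>
           extends R (regular_bimodule R) \<delta> \<delta> F \<and>
           (faithful_on_both_sides R F \<longrightarrow> symmetric_filter R F \<subseteq> symmetric_filter R G) \<and>
           (symmetric_filter R F \<subseteq> symmetric_filter R G \<longrightarrow>
              extensions_agree R (regular_bimodule R) \<delta> \<delta> F G) \<and>
           (symmetric_filter R G \<subseteq> symmetric_filter R F \<longrightarrow>
              extensions_agree R (regular_bimodule R) \<delta> \<delta> G F)))"
proof -
  interpret R: ring R by fact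
  note regular = R.regular_bimodule_bimodule derivation_module_derivation[OF assms(2)]
  note lambek = R.lambek_gabriel_pair
  note extR = module_derivation_extends[OF regular(1) _ assms(2) regular(2)]
    and extM = module_derivation_extends[OF assms(3) _ assms(2,4)]
  note agreeR = extensions_agree_of_filter_inclusion[OF regular(1) _ _ assms(2) regular(2)]
    and agreeM = extensions_agree_of_filter_inclusion[OF assms(3) _ _ assms(2,4)]
  note total = total_perfect_pair[OF assms(1)]
  note classical = R.classical_gabriel_pair
    R.faithful_on_both_sides_lambek[OF R.classical_gabriel_pair R.classical_faithful]
  have goldie: "gabriel_pair R G" if "goldie_pair R G" for G
    using that by (simp add: goldie_pair_def)
  show ?thesis
    \<comment> \<open>After splitting, each goal asks for an extension, an inclusion or an
      agreement. The inclusion into the Goldie filter is composed of the ones into the Lambek filter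
      and from there into the Goldie filter.\<close>
    by (intro conjI allI impI; (elim conjE)?)
      (assumption | rule extR extM agreeR agreeM lambek classical
        | erule total goldie R.lambek_goldie
        | rule classical_total[OF assms(1)] R.faithful_on_both_sides_lambek
            subset_trans[OF R.faithful_on_both_sides_lambek R.lambek_goldie])+
qed

end
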